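(* Let $d=2$, let $F=G/H^p$ with singular variety $\mathcal{V}=\{x\in\mathcal{D}: H(x)=0\}$ be as in the context, and let $\alpha\in\mathbb{N}_+^2$. If $c\in\mathcal{V}$ is strictly minimal, smooth with $c_2\,\partial_2 H(c)\neq0$, critical and isolated for $\alpha$, and $v\ge2$ is least such that $\widetilde g^{(v)}(0)\ne0$, then for all $N\in\mathbb{N}$, $$F_{n\alpha}=c^{-n\alpha}\Bigg[\frac{(a\alpha_2n)^{-1/v}}{\pi v}\sum_{j=0}^{p-1}\sum_{k=0}^{N-1}\frac{(\alpha_2n+1)^{\overline{p-1-j}}}{(p-1-j)!\,j!}(\alpha_2n)^{-2k/v}L^{\text{even}}_k(\widetilde u_j,\widetilde g)+O\left(n^{p-1-(2N+1)/v}\right)\Bigg]$$ as $n\to\infty$ for $v$ even, and $$F_{n\alpha}=c^{-n\alpha}\Bigg[\frac{(|a|\alpha_2n)^{-1/v}}{2\pi v}\sum_{j=0}^{p-1}\sum_{k=0}^{N-1}\frac{(\alpha_2n+1)^{\overline{p-1-j}}}{(p-1-j)!\,j!}(\alpha_2n)^{-k/v}L^{\text{odd}}_k(\widetilde u_j,\widetilde g)+O\left(n^{p-1-(N+1)/v}\right)\Bigg]$$ as $n\to\infty$ for $v$ odd. Here $$L^{\text{even}}_k(\widetilde u_j,\widetilde g)=\sum_{l=0}^{2k}\frac{(-1)^l\,\Gamma\!\left(\frac{2k+vl+1}{v}\right)}{l!\,(2k+vl)!}\left(a^{-1/v}\frac{d}{dt}\right)^{2k+vl}(\widetilde u_j\,\underline{\widetilde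 g}^{\,l})(t_0),$$ $$L^{\text{odd}}_k(\widetilde u_j,\widetilde g)=\sum_{l=0}^{k}\frac{(-1)^l\,\Gamma\!\left(\frac{k+vl+1}{v}\right)}{l!\,(k+vl)!}\left(\zeta^{k+vl+1}+(-1)^{k+vl}\zeta^{-(k+vl+1)}\right)\left(|a|^{-1/v}\,i\,\operatorname{sgn}a\,\frac{d}{dt}\right)^{k+vl}(\widetilde u_j\,\underline{\widetilde g}^{\,l})(t_0),$$ $\underline{\widetilde g}(t)=\widetilde g(t)-\widetilde g(t_0)-a(t-t_0)^v$, $a=\widetilde g^{(v)}(t_0)/v!$, $\zeta=e^{i\pi/(2v)}$, and $t_0=0$. In every term of $L^{\text{even}}_k(\widetilde u_j,\widetilde g)$ the total number of derivatives of $\widetilde u_j$ and of $\widetilde g^{(v)}$ is at most $2k$, and in $L^{\text{odd}}_k(\widetilde u_j,\widetilde g)$ at most $k$.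
   Context: Setting. $\mathbb{N}=\{0,1,2,\dots\}$, $\mathbb{N}_+=\mathbb{N}\setminus\{0\}$. $d=2$, $p\in\mathbb{N}_+$; $\mathcal{D}\subseteq\mathbb{C}^2$ is a nonempty open connected set; $G,H:\mathcal{D}\to\mathbb{C}$ are holomorphic and relatively prime in the ring of holomorphic functions on $\mathcal{D}$; $\mathcal{V}=\{x\in\mathcal{D}:H(x)=0\}$ is nonempty and $0\in\mathcal{D}\setminus\mathcal{V}$. $F=G/H^p$ on $\mathcal{D}\setminus\mathcal{V}$, with Maclaurin coefficients $F_\beta=\partial^\beta F(0)/\beta!$, $\beta\in\mathbb{N}^2$. $n\alpha=(n\alpha_1,n\alpha_2)$, $x^\alpha=x_1^{\alpha_1}x_2^{\alpha_2}$. Rising factorial: $r^{\overline{k}}=r(r+1)\cdots(r+k-1)$, $r^{\overline{0}}=1$. Points of $\mathcal{V}$. $c\in\mathcal{V}$ is strictly minimal if $x=c$ is the only $x\in\mathcal{V}$ with $|x_j|\le|c_j|$ for all $j$. $c$ is smooth if $(\partial_1H(x),\partial_2H(x))\ne0$ for all $x$ in a neighbourhood of $c$. A smooth point $c$ is critical for $\alpha$ if $\alpha_1^{-1}c_1\partial_1H(c)=\alpha_2^{-1}c_2\partial_2H(c)$; it is isolated for $\alpha$ if moreover it has a neighbourhood in which it is the only critical point for $\alpha$. Associated functions. Let $c$ be smooth with $c_2\partial_2H(c)\ne0$. By the implicit function theorem there are a bounded neighbourhood $W\subseteq\mathbb{C}$ of $c_1$ and a holomorphic $h:W\to\mathbb{C}\setminus\{0\}$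 with $h(c_1)=c_2$, $(w,h(w))\in\mathcal{V}$ and $\partial_2H(w,h(w))\neq0$ for all $w\in W$. For $0\le j<p$ put $u_j(w)=\lim_{y\to h(w)}(-y)^{-p+j}\frac{\partial^j}{\partial y^j}\big((y-h(w))^pF(w,y)\big)$ for $w\in W$; $E(t)=c_1e^{it}$ for $t\in[-1,1]$; and on $E^{-1}(W)$: $\widetilde u_j=u_j\circ E$, $\widetilde h=h\circ E$, and (for $c$ critical for $\alpha$) $\widetilde g(t)=\log\big(\widetilde h(t)/\widetilde h(0)\big)+i\frac{\alpha_1}{\alpha_2}t$, where $\log$ is the continuous branch with $\log1=0$ near $t=0$. These are $C^\infty$ functions. Conventions: for $z\in\mathbb{C}\setminus\{0\}$ with $\arg z\in[-\pi/2,\pi/2]$, $z^{-1/v}=|z|^{-1/v}e^{-i\arg z/v}$. $\operatorname{sgn}$ is the usual complex sign, $\operatorname{sgn}z=z/|z|$ for $z\neq0$.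
   Formalization: Assumes in addition that 𝒟 contains the closed polydisc |x_1|≤|c_1|, |x_2|≤|c_2|; without it the claim fails, e.g. 𝒟={x_1≠1/3}, G=1/(1-3x_1), H=1-x_1-x_2, p=1, α=(1,1), c=(1/2,1/2). *)

theory Defs
  imports "HOL-Analysis.Analysis" "HOL-Library.Landau_Symbols"
begin

(* Complex differentiability in two variables: a complex-linear Frechet derivative at each point.
   Only used for open sets. *)
definition holomorphic2_on :: "(complex \<times> complex \<Rightarrow> complex) \<Rightarrow> (complex \<times> complex) set \<Rightarrow> bool" where
  "holomorphic2_on f D \<longleftrightarrow>
     (\<forall>x\<in>D. \<exists>A B. (f has_derivative (\<lambda>z. A * fst z + B * snd z)) (at x))"

(* Every common divisor in the ring of holomorphic functions on D is a unit of that ring. *)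
definition relatively_prime_on ::
    "(complex \<times> complex) set \<Rightarrow> (complex \<times> complex \<Rightarrow> complex) \<Rightarrow> (complex \<times> complex \<Rightarrow> complex) \<Rightarrow> bool" where
  "relatively_prime_on D G H \<longleftrightarrow>
     (\<forall>K A B. holomorphic2_on K D \<and> holomorphic2_on A D \<and> holomorphic2_on B D \<and>
        (\<forall>x\<in>D. G x = K x * A x \<and> H x = K x * B x) \<longrightarrow>
        (\<exists>L. holomorphic2_on L D \<and> (\<forall>x\<in>D. K x * L x = 1)))"

definition pd1 :: "(complex \<times> complex \<Rightarrow> complex) \<Rightarrow> complex \<times> complex \<Rightarrow> complex" where
  "pd1 f x = deriv (\<lambda>z. f (z, snd x)) (fst x)"

definition pd2 :: "(complex \<times> complex \<Rightarrow> complex) \<Rightarrow> complex \<times> complex \<Rightarrow> complex" where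
  "pd2 f x = deriv (\<lambda>z. f (fst x, z)) (snd x)"

definition maclaurin_coeff :: "(complex \<times> complex \<Rightarrow> complex) \<Rightarrow> nat \<Rightarrow> nat \<Rightarrow> complex" where
  "maclaurin_coeff f m n = (pd1 ^^ m) ((pd2 ^^ n) f) (0, 0) / (fact m * fact n)"

definition strictly_minimal :: "(complex \<times> complex) set \<Rightarrow> complex \<times> complex \<Rightarrow> bool" where
  "strictly_minimal V c \<longleftrightarrow> c \<in> V \<and>
     (\<forall>x\<in>V. cmod (fst x) \<le> cmod (fst c) \<and> cmod (snd x) \<le> cmod (snd c) \<longrightarrow> x = c)"

(* D is an arbitrary domain, so it has to be required to contain the closed polydisc through c:
   for D = {(x, y). x \<noteq> 1/3}, G = 1/(1 - 3x), H = 1 - x - y, p = 1, alpha = (1, 1) and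
   c = (1/2, 1/2), the point c satisfies all the other conditions, with v = 2, but F_(n,n) grows
   at least like (9/2)^n up to a polynomial factor, while c^(-n alpha) = 4^n. *)
definition closed_polydisc :: "complex \<Rightarrow> complex \<Rightarrow> (complex \<times> complex) set" where
  "closed_polydisc c1 c2 = {(x, y). cmod x \<le> cmod c1 \<and> cmod y \<le> cmod c2}"

definition smooth_point ::
    "(complex \<times> complex \<Rightarrow> complex) \<Rightarrow> (complex \<times> complex) set \<Rightarrow> complex \<times> complex \<Rightarrow> bool" where
  "smooth_point H V c \<longleftrightarrow> c \<in> V \<and> (\<forall>\<^sub>F x in nhds c. (pd1 H x, pd2 H x) \<noteq> (0, 0))"

definition critical_point ::
    "(complex \<times> complex \<Rightarrow> complex) \<Rightarrow> (complex \<times> complex) set \<Rightarrow> nat \<Rightarrow> nat \<Rightarrow> complex \<times> complex \<Rightarrow> bool" where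
  "critical_point H V \<alpha>1 \<alpha>2 c \<longleftrightarrow> smooth_point H V c \<and>
     fst c * pd1 H c / of_nat \<alpha>1 = snd c * pd2 H c / of_nat \<alpha>2"

definition isolated_critical_point ::
    "(complex \<times> complex \<Rightarrow> complex) \<Rightarrow> (complex \<times> complex) set \<Rightarrow> nat \<Rightarrow> nat \<Rightarrow> complex \<times> complex \<Rightarrow> bool" where
  "isolated_critical_point H V \<alpha>1 \<alpha>2 c \<longleftrightarrow> critical_point H V \<alpha>1 \<alpha>2 c \<and>
     (\<forall>\<^sub>F x in at c. \<not> critical_point H V \<alpha>1 \<alpha>2 x)"

definition implicit_branch ::
    "(complex \<times> complex \<Rightarrow> complex) \<Rightarrow> (complex \<times> complex) set \<Rightarrow> complex \<Rightarrow> complex \<Rightarrow>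
     complex set \<Rightarrow> (complex \<Rightarrow> complex) \<Rightarrow> bool" where
  "implicit_branch H V c1 c2 W h \<longleftrightarrow>
     open W \<and> bounded W \<and> c1 \<in> W \<and> h holomorphic_on W \<and> h c1 = c2 \<and>
     (\<forall>w\<in>W. h w \<noteq> 0 \<and> (w, h w) \<in> V \<and> pd2 H (w, h w) \<noteq> 0)"

definition assoc_u ::
    "nat \<Rightarrow> (complex \<times> complex \<Rightarrow> complex) \<Rightarrow> (complex \<Rightarrow> complex) \<Rightarrow> nat \<Rightarrow> complex \<Rightarrow> complex" where
  "assoc_u p F h j w =
     Lim (at (h w)) (\<lambda>y. (- y) powi (int j - int p) *
       (deriv ^^ j) (\<lambda>z. (z - h w) ^ p * F (w, z)) y)"

(* The functions of t below are total on the reals, but only their germs at t = 0 are ever used: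
   there circle c1 t lies in W, and the principal Ln is the continuous branch with log 1 = 0. *)
definition circle :: "complex \<Rightarrow> real \<Rightarrow> complex" where
  "circle c1 t = c1 * exp (\<i> * of_real t)"

definition assoc_u_tilde ::
    "nat \<Rightarrow> (complex \<times> complex \<Rightarrow> complex) \<Rightarrow> (complex \<Rightarrow> complex) \<Rightarrow> complex \<Rightarrow> nat \<Rightarrow> real \<Rightarrow> complex" where
  "assoc_u_tilde p F h c1 j t = assoc_u p F h j (circle c1 t)"

definition assoc_g_tilde :: "(complex \<Rightarrow> complex) \<Rightarrow> complex \<Rightarrow> nat \<Rightarrow> nat \<Rightarrow> real \<Rightarrow> complex" where
  "assoc_g_tilde h c1 \<alpha>1 \<alpha>2 t =
     Ln (h (circle c1 t) / h (circle c1 0)) + \<i> * (of_nat \<alpha>1 / of_nat \<alpha>2) * of_real t"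

definition ddt :: "(real \<Rightarrow> complex) \<Rightarrow> real \<Rightarrow> complex" where
  "ddt f t = vector_derivative f (at t)"

definition scaled_ddt :: "complex \<Rightarrow> (real \<Rightarrow> complex) \<Rightarrow> real \<Rightarrow> complex" where
  "scaled_ddt b f t = b * ddt f t"

(* The number a and the function g with a bar below it, at t_0 = 0. *)
definition phase_coeff :: "nat \<Rightarrow> (real \<Rightarrow> complex) \<Rightarrow> complex" where
  "phase_coeff v g = (ddt ^^ v) g 0 / fact v"

definition phase_rest :: "nat \<Rightarrow> (real \<Rightarrow> complex) \<Rightarrow> real \<Rightarrow> complex" where
  "phase_rest v g t = g t - g 0 - phase_coeff v g * of_real t ^ v"

(* Complex powr is exp (s * Ln z) with the principal Ln, so z powr (-1/v) equals
   |z| powr (-1/v) * exp (- i * Arg z / v), for arg z in [-pi/2, pi/2] in particular. *)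
definition scale_even :: "nat \<Rightarrow> (real \<Rightarrow> complex) \<Rightarrow> complex" where
  "scale_even v g = phase_coeff v g powr (- 1 / of_nat v)"

definition scale_odd :: "nat \<Rightarrow> (real \<Rightarrow> complex) \<Rightarrow> complex" where
  "scale_odd v g =
     of_real (cmod (phase_coeff v g) powr (- 1 / real v)) * \<i> * sgn (phase_coeff v g)"

definition L_even_term :: "nat \<Rightarrow> nat \<Rightarrow> nat \<Rightarrow> (real \<Rightarrow> complex) \<Rightarrow> (real \<Rightarrow> complex) \<Rightarrow> complex" where
  "L_even_term v k l u g =
     (- 1) ^ l * of_real (Gamma (real (2 * k + v * l + 1) / real v)) / (fact l * fact (2 * k + v * l)) *
     (scaled_ddt (scale_even v g) ^^ (2 * k + v * l)) (\<lambda>t. u t * phase_rest v g t ^ l) 0"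

definition L_even :: "nat \<Rightarrow> nat \<Rightarrow> (real \<Rightarrow> complex) \<Rightarrow> (real \<Rightarrow> complex) \<Rightarrow> complex" where
  "L_even v k u g = (\<Sum>l\<le>2 * k. L_even_term v k l u g)"

definition zeta_root :: "nat \<Rightarrow> complex" where
  "zeta_root v = exp (\<i> * of_real pi / (2 * of_nat v))"

definition L_odd_term :: "nat \<Rightarrow> nat \<Rightarrow> nat \<Rightarrow> (real \<Rightarrow> complex) \<Rightarrow> (real \<Rightarrow> complex) \<Rightarrow> complex" where
  "L_odd_term v k l u g =
     (- 1) ^ l * of_real (Gamma (real (k + v * l + 1) / real v)) / (fact l * fact (k + v * l)) *
     (zeta_root v powi int (k + v * l + 1) +
        (- 1) ^ (k + v * l) * zeta_root v powi (- int (k + v * l + 1))) *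
     (scaled_ddt (scale_odd v g) ^^ (k + v * l)) (\<lambda>t. u t * phase_rest v g t ^ l) 0"

definition L_odd :: "nat \<Rightarrow> nat \<Rightarrow> (real \<Rightarrow> complex) \<Rightarrow> (real \<Rightarrow> complex) \<Rightarrow> complex" where
  "L_odd v k u g = (\<Sum>l\<le>k. L_odd_term v k l u g)"

definition smooth_near_0 :: "(real \<Rightarrow> complex) \<Rightarrow> bool" where
  "smooth_near_0 f \<longleftrightarrow> (\<forall>\<^sub>F t in nhds 0. \<forall>n. (ddt ^^ n) f differentiable (at t))"

definition phase_of_order :: "nat \<Rightarrow> (real \<Rightarrow> complex) \<Rightarrow> bool" where
  "phase_of_order v g \<longleftrightarrow> smooth_near_0 g \<and>
     (\<forall>i. 1 \<le> i \<and> i < v \<longrightarrow> (ddt ^^ i) g 0 = 0) \<and> (ddt ^^ v) g 0 \<noteq> 0"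

(* A polynomial in the derivatives at 0 of u and of the v-th derivative of g. The term with index
   (s, q) contains the s-th derivative of u and, for each entry r of q, the r-th derivative of
   the v-th derivative of g, and so s + sum_list q derivatives in total, which is at most M. *)
definition derivative_polynomial ::
    "nat \<Rightarrow> nat \<Rightarrow> nat \<Rightarrow> (nat \<Rightarrow> nat list \<Rightarrow> complex) \<Rightarrow> (real \<Rightarrow> complex) \<Rightarrow> (real \<Rightarrow> complex) \<Rightarrow> complex" where
  "derivative_polynomial v M l C u g =
     (\<Sum>(s, q) \<in> {(s, q). length q = l \<and> s + sum_list q \<le> M}.
        C s q * (ddt ^^ s) u 0 * (\<Prod>r\<leftarrow>q. (ddt ^^ r) ((ddt ^^ v) g) 0))"

(* T is such a polynomial, up to a power of the scale b. The coefficients C are chosen before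
   u and g; this is what makes counting derivatives in the terms of T meaningful. The pairs in P
   are covered in addition to all smooth u and all smooth phases g of order v. *)
definition derivatives_at_most ::
    "nat \<Rightarrow> nat \<Rightarrow> nat \<Rightarrow> nat \<Rightarrow> ((real \<Rightarrow> complex) \<Rightarrow> complex) \<Rightarrow>
     ((real \<Rightarrow> complex) \<Rightarrow> (real \<Rightarrow> complex) \<Rightarrow> complex) \<Rightarrow>
     ((real \<Rightarrow> complex) \<times> (real \<Rightarrow> complex)) set \<Rightarrow> bool" where
  "derivatives_at_most v M m l b T P \<longleftrightarrow>
     (\<exists>C. \<forall>u g. (smooth_near_0 u \<and> phase_of_order v g) \<or> (u, g) \<in> P \<longrightarrow>
        T u g = b g ^ m * derivative_polynomial v M l C u g)"

end

theory Submission
  imports Defs "HOL-Complex_Analysis.Complex_Analysis" "HOL-Real_Asymp.Real_Asymp"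
begin

text \<open>For fixed \<open>w\<close> with \<open>|w| \<le> |c\<^sub>1|\<close>, the Taylor coefficient of order
  \<open>n\<alpha>\<^sub>2\<close> at 0 of the slice \<open>F(w, \<cdot>)\<close> is holomorphic in \<open>w\<close>, and
  \<open>F\<^sub>n\<^sub>\<alpha>\<close> is a Fourier coefficient of its restriction to the circle
  \<open>|w| = |c\<^sub>1|\<close>. Strict minimality and compactness give a radius
  \<open>R > |c\<^sub>2|\<close> such that in \<open>|y| \<le> R\<close> the slice has no pole if \<open>w\<close>
  is away from \<open>c\<^sub>1\<close>, and only the pole \<open>h(w)\<close> if \<open>w\<close> is near
  \<open>c\<^sub>1\<close>. Up to an error of the order of \<open>R\<close> to the power \<open>- n\<alpha>\<^sub>2\<close>, the
  coefficient is therefore minus a residue, which is a sum of terms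
  \<open>u\<^sub>j(w) h(w)\<close> to the power \<open>- n\<alpha>\<^sub>2\<close> times a polynomial in \<open>n\<close>. This leaves the Laplace
  integrals of \<open>u\<^sub>j exp(- n\<alpha>\<^sub>2 g)\<close> along a short real interval about 0.

  The phase \<open>g = a t\<^sup>v + r(t)\<close> is analytic, with positive real part for
  real \<open>t \<noteq> 0\<close>, so each half of the interval can be replaced by the ray on which
  \<open>a t\<^sup>v\<close> is positive, at the cost of an exponentially small arc. On the ray,
  \<open>exp(- n\<alpha>\<^sub>2 r)\<close> is expanded into its Taylor polynomial and the result integrated
  term by term against \<open>exp(- n\<alpha>\<^sub>2 |a| t\<^sup>v)\<close>. The two rays contribute the same
  terms up to sign if \<open>v\<close> is even, and terms with conjugate powers of
  \<open>\<zeta>\<close> if \<open>v\<close> is odd.\<close>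

section \<open>Laplace integrals with a real phase\<close>

text \<open>The analytic core is stated for a continuous parameter x, later equal to
  \<open>\<alpha>2 * n\<close>: neither u_j nor g depends on n, and the rising factorials stay
  outside the integrals. Scaling dictates the double sums. Under exp(- x a t^v), t has size
  x^(-1/v). Expanding exp(- x r) gives terms x^l u r^l, and a Taylor term t^m of u r^l contributes
  the power x^(l - (m+1)/v). For the power x^(-(k+1)/v) this forces m = k + v l; as r vanishes to
  order v + 1, the term is zero unless l <= k.

  The obstacle is an imaginary a, the only possibility for odd v: on the real axis exp(- x a t^v)
  then merely oscillates and all decay comes from r, so the path has to turn before r may be
  expanded. It can turn because t -> c1 exp(i t) is entire, so that all functions of t extend to a
  complex disc. Each requirement on the interval length holds for all small lengths; in the form of
  eventual statements at 0 from the right they are met by one length d, for all j, all truncation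
  orders and the localisation at once.\<close>

lemma moment_has_integral:
  fixes c :: real and m v :: nat
  assumes "v \<ge> 1" "c > 0"
  shows "((\<lambda>t. t ^ m * exp (- (c * t ^ v))) has_integral
           Gamma (real (m + 1) / real v) / real v * c powr (- (real (m + 1) / real v))) {0..}"
proof -
  define s where "s = real (m + 1) / real v"
  have s: "s > 0" using assms by (simp add: s_def)
  define f where "f = (\<lambda>x::real. x powr (s - 1) / exp x)"
  \<comment> \<open>The substitution y = c t^v carries the Gamma integral at s = (m+1)/v into the
    moment. It is made on the open half-line because the \<open>powr\<close> identities in
    \<open>eq\<close> need t > 0.\<close>
  define G where "G = (\<lambda>t::real. c * t ^ v)"
  define G' where "G' = (\<lambda>t::real. c * (real v * t ^ (v - 1)))"
  have spike: "(h has_integral i) {0<..} \<longleftrightarrow> (h has_integral i) {0..}" for h :: "real \<Rightarrow> real" and i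
    by (rule has_integral_spike_set_eq) (auto intro: negligible_subset[of "{0}"])
  have fint: "(f has_integral Gamma s) {0<..}"
    using Gamma_integral_real[OF s] unfolding spike f_def .
  have fabs: "f absolutely_integrable_on {0<..}"
    by (rule nonnegative_absolutely_integrable_1) (use fint in \<open>auto simp: f_def has_integral_integrable\<close>)
  have img: "G ` {0<..} = {0<..}"
  proof (intro equalityI subsetI)
    fix y :: real assume y: "y \<in> {0<..}"
    have "G (root v (y / c)) = y" using assms y by (simp add: G_def)
    moreover have "root v (y / c) \<in> {0<..}" using assms y by simp
    ultimately show "y \<in> G ` {0<..}" by (metis imageI)
  qed (use assms in \<open>auto simp: G_def\<close>)
  have inj: "inj_on G {0<..}"
    by (rule inj_onI) (use assms in \<open>auto simp: G_def intro: power_eq_imp_eq_base\<close>)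
  have der: "\<And>x. x \<in> {0<..} \<Longrightarrow> (G has_field_derivative G' x) (at x within {0<..})"
    unfolding G_def G'_def by (auto intro!: derivative_eq_intros)
  have eq: "\<bar>G' t\<bar> * f (G t) = real v * c powr s * (t ^ m * exp (- (c * t ^ v)))" if "t > 0" for t
  proof -
    have "t ^ (v - 1) * (t ^ v) powr (s - 1) = t powr (real v - 1) * t powr (real v * (s - 1))"
      using that assms by (simp add: powr_powr of_nat_diff flip: powr_realpow)
    also have "\<dots> = t powr (real v * s - 1)"
      by (simp add: powr_add[symmetric] algebra_simps)
    also have "real v * s - 1 = real m" using assms by (simp add: s_def)
    finally have 1: "t ^ (v - 1) * (t ^ v) powr (s - 1) = t ^ m" using that by (simp add: powr_realpow)
    have 2: "c * c powr (s - 1) = c powr s" using assms by (simp add: powr_diff)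
    have "\<bar>G' t\<bar> * f (G t) = real v * (c * c powr (s - 1)) * (t ^ (v - 1) * (t ^ v) powr (s - 1)) * exp (- (c * t ^ v))"
      using that assms by (simp add: G'_def f_def G_def powr_mult exp_minus field_simps abs_mult)
    then show ?thesis using 1 2 by simp
  qed
  have "(\<lambda>x. \<bar>G' x\<bar> * f (G x)) absolutely_integrable_on {0<..} \<and>
         integral {0<..} (\<lambda>x. \<bar>G' x\<bar> * f (G x)) = Gamma s"
    using has_absolute_integral_change_of_variables_1'[OF _ der inj, of f "Gamma s"] fabs fint img
    by (auto simp: integral_unique)
  then have "((\<lambda>x. \<bar>G' x\<bar> * f (G x)) has_integral Gamma s) {0<..}"
    using set_lebesgue_integral_eq_integral(1) by (metis integrable_integral)
  then have "((\<lambda>t. real v * c powr s * (t ^ m * exp (- (c * t ^ v)))) has_integral Gamma s) {0<..}"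
    by (rule has_integral_eq[rotated]) (use eq in auto)
  then have "((\<lambda>t. (real v * c powr s * (t ^ m * exp (- (c * t ^ v)))) * (1 / (real v * c powr s)))
               has_integral Gamma s * (1 / (real v * c powr s))) {0<..}"
    by (rule has_integral_mult_left)
  then show ?thesis
    unfolding spike using assms by (simp add: s_def powr_minus field_simps)
qed

text \<open>The integral of t^m exp(- c t^v) over the half-line, by
  \<open>moment_has_integral\<close>.\<close>

definition moment :: "nat \<Rightarrow> nat \<Rightarrow> real \<Rightarrow> real" where
  "moment v m c = Gamma (real (m + 1) / real v) / real v * c powr (- (real (m + 1) / real v))"

lemma moment_scale:
  assumes "x > 0" "b > 0"
  shows "moment v m (x * b) = moment v m b * x powr (- (real (m + 1) / real v))"
  using assms by (simp add: moment_def powr_mult)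

text \<open>Half of the exponent pays for the tail: beyond d the factor exp(- c t^v / 2) is at most
  exp(- c d^v / 2), and the other half still has a finite moment. For d > 0, cutting at d therefore
  costs an amount exponentially small in c.\<close>

lemma moment_partial:
  fixes c d :: real
  assumes "v \<ge> 1" "c > 0" "d \<ge> 0"
  shows "integral {0..d} (\<lambda>t. t ^ m * exp (- (c * t ^ v))) \<le> moment v m c"
    and "\<bar>integral {0..d} (\<lambda>t. t ^ m * exp (- (c * t ^ v))) - moment v m c\<bar>
           \<le> exp (- (c * d ^ v / 2)) * moment v m (c / 2)"
proof -
  define f where "f = (\<lambda>t::real. t ^ m * exp (- (c * t ^ v)))"
  define I where "I = integral {0..d} f"
  have full: "(f has_integral moment v m c) {0..}"
    unfolding f_def moment_def by (rule moment_has_integral) (use assms in auto)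
  have half: "((\<lambda>t. exp (- (c * d ^ v / 2)) * (t ^ m * exp (- (c / 2 * t ^ v)))) has_integral
      exp (- (c * d ^ v / 2)) * moment v m (c / 2)) {0..}"
    unfolding moment_def
    by (intro has_integral_mult_right moment_has_integral) (use assms in auto)
  have "f integrable_on {0..d}"
    unfolding f_def by (intro integrable_continuous_interval continuous_intros)
  then have "(f has_integral I) {0..d}" by (simp add: I_def integrable_integral)
  then have part: "((\<lambda>t. if t \<in> {0..d} then f t else 0) has_integral I) {0..}"
    by (subst has_integral_restrict) auto
  have diff: "((\<lambda>t. f t - (if t \<in> {0..d} then f t else 0)) has_integral moment v m c - I) {0..}"
    by (rule has_integral_diff[OF full part])
  have lo: "0 \<le> moment v m c - I"
    by (rule has_integral_nonneg[OF diff]) (auto simp: f_def)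
  then show "integral {0..d} (\<lambda>t. t ^ m * exp (- (c * t ^ v))) \<le> moment v m c"
    by (simp add: I_def f_def)
  have "moment v m c - I \<le> exp (- (c * d ^ v / 2)) * moment v m (c / 2)"
  proof (rule has_integral_le[OF diff half])
    fix t :: real assume t: "t \<in> {0..}"
    show "f t - (if t \<in> {0..d} then f t else 0) \<le> exp (- (c * d ^ v / 2)) * (t ^ m * exp (- (c / 2 * t ^ v)))"
    proof (cases "t \<le> d")
      case False
      then have "d ^ v \<le> t ^ v" using assms by (intro power_mono) auto
      then have "c * d ^ v \<le> c * t ^ v" using assms by simp
      then have "exp (- (c * t ^ v)) \<le> exp (- (c * d ^ v / 2)) * exp (- (c / 2 * t ^ v))"
        by (simp flip: exp_add)
      then have "t ^ m * exp (- (c * t ^ v)) \<le> t ^ m * (exp (- (c * d ^ v / 2)) * exp (- (c / 2 * t ^ v)))"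
        by (rule mult_left_mono) (use t in auto)
      then show ?thesis using False by (simp add: f_def mult_ac)
    qed (use t in \<open>auto simp: f_def\<close>)
  qed
  with lo show "\<bar>integral {0..d} (\<lambda>t. t ^ m * exp (- (c * t ^ v))) - moment v m c\<bar>
           \<le> exp (- (c * d ^ v / 2)) * moment v m (c / 2)"
    by (simp add: I_def f_def)
qed

abbreviation cpowr :: "real \<Rightarrow> real \<Rightarrow> complex" where
  "cpowr s \<equiv> (\<lambda>x. of_real (x powr s))"

text \<open>A Poincare expansion in powers of x^(-1/v). The quantifier over M is part of the notion,
  so that an interval length chosen beforehand serves every truncation order.\<close>

definition laplace_expansion :: "(real \<Rightarrow> complex) \<Rightarrow> nat \<Rightarrow> (nat \<Rightarrow> complex) \<Rightarrow> bool" where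
  "laplace_expansion J v c \<longleftrightarrow> (\<forall>M. (\<lambda>x. J x - (\<Sum>k<M. cpowr (- (real (k + 1) / real v)) x * c k))
     \<in> O[at_top](cpowr (- (real (M + 1) / real v))))"

lemma exp_times_powr_bigo:
  assumes "\<kappa> > 0"
  shows "(\<lambda>x. of_real (exp (- (\<kappa> * x)) * x powr q) :: complex) \<in> O[at_top](cpowr s)"
proof -
  have "(\<lambda>x. exp (- (\<kappa> * x)) * x powr q :: real) \<in> O[at_top](\<lambda>x. x powr s)"
    using assms by real_asymp
  then show ?thesis
    by (subst landau_o.big.norm_iff[symmetric]) (simp add: landau_o.big.norm_iff norm_mult abs_mult)
qed

text \<open>Watson's lemma at one fixed order n: the Taylor remainder contributes at most K times
  the n-th moment, which has exactly the order of the error, and replacing truncated moments by full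
  ones costs only exponentially small terms.\<close>

lemma watson:
  fixes f :: "real \<Rightarrow> complex" and c :: "nat \<Rightarrow> complex"
  assumes "v \<ge> 1" "b > 0" "d > 0" and cont: "continuous_on {0..d} f"
    and taylor: "\<And>t. t \<in> {0..d} \<Longrightarrow> norm (f t - (\<Sum>m<n. c m * of_real t ^ m)) \<le> K * t ^ n"
  shows "(\<lambda>x. integral {0..d} (\<lambda>t. f t * of_real (exp (- (x * b * t ^ v)))) -
              (\<Sum>m<n. c m * of_real (moment v m (x * b))))
           \<in> O[at_top](cpowr (- (real (n + 1) / real v)))" (is "?lhs \<in> _")
proof -
  define e where "e = (\<lambda>x t::real. exp (- (x * b * t ^ v)))"
  define P where "P = (\<lambda>m x. integral {0..d} (\<lambda>t. t ^ m * e x t))"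
  define R where "R = (\<lambda>x. integral {0..d} (\<lambda>t. (f t - (\<Sum>m<n. c m * of_real t ^ m)) * of_real (e x t)))"
  have Rbig: "R \<in> O[at_top](cpowr (- (real (n + 1) / real v)))"
  proof (rule bigoI[where c = "K * moment v n b"])
    show "\<forall>\<^sub>F x in at_top. norm (R x) \<le> K * moment v n b * norm (cpowr (- (real (n + 1) / real v)) x)"
      using eventually_gt_at_top[of 0]
    proof eventually_elim
      fix x :: real assume x: "x > 0"
      \<comment> \<open>The Taylor hypothesis at t = d bounds a norm by K d^n with d^n > 0, so K
        cannot be negative.\<close>
      have K: "K \<ge> 0" using order_trans[OF norm_ge_zero taylor[of d]] \<open>d > 0\<close>
        by (metis atLeastAtMost_iff less_imp_le order_refl zero_le_mult_iff zero_less_power not_less)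
      have R1: "norm (R x) \<le> integral {0..d} (\<lambda>t. K * (t ^ n * e x t))"
        unfolding R_def
      proof (rule integral_norm_bound_integral)
        show "norm ((f t - (\<Sum>m<n. c m * of_real t ^ m)) * of_real (e x t)) \<le> K * (t ^ n * e x t)"
          if "t \<in> {0..d}" for t
          using mult_right_mono[OF taylor[OF that], of "e x t"] by (simp add: norm_mult e_def mult_ac)
      qed (auto simp: e_def intro!: integrable_continuous_interval continuous_intros cont)
      have R2: "integral {0..d} (\<lambda>t. K * (t ^ n * e x t)) = K * P n x" by (simp add: P_def)
      have "P n x \<le> moment v n (x * b)"
        unfolding P_def e_def using moment_partial(1)[of v "x * b" d n] assms x by simp
      also have "\<dots> = moment v n b * x powr (- (real (n + 1) / real v))"
        by (rule moment_scale) (use x assms in auto)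
      finally have "K * P n x \<le> K * (moment v n b * x powr (- (real (n + 1) / real v)))"
        using K by (rule mult_left_mono)
      then show "norm (R x) \<le> K * moment v n b * norm (cpowr (- (real (n + 1) / real v)) x)"
        using order_trans[OF R1[unfolded R2]] by (simp add: mult_ac)
    qed
  qed
  have Pbig: "(\<lambda>x. of_real (P m x - moment v m (x * b))) \<in> O[at_top](cpowr s)" for m s
  proof -
    have "(\<lambda>x. of_real (P m x - moment v m (x * b)) :: complex) \<in>
        O[at_top](\<lambda>x. of_real (exp (- (b * d ^ v / 2 * x)) * x powr (- (real (m + 1) / real v))))"
    proof (rule bigoI[where c = "moment v m (b / 2)"])
      show "\<forall>\<^sub>F x in at_top. norm (of_real (P m x - moment v m (x * b)) :: complex) \<le> moment v m (b / 2) *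
         norm (of_real (exp (- (b * d ^ v / 2 * x)) * x powr (- (real (m + 1) / real v))) :: complex)"
        using eventually_gt_at_top[of 0]
      proof eventually_elim
        fix x :: real assume x: "x > 0"
        have "\<bar>P m x - moment v m (x * b)\<bar> \<le> exp (- (x * b * d ^ v / 2)) * moment v m (x * b / 2)"
          unfolding P_def e_def using moment_partial(2)[of v "x * b" d m] assms x by simp
        also have "moment v m (x * b / 2) = moment v m (b / 2) * x powr (- (real (m + 1) / real v))"
          using moment_scale[of x "b / 2" v m] x assms by simp
        finally show "norm (of_real (P m x - moment v m (x * b)) :: complex) \<le> moment v m (b / 2) *
           norm (of_real (exp (- (b * d ^ v / 2 * x)) * x powr (- (real (m + 1) / real v))) :: complex)"
          unfolding norm_of_real by (simp add: abs_mult mult_ac)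
      qed
    qed
    also have "(\<lambda>x. of_real (exp (- (b * d ^ v / 2 * x)) * x powr (- (real (m + 1) / real v))) :: complex)
        \<in> O[at_top](cpowr s)"
      by (rule exp_times_powr_bigo) (use assms in auto)
    finally show ?thesis .
  qed
  have "?lhs x = R x + (\<Sum>m<n. c m * of_real (P m x - moment v m (x * b)))" for x
  proof -
    have int1: "(\<lambda>t. c m * of_real (t ^ m * e x t)) integrable_on {0..d}" for m
      by (auto simp: e_def intro!: integrable_continuous_interval continuous_intros)
    have "integral {0..d} (\<lambda>t. f t * of_real (e x t)) =
        integral {0..d} (\<lambda>t. (f t - (\<Sum>m<n. c m * of_real t ^ m)) * of_real (e x t)
          + (\<Sum>m<n. c m * of_real (t ^ m * e x t)))"
      by (rule arg_cong[of _ _ "integral {0..d}"]) (auto simp: fun_eq_iff algebra_simps sum_distrib_left)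
    also have "\<dots> = R x + integral {0..d} (\<lambda>t. \<Sum>m<n. c m * of_real (t ^ m * e x t))"
      unfolding R_def
      by (rule integral_add) (auto simp: e_def intro!: integrable_continuous_interval continuous_intros cont)
    also have "integral {0..d} (\<lambda>t. \<Sum>m<n. c m * of_real (t ^ m * e x t)) =
        (\<Sum>m<n. integral {0..d} (\<lambda>t. c m * of_real (t ^ m * e x t)))"
      by (rule integral_sum) (use int1 in auto)
    also have "\<dots> = (\<Sum>m<n. c m * of_real (P m x))"
    proof (rule sum.cong)
      fix m
      have "((\<lambda>t. t ^ m * e x t) has_integral P m x) {0..d}"
        unfolding P_def
        by (rule integrable_integral) (auto simp: e_def intro!: integrable_continuous_interval continuous_intros)
      then have "((\<lambda>t. c m * of_real (t ^ m * e x t)) has_integral c m * of_real (P m x)) {0..d}"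
        by (intro has_integral_mult_right has_integral_of_real)
      then show "integral {0..d} (\<lambda>t. c m * of_real (t ^ m * e x t)) = c m * of_real (P m x)"
        by (rule integral_unique)
    qed simp
    finally show ?thesis by (simp add: e_def sum_subtractf algebra_simps)
  qed
  then have "?lhs = (\<lambda>x. R x + (\<Sum>m<n. c m * of_real (P m x - moment v m (x * b))))" by auto
  then show ?thesis
    using Rbig Pbig by (auto intro!: sum_in_bigo big_sum_in_bigo landau_o.big.mult_in_1
      simp: cmult_in_bigo_iff)
qed

text \<open>On the closed disc of half the radius the n-th derivative is bounded by compactness.
  \<open>complex_Taylor\<close> covers sums with at least one term, so the empty sum n = 0, which is
  just boundedness of f, is treated apart.\<close>

lemma holomorphic_taylor_bound:
  fixes f :: "complex \<Rightarrow> complex"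
  assumes "f holomorphic_on ball 0 \<rho>" "\<rho> > 0"
  obtains K where "K \<ge> 0"
    "\<And>z. z \<in> cball 0 (\<rho> / 2) \<Longrightarrow> norm (f z - (\<Sum>m<n. (deriv ^^ m) f 0 / fact m * z ^ m)) \<le> K * norm z ^ n"
proof -
  have sub: "cball 0 (\<rho> / 2) \<subseteq> ball (0::complex) \<rho>" using assms by auto
  have holn: "(deriv ^^ k) f holomorphic_on ball 0 \<rho>" for k
    by (rule holomorphic_higher_deriv[OF assms(1)]) simp
  have "compact ((deriv ^^ n) f ` cball 0 (\<rho> / 2))"
    by (intro compact_continuous_image continuous_on_subset[OF holomorphic_on_imp_continuous_on[OF holn] sub]) simp
  then obtain B where B: "\<And>z. z \<in> cball 0 (\<rho> / 2) \<Longrightarrow> norm ((deriv ^^ n) f z) \<le> B" and B0: "B > 0"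
    using bounded_pos[of "(deriv ^^ n) f ` cball 0 (\<rho> / 2)"] compact_imp_bounded by blast
  show ?thesis
  proof (cases n)
    case 0
    then show ?thesis using that[of B] B B0 by auto
  next
    case (Suc k)
    have "norm (f z - (\<Sum>m<n. (deriv ^^ m) f 0 / fact m * z ^ m)) \<le> B / fact k * norm z ^ n"
      if z: "z \<in> cball 0 (\<rho> / 2)" for z
    proof -
      have "cmod ((deriv ^^ 0) f z - (\<Sum>i\<le>k. (deriv ^^ i) f 0 * (z - 0) ^ i / fact i))
          \<le> B * cmod (z - 0) ^ Suc k / fact k"
      proof (rule complex_Taylor[where S = "cball 0 (\<rho> / 2)"])
        fix i and x :: complex assume "x \<in> cball 0 (\<rho> / 2)" "i \<le> k"
        then have "x \<in> ball 0 \<rho>" using sub by (meson subsetD)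
        then show "((deriv ^^ i) f has_field_derivative (deriv ^^ Suc i) f x) (at x within cball 0 (\<rho> / 2))"
          using has_field_derivative_higher_deriv[OF assms(1) open_ball] DERIV_subset by blast
      qed (use z B Suc assms in auto)
      then show ?thesis by (simp add: Suc lessThan_Suc_atMost)
    qed
    then show ?thesis using that[of "B / fact k"] B0 by auto
  qed
qed

text \<open>The factor exp (norm z) is affordable: in \<open>laplace_ray\<close> it is at most exp(x
  b t^v / 2), half of the available decay.\<close>

lemma exp_remainder_bound:
  fixes z :: complex
  shows "norm (exp z - (\<Sum>l<M. z ^ l / fact l)) \<le> exp (norm z) * norm z ^ M"
proof (cases M)
  case 0
  then show ?thesis by (simp add: norm_exp complex_Re_le_cmod)
next
  case (Suc k)
  have "norm (exp z - (\<Sum>l<M. z ^ l / fact l)) \<le> exp (norm z) * (norm z ^ M) / fact k"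
    using Taylor_exp_field[of z k] by (simp add: Suc lessThan_Suc_atMost)
  also have "\<dots> \<le> exp (norm z) * norm z ^ M / 1"
    by (intro divide_left_mono) (auto simp: fact_ge_1)
  finally show ?thesis by simp
qed

text \<open>A zero of order n of r is one of order n l of r^l. In the Leibniz rule, fewer than n
  (l+1) derivatives either leave fewer than n for the last factor or fewer than n l for the
  rest.\<close>

lemma higher_deriv_mult_power_eq_0:
  fixes u r :: "complex \<Rightarrow> complex"
  assumes "u holomorphic_on S" "r holomorphic_on S" "open S" "z \<in> S"
    and "\<And>i. i < n \<Longrightarrow> (deriv ^^ i) r z = 0"
  shows "m < n * l \<Longrightarrow> (deriv ^^ m) (\<lambda>z. u z * r z ^ l) z = 0"
proof (induction l arbitrary: m)
  case (Suc l)
  have "(deriv ^^ m) (\<lambda>z. (u z * r z ^ l) * r z) z =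
      (\<Sum>i = 0..m. of_nat (m choose i) * (deriv ^^ i) (\<lambda>z. u z * r z ^ l) z * (deriv ^^ (m - i)) r z)"
    by (rule higher_deriv_mult) (use assms in \<open>auto intro!: holomorphic_intros\<close>)
  also have "\<dots> = 0"
  proof (rule sum.neutral, rule ballI)
    fix i assume "i \<in> {0..m}"
    then have "i < n * l \<or> m - i < n" using Suc.prems by auto
    then show "of_nat (m choose i) * (deriv ^^ i) (\<lambda>z. u z * r z ^ l) z * (deriv ^^ (m - i)) r z = 0"
      using Suc.IH assms(5) by auto
  qed
  finally show ?case by (simp add: mult_ac)
qed simp

text \<open>The coefficient of x^(-(k+1)/v). It collects, for each l, the Taylor coefficient of u
  r^l at index k + v l, times the moment of that index stripped of its power of x; s stands for the
  v-th root a^(-1/v), and 1/v comes from the moment.\<close>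

definition laplace_coeff ::
    "nat \<Rightarrow> complex \<Rightarrow> (complex \<Rightarrow> complex) \<Rightarrow> (complex \<Rightarrow> complex) \<Rightarrow> nat \<Rightarrow> complex" where
  "laplace_coeff v s u r k =
     (\<Sum>l\<le>k. (- 1) ^ l * of_real (Gamma (real (k + v * l + 1) / real v)) / (fact l * of_nat v) *
        s ^ (k + v * l + 1) * ((deriv ^^ (k + v * l)) (\<lambda>z. u z * r z ^ l) 0 / fact (k + v * l)))"

text \<open>Since x t^v has size 1 and r is of order t^(v+1), the l-th term of the expansion of
  exp(- x r) is smaller than the first by x^(-l/v). Hence M terms of the exponential series suffice
  for an error of order x^(-(M+1)/v).\<close>

lemma laplace_ray:
  fixes u r :: "complex \<Rightarrow> complex"
  assumes "v \<ge> 1" "b > 0" "\<rho> > 0"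
    and holu: "u holomorphic_on ball 0 \<rho>" and holr: "r holomorphic_on ball 0 \<rho>"
    and r0: "\<And>i. i \<le> v \<Longrightarrow> (deriv ^^ i) r 0 = 0"
  shows "\<forall>\<^sub>F d in at_right 0. laplace_expansion
    (\<lambda>x. integral {0..d} (\<lambda>t. u (of_real t) * exp (- (of_real x * (of_real (b * t ^ v) + r (of_real t))))))
    v (laplace_coeff v (of_real (b powr (- 1 / real v))) u r)"
proof -
  obtain Kr where Kr: "Kr \<ge> 0" "\<And>z. z \<in> cball 0 (\<rho> / 2) \<Longrightarrow> norm (r z) \<le> Kr * norm z ^ Suc v"
  proof (rule holomorphic_taylor_bound[OF holr \<open>\<rho> > 0\<close>, of "Suc v"])
    fix K assume "K \<ge> 0" and *: "\<And>z. z \<in> cball 0 (\<rho> / 2) \<Longrightarrow>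
      cmod (r z - (\<Sum>m<Suc v. (deriv ^^ m) r 0 / fact m * z ^ m)) \<le> K * cmod z ^ Suc v"
    have "(\<Sum>m<Suc v. (deriv ^^ m) r 0 / fact m * z ^ m) = 0" for z
      by (rule sum.neutral) (use r0 in auto)
    then show thesis using that[of K] * \<open>K \<ge> 0\<close> by simp
  qed
  have sub: "cball 0 (\<rho> / 2) \<subseteq> ball (0::complex) \<rho>" using assms by auto
  \<comment> \<open>The second bound gives Kr t <= b/2, so that r is at most half of the leading
    term b t^v on the interval.\<close>
  define \<delta> where "\<delta> = min (\<rho> / 2) (b / (2 * (Kr + 1)))"
  have \<delta>: "\<delta> > 0" using assms Kr by (simp add: \<delta>_def)
  have "\<forall>\<^sub>F d in at_right 0. 0 < d \<and> d < \<delta>"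
    using eventually_at_right_less[of "0::real"] eventually_at_right_real[OF \<delta>] by eventually_elim auto
  then show ?thesis
  proof (eventually_elim, unfold laplace_expansion_def, intro allI)
    fix d M assume d: "0 < d \<and> d < \<delta>"
    let ?I = "\<lambda>x. integral {0..d} (\<lambda>t. u (of_real t) * exp (- (of_real x * (of_real (b * t ^ v) + r (of_real t)))))"
    let ?tail = "\<lambda>z. exp z - (\<Sum>l<M. z ^ l / fact l) :: complex"
    let ?O = "O[at_top](cpowr (- (real (M + 1) / real v)))"
    have in_cball: "complex_of_real t \<in> cball 0 (\<rho> / 2)" if "t \<in> {0..d}" for t
      using that d by (auto simp: \<delta>_def)
    have rb: "norm (r (of_real t)) \<le> Kr * t ^ Suc v" "Kr * t ^ Suc v \<le> b / 2 * t ^ v" if t: "t \<in> {0..d}" for t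
    proof -
      show "norm (r (of_real t)) \<le> Kr * t ^ Suc v" using Kr(2)[OF in_cball[OF t]] t by (simp add: norm_power)
      have "t \<le> b / (2 * (Kr + 1))" using t d by (auto simp: \<delta>_def)
      then have "(Kr + 1) * t \<le> b / 2" using Kr by (simp add: field_simps)
      then have "Kr * t \<le> b / 2" using t by (simp add: algebra_simps)
      then show "Kr * t ^ Suc v \<le> b / 2 * t ^ v"
        using t mult_right_mono[of "Kr * t" "b / 2" "t ^ v"] by (simp add: mult_ac)
    qed
    have contd: "continuous_on {0..d} (\<lambda>t. f (complex_of_real t))" if "f holomorphic_on ball 0 \<rho>" for f
      by (rule continuous_on_compose2[OF holomorphic_on_imp_continuous_on[OF that]])
         (use in_cball sub in \<open>auto intro!: continuous_intros\<close>)
    note contu = contd[OF holu] and contr = contd[OF holr]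
    obtain Ku where Ku: "Ku \<ge> 0" "\<And>z. z \<in> cball 0 (\<rho> / 2) \<Longrightarrow> norm (u z) \<le> Ku"
      by (rule holomorphic_taylor_bound[OF holu \<open>\<rho> > 0\<close>, of 0]) auto
    define c where "c = (\<lambda>l m. (deriv ^^ m) (\<lambda>z. u z * r z ^ l) 0 / fact m)"
    have c0: "c l m = 0" if "m < Suc v * l" for l m
      unfolding c_def using higher_deriv_mult_power_eq_0[OF holu holr open_ball _ _ that, of 0] assms r0
      by simp
    define W where "W = (\<lambda>l x. integral {0..d} (\<lambda>t. u (of_real t) * r (of_real t) ^ l * of_real (exp (- (x * b * t ^ v)))))"
    \<comment> \<open>The factor x^l in front of this integral costs v l steps in the scale
      x^(-1/v), so u r^l is expanded up to index M + v l instead of M.\<close>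
    have W: "(\<lambda>x. W l x - (\<Sum>m<M + v * l. c l m * of_real (moment v m (x * b))))
        \<in> O[at_top](cpowr (- (real (M + v * l + 1) / real v)))" for l
    proof -
      have hol: "(\<lambda>z. u z * r z ^ l) holomorphic_on ball 0 \<rho>" by (intro holomorphic_intros holu holr)
      obtain K where K: "\<And>z. z \<in> cball 0 (\<rho> / 2) \<Longrightarrow>
          norm (u z * r z ^ l - (\<Sum>m<M + v * l. c l m * z ^ m)) \<le> K * norm z ^ (M + v * l)"
        unfolding c_def by (rule holomorphic_taylor_bound[OF hol \<open>\<rho> > 0\<close>]) blast
      show ?thesis
        unfolding W_def
      proof (rule watson)
        fix t assume t: "t \<in> {0..d}"
        show "cmod (u (complex_of_real t) * r (complex_of_real t) ^ l -
            (\<Sum>m<M + v * l. c l m * complex_of_real t ^ m)) \<le> K * t ^ (M + v * l)"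
          using K[OF in_cball[OF t]] t by (simp add: norm_power)
      qed (use assms d contd[OF hol] in auto)
    qed
    define Rem where "Rem = (\<lambda>x. integral {0..d} (\<lambda>t. u (of_real t) *
        ?tail (- (of_real x * r (of_real t))) *
        of_real (exp (- (x * b * t ^ v)))))"
    \<comment> \<open>The remainder is of size x^M t^((v+1) M) against exp(- x b t^v / 2), and x^M
      x^(-((v+1) M + 1)/v) is exactly x^(-(M+1)/v).\<close>
    have Rem: "Rem \<in> ?O"
    proof (rule bigoI[where c = "Ku * Kr ^ M * moment v (Suc v * M) (b / 2)"])
      show "\<forall>\<^sub>F x in at_top. norm (Rem x) \<le> Ku * Kr ^ M * moment v (Suc v * M) (b / 2) *
               norm (cpowr (- (real (M + 1) / real v)) x)"
        using eventually_gt_at_top[of 0]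
      proof eventually_elim
        fix x :: real assume x: "x > 0"
        let ?e = "\<lambda>t. exp (- (x * (b / 2) * t ^ v))"
        have "norm (Rem x) \<le> integral {0..d} (\<lambda>t. Ku * Kr ^ M * x ^ M * (t ^ (Suc v * M) * ?e t))"
          unfolding Rem_def
        proof (rule integral_norm_bound_integral)
          fix t assume t: "t \<in> {0..d}"
          let ?z = "- (of_real x * r (of_real t))"
          have z: "norm ?z \<le> x * (Kr * t ^ Suc v)"
            using rb(1)[OF t] x by (simp add: norm_mult)
          have "norm (?tail ?z) \<le> exp (norm ?z) * norm ?z ^ M"
            by (rule exp_remainder_bound)
          also have "\<dots> \<le> exp (x * (b / 2 * t ^ v)) * (x * (Kr * t ^ Suc v)) ^ M"
          proof (intro mult_mono power_mono)
            show "exp (norm ?z) \<le> exp (x * (b / 2 * t ^ v))"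
              using order_trans[OF z mult_left_mono[OF rb(2)[OF t]]] x by simp
          qed (use z x in auto)
          finally have 1: "norm (?tail ?z) \<le> \<dots>" .
          have "norm (u (of_real t) * ?tail ?z * of_real (exp (- (x * b * t ^ v))))
            \<le> Ku * (exp (x * (b / 2 * t ^ v)) * (x * (Kr * t ^ Suc v)) ^ M) * exp (- (x * b * t ^ v))"
            unfolding norm_mult norm_of_real abs_exp_cancel
            by (intro mult_mono 1 Ku in_cball t mult_nonneg_nonneg zero_le_power) (use x Ku Kr t in auto)
          also have "\<dots> = Ku * Kr ^ M * x ^ M * (t ^ (Suc v * M) *
              (exp (x * (b / 2 * t ^ v)) * exp (- (x * b * t ^ v))))"
            unfolding power_mult[of t "Suc v" M] power_mult_distrib by (simp only: mult_ac)
          also have "exp (x * (b / 2 * t ^ v)) * exp (- (x * b * t ^ v)) = ?e t"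
            by (simp flip: exp_add add: field_simps)
          finally show "norm (u (of_real t) * ?tail ?z * of_real (exp (- (x * b * t ^ v))))
            \<le> Ku * Kr ^ M * x ^ M * (t ^ (Suc v * M) * ?e t)" .
        qed (intro integrable_continuous_interval continuous_intros contu contr; simp)+
        also have "\<dots> = Ku * Kr ^ M * x ^ M * integral {0..d} (\<lambda>t. t ^ (Suc v * M) * ?e t)" by simp
        also have "\<dots> \<le> Ku * Kr ^ M * x ^ M * moment v (Suc v * M) (x * (b / 2))"
          by (intro mult_left_mono moment_partial(1)) (use assms d x Ku Kr in auto)
        also have "moment v (Suc v * M) (x * (b / 2)) =
            moment v (Suc v * M) (b / 2) * x powr (- (real (Suc v * M + 1) / real v))"
          by (rule moment_scale) (use x assms in auto)
        also have "Ku * Kr ^ M * x ^ M * \<dots> = Ku * Kr ^ M * moment v (Suc v * M) (b / 2) *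
            (x powr real M * x powr (- (real (Suc v * M + 1) / real v)))"
          using x by (simp add: powr_realpow)
        also have "x powr real M * x powr (- (real (Suc v * M + 1) / real v)) = x powr (- (real (M + 1) / real v))"
          unfolding powr_add[symmetric] using assms by (intro arg_cong[of _ _ "(powr) x"]) (simp add: field_simps)
        finally show "norm (Rem x) \<le> Ku * Kr ^ M * moment v (Suc v * M) (b / 2) *
               norm (cpowr (- (real (M + 1) / real v)) x)" by simp
      qed
    qed
    define T where "T = (\<lambda>l x. (- of_real x) ^ l / fact l * (W l x - (\<Sum>m<M + v * l. c l m * of_real (moment v m (x * b)))))"
    have T: "T l \<in> ?O" for l
    proof -
      have "T l \<in> O[at_top](\<lambda>x. (- of_real x) ^ l / fact l * cpowr (- (real (M + v * l + 1) / real v)) x)"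
        unfolding T_def by (rule landau_o.big.mult_left[OF W])
      also have "(\<lambda>x. (- of_real x) ^ l / fact l * cpowr (- (real (M + v * l + 1) / real v)) x)
          \<in> ?O"
      proof (rule bigoI[where c = 1])
        show "\<forall>\<^sub>F x in at_top. norm ((- of_real x) ^ l / fact l * cpowr (- (real (M + v * l + 1) / real v)) x)
            \<le> 1 * norm (cpowr (- (real (M + 1) / real v)) x)"
          using eventually_gt_at_top[of 0]
        proof eventually_elim
          fix x :: real assume x: "x > 0"
          have "x powr real l * x powr (- (real (M + v * l + 1) / real v)) = x powr (- (real (M + 1) / real v))"
            unfolding powr_add[symmetric] using assms by (intro arg_cong[of _ _ "(powr) x"]) (simp add: field_simps)
          then have "x ^ l * x powr (- (real (M + v * l + 1) / real v)) = x powr (- (real (M + 1) / real v))"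
            using x by (simp add: powr_realpow)
          moreover have "x ^ l / fact l * x powr (- (real (M + v * l + 1) / real v))
              \<le> x ^ l / 1 * x powr (- (real (M + v * l + 1) / real v))"
            by (intro mult_right_mono divide_left_mono) (use x in \<open>auto simp: fact_ge_1\<close>)
          ultimately show "norm ((- of_real x) ^ l / fact l * cpowr (- (real (M + v * l + 1) / real v)) x)
            \<le> 1 * norm (cpowr (- (real (M + 1) / real v)) x)"
            using x by (simp add: norm_mult norm_divide norm_power)
        qed
      qed
      finally show ?thesis .
    qed
    define s where "s = complex_of_real (b powr (- 1 / real v))"
    let ?K = "\<lambda>k l. (- 1) ^ l *
            of_real (Gamma (real (k + v * l + 1) / real v)) / (fact l * of_nat v) *
            s ^ (k + v * l + 1) * c l (k + v * l)"
    have main: "?I x -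
         (\<Sum>k<M. cpowr (- (real (k + 1) / real v)) x * laplace_coeff v s u r k) = Rem x + (\<Sum>l<M. T l x)"
      if x: "x > 0" for x
    proof -
      let ?e = "\<lambda>t. complex_of_real (exp (- (x * b * t ^ v)))"
      have "?I x =
         integral {0..d} (\<lambda>t. u (of_real t) *
        ?tail (- (of_real x * r (of_real t))) * ?e t +
         (\<Sum>l<M. (- of_real x) ^ l / fact l * (u (of_real t) * r (of_real t) ^ l * ?e t)))"
      proof (rule arg_cong[of _ _ "integral {0..d}"], rule ext)
        fix t
        let ?z = "- (of_real x * r (of_real t))"
        have 1: "exp (- (of_real x * (of_real (b * t ^ v) + r (of_real t)))) = exp ?z * ?e t"
          unfolding exp_of_real[symmetric] exp_add[symmetric] by (simp add: algebra_simps)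
        have 2: "?z ^ l / fact l * (u (of_real t) * ?e t) =
            (- of_real x) ^ l / fact l * (u (of_real t) * r (of_real t) ^ l * ?e t)" for l
          by (simp add: power_mult_distrib[symmetric] mult_ac)
        show "u (of_real t) * exp (- (of_real x * (of_real (b * t ^ v) + r (of_real t)))) = u (of_real t) *
        ?tail ?z * ?e t +
         (\<Sum>l<M. (- of_real x) ^ l / fact l * (u (of_real t) * r (of_real t) ^ l * ?e t))"
          unfolding 1 2[symmetric] sum_distrib_right[symmetric] by (simp add: algebra_simps)
      qed
      also have "\<dots> = Rem x + integral {0..d} (\<lambda>t. \<Sum>l<M. (- of_real x) ^ l / fact l * (u (of_real t) * r (of_real t) ^ l * ?e t))"
        unfolding Rem_def
        by (rule integral_add) (intro integrable_continuous_interval continuous_intros contu contr; simp)+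
      also have "integral {0..d} (\<lambda>t. \<Sum>l<M. (- of_real x) ^ l / fact l * (u (of_real t) * r (of_real t) ^ l * ?e t)) =
          (\<Sum>l<M. (- of_real x) ^ l / fact l * W l x)"
        unfolding W_def
        by (subst integral_sum) (simp | intro integrable_continuous_interval continuous_intros contu contr)+
      finally have A: "?I x =
          Rem x + (\<Sum>l<M. T l x) +
          (\<Sum>l<M. (- of_real x) ^ l / fact l * (\<Sum>m<M + v * l. c l m * of_real (moment v m (x * b))))"
        by (simp add: T_def sum_subtractf right_diff_distrib)
      \<comment> \<open>Taylor indices below v l vanish by \<open>c0\<close>; the remaining ones are
        written m = k + v l, where x^l times the moment becomes x^(-(k+1)/v) times a
        constant.\<close>
      have B: "(- of_real x) ^ l / fact l * (\<Sum>m<M + v * l. c l m * of_real (moment v m (x * b))) =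
         (\<Sum>k<M. cpowr (- (real (k + 1) / real v)) x * (?K k l))" for l
      proof -
        have "(\<Sum>m<M + v * l. c l m * of_real (moment v m (x * b))) =
            (\<Sum>m\<in>{v * l..<M + v * l}. c l m * of_real (moment v m (x * b)))"
          by (rule sum.mono_neutral_right) (auto simp: c0)
        also have "\<dots> = (\<Sum>k<M. c l (k + v * l) * of_real (moment v (k + v * l) (x * b)))"
          by (simp add: sum.shift_bounds_nat_ivl[of _ 0 "v * l" M, simplified] lessThan_atLeast0)
        finally have eq: "(\<Sum>m<M + v * l. c l m * of_real (moment v m (x * b))) = \<dots>" .
        have m1: "x ^ l * moment v (k + v * l) (x * b) = x powr (- (real (k + 1) / real v)) *
            (Gamma (real (k + v * l + 1) / real v) / real v * (b powr (- 1 / real v)) ^ (k + v * l + 1))" for k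
        proof -
          have "x powr real l * x powr (- (real (k + v * l + 1) / real v)) = x powr (- (real (k + 1) / real v))"
            unfolding powr_add[symmetric] using assms by (intro arg_cong[of _ _ "(powr) x"]) (simp add: field_simps)
          then have 1: "x ^ l * x powr (- (real (k + v * l + 1) / real v)) = x powr (- (real (k + 1) / real v))"
            using x by (simp add: powr_realpow)
          have 2: "(b powr (- 1 / real v)) ^ (k + v * l + 1) = b powr (- (real (k + v * l + 1) / real v))"
            using assms by (subst powr_realpow[symmetric]) (auto simp: powr_powr field_simps)
          show ?thesis
            unfolding 2 1[symmetric] moment_def using assms x by (simp add: powr_mult)
        qed
        have 3: "of_real x ^ l * of_real (moment v (k + v * l) (x * b)) =
            cpowr (- (real (k + 1) / real v)) x *
            (of_real (Gamma (real (k + v * l + 1) / real v)) / of_nat v * s ^ (k + v * l + 1))" for k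
        proof -
          fix k
          from m1[of k] have "complex_of_real (x ^ l * moment v (k + v * l) (x * b)) =
            complex_of_real (x powr (- (real (k + 1) / real v)) *
            (Gamma (real (k + v * l + 1) / real v) / real v * (b powr (- 1 / real v)) ^ (k + v * l + 1)))"
            by (rule arg_cong)
          then show "of_real x ^ l * of_real (moment v (k + v * l) (x * b)) =
            cpowr (- (real (k + 1) / real v)) x *
            (of_real (Gamma (real (k + v * l + 1) / real v)) / of_nat v * s ^ (k + v * l + 1))"
            by (simp only: s_def of_real_mult of_real_power of_real_divide of_real_of_nat_eq)
        qed
        have "(- of_real x) ^ l / fact l * (c l (k + v * l) * of_real (moment v (k + v * l) (x * b))) =
          cpowr (- (real (k + 1) / real v)) x * (?K k l)" for k
        proof -
          have "(- of_real x) ^ l / fact l * (c l (k + v * l) * of_real (moment v (k + v * l) (x * b))) =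
            (-1) ^ l / fact l * c l (k + v * l) * (of_real x ^ l * of_real (moment v (k + v * l) (x * b)))"
            by (simp add: power_minus[of "of_real x"])
          then show ?thesis unfolding 3 by simp
        qed
        then show ?thesis by (simp add: eq sum_distrib_left)
      qed
      have "(\<Sum>l<M. (- of_real x) ^ l / fact l * (\<Sum>m<M + v * l. c l m * of_real (moment v m (x * b)))) =
         (\<Sum>k<M. cpowr (- (real (k + 1) / real v)) x * (\<Sum>l<M. ?K k l))"
        unfolding B sum_distrib_left[symmetric] by (subst sum.swap) (simp only: sum_distrib_left)
      also have "\<dots> = (\<Sum>k<M. cpowr (- (real (k + 1) / real v)) x * laplace_coeff v s u r k)"
      proof (rule sum.cong, simp)
        fix k assume k: "k \<in> {..<M}"
        \<comment> \<open>For l > k the index k + v l lies below (v+1) l, where \<open>c0\<close>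
          applies. So the sum ends at l = k and the coefficient does not depend on M.\<close>
        have "(\<Sum>l<M. ?K k l) = (\<Sum>l\<le>k. ?K k l)"
          by (rule sum.mono_neutral_right) (use k in \<open>auto simp: c0\<close>)
        also have "\<dots> = laplace_coeff v s u r k"
          by (simp only: laplace_coeff_def c_def)
        finally show "cpowr (- (real (k + 1) / real v)) x * (\<Sum>l<M. ?K k l) = cpowr (- (real (k + 1) / real v)) x * laplace_coeff v s u r k"
          by simp
      qed
      finally show ?thesis using A by simp
    qed
    have "(\<lambda>x. Rem x + (\<Sum>l<M. T l x)) \<in> ?O"
      by (intro sum_in_bigo big_sum_in_bigo Rem T)
    moreover have "\<forall>\<^sub>F x in at_top. ?I x -
         (\<Sum>k<M. cpowr (- (real (k + 1) / real v)) x * laplace_coeff v s u r k) = Rem x + (\<Sum>l<M. T l x)"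
      using eventually_gt_at_top[of 0] by eventually_elim (rule main)
    ultimately show "(\<lambda>x. ?I x -
         (\<Sum>k<M. cpowr (- (real (k + 1) / real v)) x * laplace_coeff v (of_real (b powr (- 1 / real v))) u r k))
      \<in> ?O"
      unfolding s_def by (subst landau_o.big.in_cong) (auto simp: s_def)
  qed
qed

section \<open>Rotation of the path of integration\<close>

text \<open>In 2 sin(B - x/2) sin(x/2) the first sine is at least sin(B/2), because its angle lies
  between B/2 and pi/2, and the second is at least x/4. A bound linear in the turned angle x is
  needed, since the change of r is linear in the angle too.\<close>

lemma cos_diff_ge:
  assumes "0 \<le> x" "x \<le> B" "B \<le> pi / 2"
  shows "cos (B - x) - cos B \<ge> x / 2 * sin (B / 2)"
proof -
  have s: "sin y \<ge> y / 2" if "0 \<le> y" "y \<le> pi / 4" for y :: real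
  proof (cases "y = 0")
    case False
    then have "\<exists>z>0. z < y \<and> sin y - sin 0 = (y - 0) * cos z"
      using that by (intro MVT2) (auto intro!: derivative_eq_intros)
    then obtain z where z: "0 < z" "z < y" "sin y = y * cos z" by auto
    have "cos z \<ge> cos (pi / 3)" by (intro cos_monotone_0_pi_le) (use z that in auto)
    then have "cos z \<ge> 1 / 2" by (simp add: cos_60)
    then show ?thesis using z(3) that mult_left_mono[of "1/2" "cos z" y] by simp
  qed simp
  have "cos (B - x) - cos B = 2 * sin (B - x / 2) * sin (x / 2)"
    using cos_diff_cos[of "B - x" B] by (simp add: field_simps)
  moreover have "sin (B - x / 2) * sin (x / 2) \<ge> sin (B / 2) * (x / 2 / 2)"
  proof (intro mult_mono)
    show "sin (B / 2) \<le> sin (B - x / 2)" by (intro sin_monotone_2pi_le) (use assms in auto)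
    then show "0 \<le> sin (B - x / 2)" using sin_ge_zero[of "B / 2"] assms by auto
  qed (use s[of "x / 2"] assms in auto)
  ultimately show ?thesis by (simp add: mult_ac)
qed

text \<open>The interval is turned by the angle \<open>- Arg a / v\<close>, where the leading term of the phase
  is real. This is possible because turning towards that direction increases the real part of the
  phase on a small circle about 0; if \<open>a\<close> is imaginary, it is the only reason for exponential
  decay that is uniform on the arc.\<close>

lemma phase_pos_on_arc:
  fixes r :: "complex \<Rightarrow> complex"
  assumes "v \<ge> 1" "\<rho> > 0" "Re a \<ge> 0" "a \<noteq> 0" and holr: "r holomorphic_on ball 0 \<rho>"
    and r0: "\<And>i. i \<le> v \<Longrightarrow> (deriv ^^ i) r 0 = 0"
    and pos: "\<And>t::real. 0 < t \<Longrightarrow> t < \<rho> \<Longrightarrow> Re (a * of_real t ^ v + r (of_real t)) > 0"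
  shows "\<forall>\<^sub>F d in at_right 0. \<forall>\<tau>\<in>{0..1}.
     Re (a * (of_real d * cis (\<tau> * (- Arg a / real v))) ^ v + r (of_real d * cis (\<tau> * (- Arg a / real v)))) > 0"
proof -
  define B where "B = \<bar>Arg a\<bar>"
  have B: "0 \<le> B" "B \<le> pi / 2"
    using assms Arg_Re_nonneg[of a] by (auto simp: B_def)
  have holr': "deriv r holomorphic_on ball 0 \<rho>" by (rule holomorphic_deriv[OF holr]) simp
  \<comment> \<open>The derivative of r vanishes to order v, so on the circle of radius d a turn by
    some angle changes r by at most K d^(v+1) times that angle.\<close>
  obtain K where K: "K \<ge> 0" "\<And>z. z \<in> cball 0 (\<rho> / 2) \<Longrightarrow> norm (deriv r z) \<le> K * norm z ^ v"
  proof (rule holomorphic_taylor_bound[OF holr' \<open>\<rho> > 0\<close>, of v])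
    fix K assume "K \<ge> 0" and *: "\<And>z. z \<in> cball 0 (\<rho> / 2) \<Longrightarrow>
      cmod (deriv r z - (\<Sum>m<v. (deriv ^^ m) (deriv r) 0 / fact m * z ^ m)) \<le> K * cmod z ^ v"
    have "(\<Sum>m<v. (deriv ^^ m) (deriv r) 0 / fact m * z ^ m) = 0" for z
    proof (rule sum.neutral, rule ballI)
      fix m assume "m \<in> {..<v}"
      then have "(deriv ^^ Suc m) r 0 = 0" using r0[of "Suc m"] by simp
      then show "(deriv ^^ m) (deriv r) 0 / fact m * z ^ m = 0" by (simp only: funpow_Suc_right o_def) simp
    qed
    then show thesis using that[of K] * \<open>K \<ge> 0\<close> by simp
  qed
  \<comment> \<open>Below this bound K d <= cmod a sin(B/2) / 2, so the change of r along the arc is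
    at most the gain from \<open>cos_diff_ge\<close>. For B = 0 the arc is a point and any positive
    value will do.\<close>
  define \<delta> where "\<delta> = min (\<rho> / 2) (if B > 0 then cmod a * sin (B / 2) / (2 * (K + 1)) else 1)"
  have sB: "sin (B / 2) > 0" if "B > 0" by (rule sin_gt_zero) (use that B pi_gt_zero in linarith)+
  have "\<delta> > 0" using assms K sB by (auto simp: \<delta>_def)
  have "\<forall>\<^sub>F d in at_right 0. 0 < d \<and> d < \<delta>"
    using eventually_at_right_real[OF \<open>\<delta> > 0\<close>] by eventually_elim auto
  then show ?thesis
  proof (eventually_elim, intro ballI)
    fix d \<tau> :: real assume d: "0 < d \<and> d < \<delta>" and \<tau>: "\<tau> \<in> {0..1}"
    define \<theta> where "\<theta> = - Arg a / real v"
    have \<theta>: "\<bar>\<theta>\<bar> = B / real v" by (simp add: \<theta>_def B_def)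
    have d\<rho>: "d < \<rho> / 2" using d by (simp add: \<delta>_def)
    have rdiff: "norm (r (of_real d * cis (\<tau> * \<theta>)) - r (of_real d)) \<le> K * d ^ v * d * (\<tau> * \<bar>\<theta>\<bar>)"
    proof -
      have "norm (r (of_real d * exp (\<i> * of_real (\<tau> * \<theta>))) - r (of_real d * exp (\<i> * 0)))
          \<le> K * d ^ v * d * norm (of_real (\<tau> * \<theta>) - (0::complex))"
      proof (rule field_differentiable_bound[of "closed_segment 0 (of_real (\<tau> * \<theta>))"
            "\<lambda>w. r (of_real d * exp (\<i> * w))" "\<lambda>w. deriv r (of_real d * exp (\<i> * w)) * (of_real d * (exp (\<i> * w) * \<i>))"])
        fix w :: complex assume "w \<in> closed_segment 0 (of_real (\<tau> * \<theta>))"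
        then have "Im w = 0" by (auto simp: closed_segment_def)
        then have nw: "norm (of_real d * exp (\<i> * w)) = d" "norm (exp (\<i> * w)) = 1" using d by (auto simp: norm_mult)
        then have inb: "of_real d * exp (\<i> * w) \<in> ball 0 \<rho>" using d\<rho> assms by auto
        have "(r has_field_derivative deriv r (of_real d * exp (\<i> * w))) (at (of_real d * exp (\<i> * w)))"
          by (rule holomorphic_derivI[OF holr _ inb]) simp
        moreover have "((\<lambda>w. of_real d * exp (\<i> * w)) has_field_derivative of_real d * (exp (\<i> * w) * \<i>))
            (at w within closed_segment 0 (of_real (\<tau> * \<theta>)))"
          by (auto intro!: derivative_eq_intros)
        ultimately show "((\<lambda>w. r (of_real d * exp (\<i> * w))) has_field_derivative
            deriv r (of_real d * exp (\<i> * w)) * (of_real d * (exp (\<i> * w) * \<i>)))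
            (at w within closed_segment 0 (of_real (\<tau> * \<theta>)))"
          by (rule DERIV_chain2)
        have "norm (deriv r (of_real d * exp (\<i> * w))) \<le> K * d ^ v"
          using K(2)[of "of_real d * exp (\<i> * w)"] nw(1) d\<rho> by simp
        then show "norm (deriv r (of_real d * exp (\<i> * w)) * (of_real d * (exp (\<i> * w) * \<i>))) \<le> K * d ^ v * d"
          using nw(2) d by (simp add: norm_mult mult_right_mono)
      qed auto
      then show ?thesis using \<tau> by (simp add: cis_conv_exp norm_mult)
    qed
    have "a = of_real (cmod a) * cis (Arg a)" using rcis_cmod_Arg[of a] by (simp add: rcis_def)
    then have "a * (of_real d * cis (\<tau> * \<theta>)) ^ v = of_real (cmod a * d ^ v) * (cis (Arg a) * cis (\<tau> * \<theta>) ^ v)"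
      by (simp add: power_mult_distrib)
    also have "cis (Arg a) * cis (\<tau> * \<theta>) ^ v = cis ((1 - \<tau>) * Arg a)"
    proof -
      have "real v * (\<tau> * \<theta>) = - \<tau> * Arg a" using assms by (simp add: \<theta>_def)
      then have "cis (\<tau> * \<theta>) ^ v = cis (- \<tau> * Arg a)" by (simp only: Complex.DeMoivre)
      moreover have "cis (Arg a) * cis (- \<tau> * Arg a) = cis (Arg a + - \<tau> * Arg a)" by (rule cis_mult)
      moreover have "Arg a + - \<tau> * Arg a = (1 - \<tau>) * Arg a" by (simp add: algebra_simps)
      ultimately show ?thesis by (simp only:)
    qed
    finally have "Re (a * (of_real d * cis (\<tau> * \<theta>)) ^ v) = cmod a * d ^ v * cos ((1 - \<tau>) * Arg a)"
      by simp
    also have "cos ((1 - \<tau>) * Arg a) = cos (B - \<tau> * B)"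
      by (cases "Arg a \<ge> 0") (auto simp: B_def algebra_simps intro: arg_cong[of _ _ cos] cos_minus[symmetric, THEN trans])
    finally have 1: "Re (a * (of_real d * cis (\<tau> * \<theta>)) ^ v) = cmod a * d ^ v * cos (B - \<tau> * B)" .
    have g1: "Re (a * of_real d ^ v) = cmod a * d ^ v * cos B"
    proof -
      have "Re (a * of_real d ^ v) = Re a * d ^ v" by (simp flip: of_real_power)
      also have "Re a = cmod a * cos (Arg a)" using rcis_cmod_Arg[of a] by (metis Re_rcis)
      also have "cos (Arg a) = cos B" by (auto simp: B_def abs_if)
      finally show ?thesis by simp
    qed
    \<comment> \<open>At the real end of the arc positivity is the hypothesis on the phase. Along
      the arc only the balance of gain and change of r matters, and so Re a = 0 is
      admissible.\<close>
    then have g0: "cmod a * d ^ v * cos B + Re (r (of_real d)) > 0"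
      using pos[of d, unfolded plus_complex.sel g1] d d\<rho> \<open>\<rho> > 0\<close> by simp
    have cd: "cos (B - \<tau> * B) - cos B \<ge> \<tau> * B / 2 * sin (B / 2)"
      using \<tau> B by (intro cos_diff_ge) (auto simp: mult_left_le_one_le)
    have 2: "cmod a * d ^ v * cos (B - \<tau> * B) \<ge> cmod a * d ^ v * cos B + cmod a * d ^ v * (\<tau> * B / 2 * sin (B / 2))"
    proof -
      have "cos B + \<tau> * B / 2 * sin (B / 2) \<le> cos (B - \<tau> * B)"
        using cd by simp
      from mult_left_mono[OF this, of "cmod a * d ^ v"] show ?thesis using d by (simp add: distrib_left)
    qed
    have 3: "K * d ^ v * d * (\<tau> * \<bar>\<theta>\<bar>) \<le> cmod a * d ^ v * (\<tau> * B / 2 * sin (B / 2))"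
    proof (cases "B > 0")
      case True
      have "d \<le> cmod a * sin (B / 2) / (2 * (K + 1))" using d True by (simp add: \<delta>_def)
      then have "(K + 1) * d \<le> cmod a * sin (B / 2) / 2" using K by (simp add: field_simps)
      then have "K * d \<le> cmod a * sin (B / 2) / 2" using d by (simp add: algebra_simps)
      then have "K * d * (d ^ v * \<tau> * B) \<le> cmod a * sin (B / 2) / 2 * (d ^ v * \<tau> * B)"
        by (rule mult_right_mono) (use d \<tau> B in auto)
      moreover have "K * d ^ v * d * (\<tau> * \<bar>\<theta>\<bar>) \<le> K * d ^ v * d * (\<tau> * B)"
      proof (intro mult_left_mono)
        show "\<bar>\<theta>\<bar> \<le> B"
          unfolding \<theta> using divide_left_mono[of 1 "real v" B] assms B by simp
      qed (use d \<tau> K in auto)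
      ultimately show ?thesis by (simp add: mult_ac)
    next
      case False
      then show ?thesis using B \<theta> by simp
    qed
    have "Re (r (of_real d * cis (\<tau> * \<theta>))) \<ge> Re (r (of_real d)) - K * d ^ v * d * (\<tau> * \<bar>\<theta>\<bar>)"
      using rdiff abs_Re_le_cmod[of "r (of_real d * cis (\<tau> * \<theta>)) - r (of_real d)"] by simp
    then show "Re (a * (of_real d * cis (\<tau> * (- Arg a / real v))) ^ v + r (of_real d * cis (\<tau> * (- Arg a / real v)))) > 0"
      unfolding \<theta>_def[symmetric] using 1 2 3 g0 by simp
  qed
qed

text \<open>With Re a < 0 the leading term would dominate r, which is of order v + 1, and a small t
  > 0 would make the real part of the phase nonpositive.\<close>

lemma Re_leading_coeff_nonneg:
  fixes r :: "complex \<Rightarrow> complex"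
  assumes "\<rho> > 0" and holr: "r holomorphic_on ball 0 \<rho>"
    and r0: "\<And>i. i \<le> v \<Longrightarrow> (deriv ^^ i) r 0 = 0"
    and pos: "\<And>t::real. 0 < t \<Longrightarrow> t < \<rho> \<Longrightarrow> Re (a * of_real t ^ v + r (of_real t)) > 0"
  shows "Re a \<ge> 0"
proof (rule ccontr)
  assume neg: "\<not> Re a \<ge> 0"
  obtain K where K: "K \<ge> 0" "\<And>z. z \<in> cball 0 (\<rho> / 2) \<Longrightarrow>
      cmod (r z - (\<Sum>m<Suc v. (deriv ^^ m) r 0 / fact m * z ^ m)) \<le> K * cmod z ^ Suc v"
    using holomorphic_taylor_bound[OF holr \<open>\<rho> > 0\<close>] by blast
  have sum0: "(\<Sum>m<Suc v. (deriv ^^ m) r 0 / fact m * z ^ m) = 0" for z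
    by (rule sum.neutral) (use r0 in auto)
  define t where "t = min (\<rho> / 2) (- Re a / (K + 1))"
  have "- Re a / (K + 1) > 0" by (rule divide_pos_pos) (use K neg in auto)
  then have t: "0 < t" "t \<le> \<rho> / 2" "t \<le> - Re a / (K + 1)"
    unfolding t_def using \<open>\<rho> > 0\<close> by linarith+
  have "Re (r (of_real t)) \<le> K * t ^ Suc v"
    using K(2)[of "of_real t"] complex_Re_le_cmod[of "r (of_real t)"] t unfolding sum0 by simp
  moreover have "K * t \<le> - Re a"
  proof -
    have "(K + 1) * t \<le> - Re a" using t(3) K by (simp add: field_simps)
    then show ?thesis using t by (simp add: algebra_simps)
  qed
  then have "K * t ^ Suc v \<le> - Re a * t ^ v" using t mult_right_mono[of "K * t" "- Re a" "t ^ v"] by simp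
  moreover have "Re (a * of_real t ^ v) = Re a * t ^ v" by (simp flip: of_real_power)
  ultimately show False using pos[of t] t assms by simp
qed

text \<open>By Cauchy's theorem the segment and the ray in direction e = cis (- Arg a / v) differ by
  an integral over an arc, where compactness turns \<open>phase_pos_on_arc\<close> into a uniform
  positive lower bound. On the ray, a (e t)^v = cmod a t^v, which is the situation of
  \<open>laplace_ray\<close> for u1 and r1.\<close>

lemma laplace_half_line:
  fixes u r :: "complex \<Rightarrow> complex"
  assumes "v \<ge> 1" "a \<noteq> 0" "\<rho> > 0"
    and holu: "u holomorphic_on ball 0 \<rho>" and holr: "r holomorphic_on ball 0 \<rho>"
    and r0: "\<And>i. i \<le> v \<Longrightarrow> (deriv ^^ i) r 0 = 0"
    and pos: "\<And>t::real. 0 < t \<Longrightarrow> t < \<rho> \<Longrightarrow> Re (a * of_real t ^ v + r (of_real t)) > 0"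
  shows "\<forall>\<^sub>F d in at_right 0. laplace_expansion
    (\<lambda>x. integral {0..d} (\<lambda>t. u (of_real t) * exp (- (of_real x * (a * of_real t ^ v + r (of_real t))))))
    v (laplace_coeff v (a powr (- 1 / of_nat v)) u r)"
proof -
  have Rea: "Re a \<ge> 0" by (rule Re_leading_coeff_nonneg[OF assms(3,5,6,7)])
  define \<theta> where "\<theta> = - Arg a / real v"
  define e where "e = cis \<theta>"
  have ne: "norm e = 1" by (simp add: e_def)
  define u1 where "u1 = (\<lambda>z. e * u (e * z))"
  define r1 where "r1 = (\<lambda>z. r (e * z))"
  have inb: "e * z \<in> ball 0 \<rho>" if "z \<in> ball 0 \<rho>" for z using that ne by (simp add: norm_mult)
  have rot: "(\<lambda>z. h (e * z)) holomorphic_on ball 0 \<rho>" if "h holomorphic_on ball 0 \<rho>" for h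
    by (rule holomorphic_on_compose_gen[OF _ that, unfolded o_def]) (use inb in \<open>auto intro!: holomorphic_intros\<close>)
  have holu1: "u1 holomorphic_on ball 0 \<rho>"
    unfolding u1_def by (intro holomorphic_intros rot holu)
  have holr1: "r1 holomorphic_on ball 0 \<rho>"
    unfolding r1_def by (intro rot holr)
  have r10: "(deriv ^^ i) r1 0 = 0" if "i \<le> v" for i
    unfolding r1_def using higher_deriv_compose_linear[of r "ball 0 \<rho>" "ball 0 \<rho>" 0 e i] holr inb assms that
    by (simp add: r0)
  \<comment> \<open>The m-th derivative of the rotated product brings e^m, and the line element one
    more e. Together with the real root of cmod a they form powers of the principal root of a, whose
    argument is - Arg a / v.\<close>
  have coeff_eq: "laplace_coeff v (of_real (cmod a powr (- 1 / real v))) u1 r1 k =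
      laplace_coeff v (a powr (- 1 / of_nat v)) u r k" for k
  proof -
    have "a powr (- 1 / of_nat v) = exp (- (Ln a / of_nat v))" using assms by (simp add: powr_def)
    also have "Ln a = of_real (ln (cmod a)) + \<i> * of_real (Arg a)"
      using \<open>a \<noteq> 0\<close> by (intro complex_eqI) (simp_all add: Arg_eq_Im_Ln)
    also have "exp (- ((of_real (ln (cmod a)) + \<i> * of_real (Arg a)) / of_nat v)) =
        of_real (exp (- (ln (cmod a)) / real v)) * e"
      unfolding e_def cis_conv_exp exp_of_real[symmetric] exp_add[symmetric]
      by (rule arg_cong[of _ _ exp]) (simp add: \<theta>_def add_divide_distrib)
    also have "exp (- (ln (cmod a)) / real v) = cmod a powr (- 1 / real v)" using assms by (simp add: powr_def)
    finally have s: "a powr (- 1 / of_nat v) = of_real (cmod a powr (- 1 / real v)) * e" .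
    have "(deriv ^^ m) (\<lambda>z. u1 z * r1 z ^ l) 0 = e ^ (m + 1) * (deriv ^^ m) (\<lambda>z. u z * r z ^ l) 0" for m l
    proof -
      let ?f = "\<lambda>z. u z * r z ^ l"
      have hol: "?f holomorphic_on ball 0 \<rho>" by (intro holomorphic_intros holu holr)
      have "(deriv ^^ m) (\<lambda>z. u1 z * r1 z ^ l) 0 = (deriv ^^ m) (\<lambda>z. e * ?f (e * z)) 0"
        by (simp add: u1_def r1_def mult_ac)
      also have "\<dots> = e * (deriv ^^ m) (\<lambda>z. ?f (e * z)) 0"
        by (rule higher_deriv_cmult[of _ "ball 0 \<rho>"])
           (use assms rot[OF hol] in auto)
      also have "(deriv ^^ m) (\<lambda>z. ?f (e * z)) 0 = e ^ m * (deriv ^^ m) ?f (e * 0)"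
        using inb by (intro higher_deriv_compose_linear[OF hol open_ball[of 0 \<rho>] open_ball]) (use assms in auto)
      finally show ?thesis by simp
    qed
    then show ?thesis
      unfolding laplace_coeff_def s by (simp add: power_mult_distrib mult_ac)
  qed
  have "\<forall>\<^sub>F d in at_right 0. 0 < d \<and> d < \<rho> / 2"
    using eventually_at_right_real[of 0 "\<rho> / 2"] assms by (auto elim: eventually_mono)
  moreover have "\<forall>\<^sub>F d in at_right 0. \<forall>\<tau>\<in>{0..1}.
     Re (a * (of_real d * cis (\<tau> * (- Arg a / real v))) ^ v + r (of_real d * cis (\<tau> * (- Arg a / real v)))) > 0"
    by (rule phase_pos_on_arc) (use assms Rea in auto)
  moreover have "\<forall>\<^sub>F d in at_right 0. laplace_expansion
    (\<lambda>x. integral {0..d} (\<lambda>t. u1 (of_real t) * exp (- (of_real x * (of_real (cmod a * t ^ v) + r1 (of_real t))))))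
    v (laplace_coeff v (of_real (cmod a powr (- 1 / real v))) u1 r1)"
    by (rule laplace_ray) (use assms holu1 holr1 r10 in auto)
  ultimately show ?thesis
  proof (eventually_elim, unfold laplace_expansion_def, intro allI)
    fix d M
    assume d: "0 < d \<and> d < \<rho> / 2"
    assume arc: "\<forall>\<tau>\<in>{0..1}. Re (a * (of_real d * cis (\<tau> * (- Arg a / real v))) ^ v +
       r (of_real d * cis (\<tau> * (- Arg a / real v)))) > 0"
    assume ray: "\<forall>M. (\<lambda>x. integral {0..d} (\<lambda>t. u1 (of_real t) * exp (- (of_real x * (of_real (cmod a * t ^ v) + r1 (of_real t))))) -
         (\<Sum>k<M. cpowr (- (real (k + 1) / real v)) x * laplace_coeff v (of_real (cmod a powr (- 1 / real v))) u1 r1 k))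
      \<in> O[at_top](cpowr (- (real (M + 1) / real v)))"
    let ?O = "O[at_top](cpowr (- (real (M + 1) / real v)))"
    let ?S = "\<lambda>x. \<Sum>k<M. cpowr (- (real (k + 1) / real v)) x * laplace_coeff v (a powr (- 1 / of_nat v)) u r k"
    define f where "f = (\<lambda>x z. u z * exp (- (of_real x * (a * z ^ v + r z))))"
    let ?J = "\<lambda>x. integral {0..d} (\<lambda>t. f x (of_real t))" and ?J' = "\<lambda>x. integral {0..d} (\<lambda>t. e * f x (e * of_real t))"
    define A where "A = (\<lambda>\<tau>. of_real d * cis (\<tau> * \<theta>)) ` {0..1}"
    have "compact A" unfolding A_def
      by (intro compact_continuous_image continuous_intros continuous_on_cis) auto
    have Asub: "A \<subseteq> ball 0 \<rho>" using d by (auto simp: A_def norm_mult)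
    have contA: "continuous_on A h" if "h holomorphic_on ball 0 \<rho>" for h
      using continuous_on_subset[OF holomorphic_on_imp_continuous_on[OF that] Asub] .
    have "A \<noteq> {}" by (auto simp: A_def)
    obtain Ku where Ku: "\<And>z. z \<in> A \<Longrightarrow> norm (u z) \<le> Ku" "Ku > 0"
      using bounded_pos[of "u ` A"] compact_imp_bounded[OF compact_continuous_image[OF contA[OF holu] \<open>compact A\<close>]]
      by blast
    have contRe: "continuous_on A (\<lambda>z. Re (a * z ^ v + r z))"
      by (intro continuous_intros contA[OF holr])
    obtain z0 where z0: "z0 \<in> A" "\<And>z. z \<in> A \<Longrightarrow> Re (a * z0 ^ v + r z0) \<le> Re (a * z ^ v + r z)"
      using continuous_attains_inf[OF \<open>compact A\<close> \<open>A \<noteq> {}\<close> contRe] by blast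
    define \<epsilon> where "\<epsilon> = Re (a * z0 ^ v + r z0)"
    have \<epsilon>: "\<epsilon> > 0" using z0(1) arc by (auto simp: \<epsilon>_def A_def \<theta>_def)
    have holf: "f x holomorphic_on ball 0 \<rho>" for x unfolding f_def by (intro holomorphic_intros holu holr)
    have diff: "norm (?J x - ?J' x)
        \<le> Ku * d * \<bar>\<theta>\<bar> * exp (- (\<epsilon> * x))" if x: "x \<ge> 0" for x
    proof -
      obtain \<Phi> where \<Phi>: "\<And>z. z \<in> ball 0 \<rho> \<Longrightarrow> (\<Phi> has_field_derivative f x z) (at z)"
        using holomorphic_convex_primitive'[OF convex_ball open_ball holf] at_within_open[OF _ open_ball] by metis
      have I: "integral {0..d} (\<lambda>t. w * f x (w * of_real t)) = \<Phi> (w * of_real d) - \<Phi> (w * 0)" if w: "norm w = 1" for w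
      proof (rule integral_unique)
        have "((\<lambda>t. w * f x (w * of_real t)) has_integral \<Phi> (w * of_real d) - \<Phi> (w * of_real 0)) {0..d}"
        proof (rule fundamental_theorem_of_calculus)
          fix t assume t: "t \<in> {0..d}"
          then have "w * of_real t \<in> ball 0 \<rho>" using w d by (simp add: norm_mult)
          then have "(\<Phi> has_field_derivative f x (w * of_real t)) (at (w * of_real t))" by (rule \<Phi>)
          moreover have "((\<lambda>t. w * of_real t) has_vector_derivative w) (at t within {0..d})"
            by (auto intro!: derivative_eq_intros)
          ultimately show "((\<lambda>t. \<Phi> (w * of_real t)) has_vector_derivative w * f x (w * of_real t)) (at t within {0..d})"
            using field_vector_diff_chain_within[of "\<lambda>t. w * of_real t" w t "{0..d}" \<Phi> "f x (w * of_real t)"]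
            by (simp add: o_def has_field_derivative_at_within)
        qed (use d in auto)
        then show "((\<lambda>t. w * f x (w * of_real t)) has_integral \<Phi> (w * of_real d) - \<Phi> (w * 0)) {0..d}" by simp
      qed
      have "norm (\<Phi> (of_real d * exp (\<i> * of_real \<theta>)) - \<Phi> (of_real d * exp (\<i> * 0)))
          \<le> Ku * exp (- (\<epsilon> * x)) * d * norm (of_real \<theta> - (0::complex))"
      proof (rule field_differentiable_bound[of "closed_segment 0 (of_real \<theta>)"
            "\<lambda>w. \<Phi> (of_real d * exp (\<i> * w))" "\<lambda>w. f x (of_real d * exp (\<i> * w)) * (of_real d * (exp (\<i> * w) * \<i>))"])
        fix w :: complex assume "w \<in> closed_segment 0 (of_real \<theta>)"
        then obtain \<tau> where \<tau>: "\<tau> \<in> {0..1}" "w = of_real (\<tau> * \<theta>)"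
          by (auto simp: closed_segment_def scaleR_conv_of_real)
        then have wA: "of_real d * exp (\<i> * w) \<in> A" by (auto simp: A_def cis_conv_exp)
        then have "(\<Phi> has_field_derivative f x (of_real d * exp (\<i> * w))) (at (of_real d * exp (\<i> * w)))"
          using Asub \<Phi> by blast
        moreover have "((\<lambda>w. of_real d * exp (\<i> * w)) has_field_derivative of_real d * (exp (\<i> * w) * \<i>))
            (at w within closed_segment 0 (of_real \<theta>))"
          by (auto intro!: derivative_eq_intros)
        ultimately show "((\<lambda>w. \<Phi> (of_real d * exp (\<i> * w))) has_field_derivative
            f x (of_real d * exp (\<i> * w)) * (of_real d * (exp (\<i> * w) * \<i>)))
            (at w within closed_segment 0 (of_real \<theta>))"
          by (rule DERIV_chain2)
        have "Re (- (of_real x * (a * z ^ v + r z))) \<le> - (\<epsilon> * x)" if "z \<in> A" for z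
          using mult_left_mono[OF z0(2)[OF that] x] by (simp add: \<epsilon>_def mult.commute)
        then have "norm (f x z) \<le> Ku * exp (- (\<epsilon> * x))" if "z \<in> A" for z
          unfolding f_def norm_mult norm_exp_eq_Re
          by (intro mult_mono Ku that) (use that Ku in auto)
        note this[OF wA]
        moreover have "norm (exp (\<i> * w)) = 1" using \<tau> by simp
        ultimately show "norm (f x (of_real d * exp (\<i> * w)) * (of_real d * (exp (\<i> * w) * \<i>))) \<le> Ku * exp (- (\<epsilon> * x)) * d"
          using d by (simp add: norm_mult mult_right_mono)
      qed auto
      then have "norm (\<Phi> (e * of_real d) - \<Phi> (of_real d)) \<le> Ku * d * \<bar>\<theta>\<bar> * exp (- (\<epsilon> * x))"
        by (simp add: e_def cis_conv_exp mult_ac)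
      then show ?thesis using I[of 1] I[OF ne] by (simp add: norm_minus_commute)
    qed
    have ray_eq: "e * f x (e * of_real t) = u1 (of_real t) * exp (- (of_real x * (of_real (cmod a * t ^ v) + r1 (of_real t))))"
      for x t
    proof -
      have "a = of_real (cmod a) * cis (Arg a)" using rcis_cmod_Arg[of a] by (simp add: rcis_def)
      moreover have "cis (Arg a) * e ^ v = 1"
      proof -
        have "e ^ v = cis (real v * \<theta>)" unfolding e_def by (rule Complex.DeMoivre)
        also have "real v * \<theta> = - Arg a" using assms by (simp add: \<theta>_def)
        finally show ?thesis by (simp only: cis_mult) simp
      qed
      ultimately have "a * (e * of_real t) ^ v = of_real (cmod a * t ^ v)"
        unfolding power_mult_distrib of_real_mult of_real_power
        by (metis (no_types, lifting) mult.assoc mult.right_neutral)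
      then show ?thesis unfolding f_def u1_def r1_def by simp
    qed
    have "(\<lambda>x. ?J x - ?J' x)
       \<in> O[at_top](\<lambda>x. of_real (exp (- (\<epsilon> * x)) * x powr 0))"
    proof (rule bigoI[where c = "Ku * d * \<bar>\<theta>\<bar>"])
      show "\<forall>\<^sub>F x in at_top. norm (?J x - ?J' x)
        \<le> Ku * d * \<bar>\<theta>\<bar> * norm (complex_of_real (exp (- (\<epsilon> * x)) * x powr 0))"
        using eventually_gt_at_top[of 0] by eventually_elim (use diff in auto)
    qed
    also have "(\<lambda>x. of_real (exp (- (\<epsilon> * x)) * x powr 0) :: complex) \<in> ?O"
      by (rule exp_times_powr_bigo[OF \<epsilon>])
    finally have "(\<lambda>x. ?J x - ?J' x)
       \<in> ?O" .
    moreover have "(\<lambda>x. ?J' x -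
         ?S x)
         \<in> ?O"
      using ray unfolding ray_eq coeff_eq by blast
    ultimately have "(\<lambda>x. (?J x - ?J' x) +
        (?J' x -
         ?S x))
         \<in> ?O"
      by (rule sum_in_bigo)
    then show "(\<lambda>x. integral {0..d} (\<lambda>t. u (of_real t) * exp (- (of_real x * (a * of_real t ^ v + r (of_real t))))) -
         ?S x)
      \<in> ?O"
      by (simp add: f_def)
  qed
qed

section \<open>Derivatives of smooth functions of a real variable\<close>

text \<open>Link between the real derivatives of the theorem and the complex ones of the Laplace
  part. The functions must agree on an interval, since a derivative depends on the germ.\<close>

lemma ddt_eq_deriv:
  assumes "F holomorphic_on ball 0 \<rho>" "\<And>t. \<bar>t\<bar> < \<rho> \<Longrightarrow> f t = F (of_real t)" "\<bar>t\<bar> < \<rho>"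
  shows "(f has_vector_derivative deriv F (of_real t)) (at t)"
proof -
  have "(F has_field_derivative deriv F (of_real t)) (at (of_real t))"
    by (rule holomorphic_derivI[OF assms(1)]) (use assms in auto)
  then have "((\<lambda>t. F (of_real t)) has_vector_derivative deriv F (of_real t)) (at t)"
    by (rule has_vector_derivative_real_field)
  then show ?thesis
    by (rule has_vector_derivative_transform_within_open[where S = "ball 0 \<rho>"]) (use assms in auto)
qed

lemma ddt_funpow_eq_deriv:
  assumes "F holomorphic_on ball 0 \<rho>" "\<And>t. \<bar>t\<bar> < \<rho> \<Longrightarrow> f t = F (of_real t)" "\<bar>t\<bar> < \<rho>"
  shows "(ddt ^^ n) f t = (deriv ^^ n) F (of_real t)"
  using assms(3)
proof (induction n arbitrary: t)
  case (Suc n)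
  have hol: "(deriv ^^ n) F holomorphic_on ball 0 \<rho>" by (rule holomorphic_higher_deriv[OF assms(1)]) simp
  show ?case using ddt_eq_deriv[OF hol Suc.IH Suc.prems] by (simp add: ddt_def vector_derivative_at)
qed (use assms in simp)

lemma smooth_near_0_holomorphic:
  assumes "F holomorphic_on ball 0 \<rho>" "\<And>t. \<bar>t\<bar> < \<rho> \<Longrightarrow> f t = F (of_real t)" "\<rho> > 0"
  shows "smooth_near_0 f"
  unfolding smooth_near_0_def
proof (rule eventually_nhds[THEN iffD2], intro exI conjI ballI allI)
  fix t n assume "t \<in> ball (0::real) \<rho>"
  then have t: "\<bar>t\<bar> < \<rho>" by simp
  have hol: "(deriv ^^ n) F holomorphic_on ball 0 \<rho>" by (rule holomorphic_higher_deriv[OF assms(1)]) simp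
  have "((ddt ^^ n) f has_vector_derivative deriv ((deriv ^^ n) F) (of_real t)) (at t)"
    by (rule ddt_eq_deriv[OF hol ddt_funpow_eq_deriv[OF assms(1,2)] t])
  then show "(ddt ^^ n) f differentiable (at t)" by (rule differentiableI_vector)
qed (use assms in auto)

text \<open>Unlike \<^const>\<open>smooth_near_0\<close>, this keeps the neighbourhood fixed through inductions
  on the order of the derivative.\<close>

definition smooth_on_interval :: "real \<Rightarrow> (real \<Rightarrow> complex) \<Rightarrow> bool" where
  "smooth_on_interval e f \<longleftrightarrow> (\<forall>t n. \<bar>t\<bar> < e \<longrightarrow> (ddt ^^ n) f differentiable (at t))"

lemma smooth_near_0_iff: "smooth_near_0 f \<longleftrightarrow> (\<exists>e>0. smooth_on_interval e f)"
  unfolding smooth_near_0_def eventually_nhds_metric smooth_on_interval_def by (auto simp: dist_real_def)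

lemma smooth_on_interval_mono: "smooth_on_interval e f \<Longrightarrow> e' \<le> e \<Longrightarrow> smooth_on_interval e' f"
  unfolding smooth_on_interval_def by auto

lemma smooth_on_intervalD:
  assumes "smooth_on_interval e f" "\<bar>t\<bar> < e"
  shows "((ddt ^^ n) f has_vector_derivative (ddt ^^ Suc n) f t) (at t)"
  using assms by (auto simp: smooth_on_interval_def ddt_def vector_derivative_works)

text \<open>Made for inductions on the order: the explicit formula for one derivative, valid on the
  interval, yields value and existence of the next.\<close>

lemma ddt_eqI:
  assumes "(G has_vector_derivative D) (at t)" "\<bar>t\<bar> < e" "\<And>t. \<bar>t\<bar> < e \<Longrightarrow> F t = G t"
  shows "ddt F t = D" "F differentiable (at t)"
proof -
  have "(F has_vector_derivative D) (at t)"
    by (rule has_vector_derivative_transform_within_open[OF assms(1), where S = "ball 0 e"])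
       (use assms in auto)
  then show "ddt F t = D" "F differentiable (at t)"
    by (auto simp: ddt_def vector_derivative_at intro: differentiableI_vector)
qed

lemma scaled_ddt_funpow:
  assumes "smooth_on_interval e f" "\<bar>t\<bar> < e"
  shows "(scaled_ddt b ^^ n) f t = b ^ n * (ddt ^^ n) f t"
  using assms(2)
proof (induction n arbitrary: t)
  case (Suc n)
  have "((\<lambda>t. b ^ n * (ddt ^^ n) f t) has_vector_derivative b ^ n * (ddt ^^ Suc n) f t) (at t)"
    by (rule has_vector_derivative_mult_right[OF smooth_on_intervalD[OF assms(1) Suc.prems]])
  then have "ddt ((scaled_ddt b ^^ n) f) t = b ^ n * (ddt ^^ Suc n) f t"
    by (rule ddt_eqI(1)[OF _ Suc.prems Suc.IH])
  then show ?case by (simp add: scaled_ddt_def[of b "(scaled_ddt b ^^ n) f" t])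
qed simp

lemma ddt_funpow_mult:
  assumes f: "smooth_on_interval e f" and g: "smooth_on_interval e g" and "\<bar>t\<bar> < e"
  shows "(ddt ^^ n) (\<lambda>t. f t * g t) t = (\<Sum>i\<le>n. of_nat (n choose i) * (ddt ^^ i) f t * (ddt ^^ (n - i)) g t)"
  using assms(3)
proof (induction n arbitrary: t)
  case (Suc n)
  let ?f = "\<lambda>i. (ddt ^^ i) f" and ?g = "\<lambda>i. (ddt ^^ i) g"
  have "((\<lambda>t. \<Sum>i\<le>n. of_nat (n choose i) * ?f i t * ?g (n - i) t) has_vector_derivative
     (\<Sum>i\<le>n. of_nat (n choose i) * ?f i t * ?g (Suc (n - i)) t + of_nat (n choose i) * ?f (Suc i) t * ?g (n - i) t)) (at t)"
    by (intro has_vector_derivative_sum has_vector_derivative_mult has_vector_derivative_mult_right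
        smooth_on_intervalD[OF f Suc.prems] smooth_on_intervalD[OF g Suc.prems])
  then have "(ddt ^^ Suc n) (\<lambda>t. f t * g t) t =
     (\<Sum>i\<le>n. of_nat (n choose i) * ?f i t * ?g (Suc (n - i)) t + of_nat (n choose i) * ?f (Suc i) t * ?g (n - i) t)"
    using ddt_eqI(1)[OF _ Suc.prems Suc.IH] by simp
  also have "\<dots> = (\<Sum>i\<le>n. of_nat (n choose i) * ?f i t * ?g (Suc n - i) t) +
      (\<Sum>i\<le>n. of_nat (n choose i) * ?f (Suc i) t * ?g (n - i) t)"
    unfolding sum.distrib by (intro arg_cong2[of _ _ _ _ "(+)"] sum.cong) (auto simp: Suc_diff_le)
  \<comment> \<open>The added summand i = n + 1 has binomial coefficient 0; it allows both sums to
    be shifted to the same range for Pascal's rule.\<close>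
  also have "(\<Sum>i\<le>n. of_nat (n choose i) * ?f i t * ?g (Suc n - i) t) =
      (\<Sum>i\<le>Suc n. of_nat (n choose i) * ?f i t * ?g (Suc n - i) t)" by simp
  also have "\<dots> = f t * ?g (Suc n) t + (\<Sum>i\<le>n. of_nat (n choose Suc i) * ?f (Suc i) t * ?g (n - i) t)"
    by (subst sum.atMost_Suc_shift) simp
  finally have "(ddt ^^ Suc n) (\<lambda>t. f t * g t) t = f t * ?g (Suc n) t +
      (\<Sum>i\<le>n. of_nat (Suc n choose Suc i) * ?f (Suc i) t * ?g (n - i) t)"
    by (simp add: sum.distrib[symmetric] algebra_simps)
  also have "\<dots> = (\<Sum>i\<le>Suc n. of_nat (Suc n choose i) * ?f i t * ?g (Suc n - i) t)"
    by (subst sum.atMost_Suc_shift) simp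
  finally show ?case .
qed simp

lemma smooth_on_interval_mult:
  assumes f: "smooth_on_interval e f" and g: "smooth_on_interval e g"
  shows "smooth_on_interval e (\<lambda>t. f t * g t)"
  unfolding smooth_on_interval_def
proof (intro allI impI)
  fix t n assume t: "\<bar>t\<bar> < e"
  let ?f = "\<lambda>i. (ddt ^^ i) f" and ?g = "\<lambda>i. (ddt ^^ i) g"
  have "((\<lambda>t. \<Sum>i\<le>n. of_nat (n choose i) * ?f i t * ?g (n - i) t) has_vector_derivative
     (\<Sum>i\<le>n. of_nat (n choose i) * ?f i t * ?g (Suc (n - i)) t + of_nat (n choose i) * ?f (Suc i) t * ?g (n - i) t)) (at t)"
    by (intro has_vector_derivative_sum has_vector_derivative_mult has_vector_derivative_mult_right
        smooth_on_intervalD[OF f t] smooth_on_intervalD[OF g t])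
  then show "(ddt ^^ n) (\<lambda>t. f t * g t) differentiable (at t)"
    by (rule ddt_eqI(2)[OF _ t ddt_funpow_mult[OF f g]])
qed

lemma smooth_on_interval_one: "smooth_on_interval e (\<lambda>t. 1)"
proof -
  have "(ddt ^^ n) (\<lambda>t. 1) = (\<lambda>t. if n = 0 then 1 else 0)" for n
  proof (induction n)
    case (Suc n)
    have "ddt (\<lambda>t. if n = 0 then 1 else 0) t = 0" for t by (simp add: ddt_def)
    then show ?case by (simp add: Suc)
  qed simp
  then show ?thesis by (simp add: smooth_on_interval_def)
qed

lemma smooth_on_interval_power:
  "smooth_on_interval e f \<Longrightarrow> smooth_on_interval e (\<lambda>t. f t ^ l)"
  by (induction l) (auto simp: smooth_on_interval_one intro: smooth_on_interval_mult)

section \<open>Derivatives of the phase rest and the count of derivatives\<close>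

lemma ddt_funpow_phase_rest:
  assumes g: "smooth_on_interval e g" and "\<bar>t\<bar> < e"
  shows "(ddt ^^ n) (phase_rest v g) t = (ddt ^^ n) g t - (if n = 0 then g 0 else 0) -
           phase_coeff v g * (deriv ^^ n) (\<lambda>z. z ^ v) (of_real t)"
    and "(ddt ^^ n) (phase_rest v g) differentiable (at t)"
proof -
  \<comment> \<open>The monomial t^v enters as a complex function, so that its derivatives at 0 are
    available from \<open>higher_deriv_power\<close>.\<close>
  let ?P = "\<lambda>n t. (ddt ^^ n) g t - (if n = 0 then g 0 else 0) - phase_coeff v g * (deriv ^^ n) (\<lambda>z. z ^ v) (of_real t)"
  have der: "(?P n has_vector_derivative ?P (Suc n) t) (at t)" if t: "\<bar>t\<bar> < e" for n t
  proof -
    have hol: "(deriv ^^ n) (\<lambda>z::complex. z ^ v) holomorphic_on ball 0 e"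
      by (intro holomorphic_higher_deriv holomorphic_intros) auto
    have "((\<lambda>t. (deriv ^^ n) (\<lambda>z::complex. z ^ v) (of_real t)) has_vector_derivative
        (deriv ^^ Suc n) (\<lambda>z. z ^ v) (of_real t)) (at t)"
      using ddt_eq_deriv[OF hol refl t] by simp
    then show ?thesis
      using smooth_on_intervalD[OF g t, of n] by (auto intro!: derivative_eq_intros)
  qed
  have eq: "(ddt ^^ n) (phase_rest v g) t = ?P n t" if "\<bar>t\<bar> < e" for n t
    using that
  proof (induction n arbitrary: t)
    case (Suc n)
    show ?case using ddt_eqI(1)[OF der[OF Suc.prems] Suc.prems Suc.IH] by simp
  qed (simp add: phase_rest_def)
  show "(ddt ^^ n) (phase_rest v g) t = ?P n t" by (rule eq[OF assms(2)])
  show "(ddt ^^ n) (phase_rest v g) differentiable (at t)"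
    by (rule ddt_eqI(2)[OF der[OF assms(2)] assms(2) eq])
qed

lemma smooth_on_interval_phase_rest:
  "smooth_on_interval e g \<Longrightarrow> smooth_on_interval e (phase_rest v g)"
  using ddt_funpow_phase_rest(2) unfolding smooth_on_interval_def by blast

text \<open>For a phase of order v, subtracting g 0 and the t^v term removes the whole Taylor
  polynomial of degree v and touches nothing above it.\<close>

lemma ddt_funpow_phase_rest_0:
  assumes "phase_of_order v g" "v \<ge> 1"
  shows "(ddt ^^ n) (phase_rest v g) 0 = (if n \<le> v then 0 else (ddt ^^ n) g 0)"
proof -
  obtain e where e: "e > 0" "smooth_on_interval e g"
    using assms by (auto simp: phase_of_order_def smooth_near_0_iff)
  have pow: "(deriv ^^ n) (\<lambda>z::complex. z ^ v) 0 = (if n = v then fact v else 0)"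
    using higher_deriv_power[of n "0::complex" v 0]
    by (cases "n \<le> v") (auto simp: pochhammer_fact power_0_left pochhammer_0_left intro: Suc_leI)
  show ?thesis
    using ddt_funpow_phase_rest(1)[OF e(2), of 0 n v] e(1) assms
    by (auto simp: pow phase_coeff_def phase_of_order_def Suc_le_eq)
qed

text \<open>The coefficient of \<open>u\<^sup>(\<^sup>s\<^sup>)\<close> times the product of the \<open>g\<^sup>(\<^sup>v\<^sup>+\<^sup>r\<^sup>)\<close>,
  \<open>r\<close> in the list, in the derivative of order \<open>M + v * l\<close> at 0 of \<open>u\<close> times the
  \<open>l\<close>-th power of the phase rest: the Leibniz rule splits off one factor of the power, and that
  factor needs more than \<open>v\<close> derivatives not to vanish.\<close>

primrec leibniz_coeff :: "nat \<Rightarrow> nat \<Rightarrow> nat \<Rightarrow> nat list \<Rightarrow> complex" where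
  "leibniz_coeff v M s [] = (if s = M then 1 else 0)"
| "leibniz_coeff v M s (r # q) =
    (if 1 \<le> r \<and> r \<le> M then of_nat ((M + v * Suc (length q)) choose (M - r + v * length q)) *
       leibniz_coeff v (M - r) s q else 0)"

lemma finite_derivative_index: "finite {(s, q). length q = l \<and> s + sum_list q \<le> (M::nat)}"
proof (rule finite_subset)
  show "{(s, q). length q = l \<and> s + sum_list q \<le> M} \<subseteq> {..M} \<times> {q. set q \<subseteq> {..M} \<and> length q = l}"
    using member_le_sum_list by fastforce
qed (auto intro: finite_lists_length_eq)

text \<open>The first entry r is split off. Since r <= M, the natural subtraction M - r is
  exact.\<close>

lemma derivative_index_Suc:
  "{(s, q). length q = Suc l \<and> s + sum_list q \<le> (M::nat)} =
     (\<lambda>(r, s, q). (s, r # q)) ` (SIGMA r:{..M}. {(s, q). length q = l \<and> s + sum_list q \<le> M - r})"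
  by (force simp: length_Suc_conv image_iff)

text \<open>Induction on l for all M at once: a split-off factor of the rest consumes v + r
  derivatives with r >= 1, and M - r + v l derivatives remain for u times the l-th power. Every
  factor thus lowers the budget M by the number r of derivatives of g^(v) that it
  contributes.\<close>

lemma ddt_funpow_mult_phase_rest_power:
  assumes u: "smooth_on_interval e u" and g: "smooth_on_interval e g" and "e > 0"
    and ord: "phase_of_order v g" "v \<ge> 1"
  shows "(ddt ^^ (M + v * l)) (\<lambda>t. u t * phase_rest v g t ^ l) 0 =
           derivative_polynomial v M l (leibniz_coeff v M) u g"
proof (induction l arbitrary: M)
  case 0
  have "{(s, q). length q = 0 \<and> s + sum_list q \<le> M} = (\<lambda>s. (s, [])) ` {..M}" by (auto simp: image_iff)
  then have "derivative_polynomial v M 0 (leibniz_coeff v M) u g = (\<Sum>s\<le>M. (if s = M then 1 else 0) * (ddt ^^ s) u 0)"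
    unfolding derivative_polynomial_def by (auto simp: sum.reindex inj_on_def)
  then show ?case by (simp add: mult_delta_left)
next
  case (Suc l)
  let ?R = "phase_rest v g" and ?n = "M + v * Suc l"
  let ?h = "\<lambda>t. u t * ?R t ^ l"
  have h: "smooth_on_interval e ?h"
    by (intro smooth_on_interval_mult u smooth_on_interval_power smooth_on_interval_phase_rest g)
  have "(ddt ^^ ?n) (\<lambda>t. u t * ?R t ^ Suc l) 0 = (ddt ^^ ?n) (\<lambda>t. ?h t * ?R t) 0"
    by (simp add: mult_ac)
  also have "\<dots> = (\<Sum>i\<le>?n. of_nat (?n choose i) * (ddt ^^ i) ?h 0 * (ddt ^^ (?n - i)) ?R 0)"
    by (rule ddt_funpow_mult[OF h smooth_on_interval_phase_rest[OF g]]) (use \<open>e > 0\<close> in simp)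
  also have "\<dots> = (\<Sum>j\<le>?n. of_nat (?n choose (?n - j)) * (ddt ^^ (?n - j)) ?h 0 * (ddt ^^ j) ?R 0)"
    by (rule sum.reindex_bij_witness[of _ "\<lambda>j. ?n - j" "\<lambda>j. ?n - j"]) auto
  \<comment> \<open>For j <= v the split-off factor vanishes; for j > M + v fewer than v l
    derivatives remain for a product that vanishes to that order.\<close>
  also have "\<dots> = (\<Sum>j\<in>{v<..M + v}. of_nat (?n choose (?n - j)) * (ddt ^^ (?n - j)) ?h 0 * (ddt ^^ j) ?R 0)"
  proof (rule sum.mono_neutral_right)
    show "\<forall>j\<in>{..?n} - {v<..M + v}. of_nat (?n choose (?n - j)) * (ddt ^^ (?n - j)) ?h 0 * (ddt ^^ j) ?R 0 = 0"
    proof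
      fix j assume j: "j \<in> {..?n} - {v<..M + v}"
      show "of_nat (?n choose (?n - j)) * (ddt ^^ (?n - j)) ?h 0 * (ddt ^^ j) ?R 0 = 0"
      proof (cases "j \<le> v")
        case False
        define i where "i = ?n - j"
        have i: "i < v * l" using j False by (auto simp: i_def)
        have "(ddt ^^ i) ?h 0 = 0" if "i < v * l" for i
          using that
        proof (induction l arbitrary: i)
          case (Suc l)
          let ?h = "\<lambda>t. u t * ?R t ^ l"
          have h: "smooth_on_interval e ?h"
            by (intro smooth_on_interval_mult u smooth_on_interval_power smooth_on_interval_phase_rest g)
          have "(ddt ^^ i) (\<lambda>t. ?h t * ?R t) 0 = (\<Sum>j\<le>i. of_nat (i choose j) * (ddt ^^ j) ?h 0 * (ddt ^^ (i - j)) ?R 0)"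
            by (rule ddt_funpow_mult[OF h smooth_on_interval_phase_rest[OF g]]) (use \<open>e > 0\<close> in simp)
          also have "\<dots> = 0"
          proof (rule sum.neutral, rule ballI)
            fix j assume "j \<in> {..i}"
            then have "j < v * l \<or> i - j \<le> v" using Suc.prems by auto
            then show "of_nat (i choose j) * (ddt ^^ j) ?h 0 * (ddt ^^ (i - j)) ?R 0 = 0"
              using Suc.IH[of j] ddt_funpow_phase_rest_0[OF ord] by auto
          qed
          finally show ?case by (simp add: mult_ac)
        qed simp
        from this[OF i] show ?thesis unfolding i_def by simp
      qed (simp add: ddt_funpow_phase_rest_0[OF ord])
    qed
  qed auto
  also have "\<dots> = (\<Sum>r\<in>{1..M}. of_nat (?n choose (M - r + v * l)) * (ddt ^^ (M - r + v * l)) ?h 0 * (ddt ^^ (v + r)) g 0)"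
    by (rule sum.reindex_bij_witness[of _ "\<lambda>r. v + r" "\<lambda>j. j - v"])
       (auto simp: ddt_funpow_phase_rest_0[OF ord] algebra_simps)
  also have "\<dots> = (\<Sum>r\<in>{1..M}. \<Sum>(s, q)\<in>{(s, q). length q = l \<and> s + sum_list q \<le> M - r}.
      leibniz_coeff v M s (r # q) * (ddt ^^ s) u 0 * (\<Prod>r\<leftarrow>r # q. (ddt ^^ r) ((ddt ^^ v) g) 0))"
  proof (rule sum.cong, simp)
    fix r assume r: "r \<in> {1..M}"
    have "(ddt ^^ (v + r)) g = (ddt ^^ r) ((ddt ^^ v) g)" by (simp add: funpow_add add.commute[of v])
    then show "of_nat (?n choose (M - r + v * l)) * (ddt ^^ (M - r + v * l)) ?h 0 * (ddt ^^ (v + r)) g 0 =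
      (\<Sum>(s, q)\<in>{(s, q). length q = l \<and> s + sum_list q \<le> M - r}.
        leibniz_coeff v M s (r # q) * (ddt ^^ s) u 0 * (\<Prod>r\<leftarrow>r # q. (ddt ^^ r) ((ddt ^^ v) g) 0))"
      unfolding Suc.IH[of "M - r"] derivative_polynomial_def sum_distrib_left sum_distrib_right
      by (intro sum.cong refl) (use r in \<open>auto simp: mult_ac\<close>)
  qed
  \<comment> \<open>The index r = 0 is added to match \<open>derivative_index_Suc\<close>;
    \<open>leibniz_coeff\<close> is 0 there.\<close>
  also have "\<dots> = (\<Sum>r\<in>{..M}. \<Sum>(s, q)\<in>{(s, q). length q = l \<and> s + sum_list q \<le> M - r}.
      leibniz_coeff v M s (r # q) * (ddt ^^ s) u 0 * (\<Prod>r\<leftarrow>r # q. (ddt ^^ r) ((ddt ^^ v) g) 0))"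
    by (rule sum.mono_neutral_left) (auto intro!: sum.neutral)
  also have "\<dots> = (\<Sum>(r, s, q)\<in>(SIGMA r:{..M}. {(s, q). length q = l \<and> s + sum_list q \<le> M - r}).
      leibniz_coeff v M s (r # q) * (ddt ^^ s) u 0 * (\<Prod>r\<leftarrow>r # q. (ddt ^^ r) ((ddt ^^ v) g) 0))"
    by (subst sum.Sigma) (use finite_derivative_index in \<open>auto simp only: split_def\<close>)
  also have "\<dots> = derivative_polynomial v M (Suc l) (leibniz_coeff v M) u g"
    unfolding derivative_polynomial_def derivative_index_Suc
    by (subst sum.reindex) (auto simp: inj_on_def o_def split_def)
  finally show ?case .
qed

text \<open>The scale comes out as the power b^(M + v l). The constant c takes up sign, Gamma value,
  factorials and, for odd v, the powers of zeta; being independent of u and g, it can be merged into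
  the coefficients.\<close>

lemma derivatives_at_most_leibniz:
  assumes "v \<ge> 1" and P: "\<And>u g. (u, g) \<in> P \<Longrightarrow> smooth_near_0 u \<and> phase_of_order v g"
    and T: "\<And>u g. T u g = c * (scaled_ddt (b g) ^^ (M + v * l)) (\<lambda>t. u t * phase_rest v g t ^ l) 0"
  shows "derivatives_at_most v M (M + v * l) l b T P"
  unfolding derivatives_at_most_def
proof (intro exI allI impI)
  fix u g
  assume "(smooth_near_0 u \<and> phase_of_order v g) \<or> (u, g) \<in> P"
  then have u: "smooth_near_0 u" and g: "phase_of_order v g" using P by auto
  obtain e1 e2 where "e1 > 0" "smooth_on_interval e1 u" "e2 > 0" "smooth_on_interval e2 g"
    using u g unfolding phase_of_order_def smooth_near_0_iff by blast
  then obtain e where e: "e > 0" "smooth_on_interval e u" "smooth_on_interval e g"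
    by (metis min.cobounded1 min.cobounded2 min_less_iff_conj smooth_on_interval_mono)
  have "T u g = c * (b g ^ (M + v * l) * (ddt ^^ (M + v * l)) (\<lambda>t. u t * phase_rest v g t ^ l) 0)"
    unfolding T using e
    by (subst scaled_ddt_funpow[where e = e])
       (auto intro!: smooth_on_interval_mult smooth_on_interval_power smooth_on_interval_phase_rest)
  also have "\<dots> = b g ^ (M + v * l) * derivative_polynomial v M l (\<lambda>s q. c * leibniz_coeff v M s q) u g"
    unfolding ddt_funpow_mult_phase_rest_power[OF e(2,3,1) g assms(1)]
    by (simp add: derivative_polynomial_def sum_distrib_left mult_ac split_def)
  finally show "T u g = b g ^ (M + v * l) * derivative_polynomial v M l (\<lambda>s q. c * leibniz_coeff v M s q) u g" .
qed

section \<open>Two-sided Laplace integrals\<close>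

lemma higher_deriv_reflect_0:
  assumes "f holomorphic_on ball 0 \<rho>" "\<rho> > 0"
  shows "(deriv ^^ m) (\<lambda>z. f (- z)) 0 = (- 1) ^ m * (deriv ^^ m) f 0"
  using higher_deriv_compose_linear[of f "ball 0 \<rho>" "ball 0 \<rho>" 0 "- 1" m] assms by simp

lemma holomorphic_reflect:
  assumes "f holomorphic_on ball 0 \<rho>"
  shows "(\<lambda>z. f (- z)) holomorphic_on ball 0 \<rho>"
  by (rule holomorphic_on_compose_gen[OF _ assms, unfolded o_def]) (auto intro!: holomorphic_intros)

text \<open>The left half becomes a half-line integral under t -> - t, with leading coefficient
  (-1)^v a and reflected u and r.\<close>

lemma laplace_two_sided:
  fixes u r :: "complex \<Rightarrow> complex"
  assumes "v \<ge> 1" "a \<noteq> 0" "\<rho> > 0"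
    and holu: "u holomorphic_on ball 0 \<rho>" and holr: "r holomorphic_on ball 0 \<rho>"
    and r0: "\<And>i. i \<le> v \<Longrightarrow> (deriv ^^ i) r 0 = 0"
    and pos: "\<And>t::real. t \<noteq> 0 \<Longrightarrow> \<bar>t\<bar> < \<rho> \<Longrightarrow> Re (a * of_real t ^ v + r (of_real t)) > 0"
  shows "\<forall>\<^sub>F d in at_right 0. laplace_expansion
    (\<lambda>x. integral {-d..d} (\<lambda>t. u (of_real t) * exp (- (of_real x * (a * of_real t ^ v + r (of_real t))))))
    v (\<lambda>k. laplace_coeff v (a powr (- 1 / of_nat v)) u r k +
       laplace_coeff v (((- 1) ^ v * a) powr (- 1 / of_nat v)) (\<lambda>z. u (- z)) (\<lambda>z. r (- z)) k)"
proof -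
  let ?a' = "(- 1) ^ v * a"
  have "\<forall>\<^sub>F d in at_right 0. 0 < d \<and> d < \<rho>"
    using eventually_at_right_real[of 0 \<rho>] assms by (auto elim: eventually_mono)
  moreover have "\<forall>\<^sub>F d in at_right 0. laplace_expansion
    (\<lambda>x. integral {0..d} (\<lambda>t. u (of_real t) * exp (- (of_real x * (a * of_real t ^ v + r (of_real t))))))
    v (laplace_coeff v (a powr (- 1 / of_nat v)) u r)"
    by (rule laplace_half_line) (use assms in auto)
  moreover have "\<forall>\<^sub>F d in at_right 0. laplace_expansion
    (\<lambda>x. integral {0..d} (\<lambda>t. u (- of_real t) * exp (- (of_real x * (?a' * of_real t ^ v + r (- of_real t))))))
    v (laplace_coeff v (?a' powr (- 1 / of_nat v)) (\<lambda>z. u (- z)) (\<lambda>z. r (- z)))"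
  proof (rule laplace_half_line[where u = "\<lambda>z. u (- z)" and r = "\<lambda>z. r (- z)"])
    show "(deriv ^^ i) (\<lambda>z. r (- z)) 0 = 0" if "i \<le> v" for i
      using higher_deriv_reflect_0[OF holr \<open>\<rho> > 0\<close>] r0[OF that] by simp
    show "Re (?a' * of_real t ^ v + r (- of_real t)) > 0" if "0 < t" "t < \<rho>" for t
    proof -
      have "a * of_real (- t) ^ v = ?a' * of_real t ^ v"
        by (simp add: power_minus[of "of_real t"])
      moreover have "0 < Re (a * of_real (- t) ^ v + r (of_real (- t)))"
        using pos[of "- t"] that by simp
      ultimately show ?thesis by (simp only: of_real_minus)
    qed
  qed (use assms holomorphic_reflect in auto)
  ultimately show ?thesis
  proof (eventually_elim, unfold laplace_expansion_def, intro allI)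
    fix d M
    let ?f = "\<lambda>x t. u (of_real t) * exp (- (of_real x * (a * of_real t ^ v + r (of_real t))))"
    let ?C = "laplace_coeff v (a powr (- 1 / of_nat v)) u r"
    let ?C' = "laplace_coeff v (?a' powr (- 1 / of_nat v)) (\<lambda>z. u (- z)) (\<lambda>z. r (- z))"
    let ?J' = "\<lambda>x. integral {0..d} (\<lambda>t. u (- of_real t) * exp (- (of_real x * (?a' * of_real t ^ v + r (- of_real t)))))"
    let ?S = "\<lambda>C x. \<Sum>k<M. cpowr (- (real (k + 1) / real v)) x * C k"
    let ?O = "O[at_top](cpowr (- (real (M + 1) / real v)))"
    assume d: "0 < d \<and> d < \<rho>"
    assume 1: "\<forall>M. (\<lambda>x. integral {0..d} (?f x) - (\<Sum>k<M. cpowr (- (real (k + 1) / real v)) x * ?C k))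
      \<in> O[at_top](cpowr (- (real (M + 1) / real v)))"
    assume 2: "\<forall>M. (\<lambda>x. ?J' x -
         (\<Sum>k<M. cpowr (- (real (k + 1) / real v)) x * ?C' k))
      \<in> O[at_top](cpowr (- (real (M + 1) / real v)))"
    have cont: "continuous_on {-d..d} (\<lambda>t. h (complex_of_real t))" if "h holomorphic_on ball 0 \<rho>" for h
      by (rule continuous_on_compose2[OF holomorphic_on_imp_continuous_on[OF that]])
         (use d in \<open>auto intro!: continuous_intros\<close>)
    have "integral {-d..d} (?f x) = integral {0..d} (?f x) +
        ?J' x" for x
    proof -
      have "?f x integrable_on {-d..d}"
        by (intro integrable_continuous_interval continuous_intros cont holu holr)
      then have e1: "integral {-d..0} (?f x) + integral {0..d} (?f x) = integral {-d..d} (?f x)"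
        by (intro Henstock_Kurzweil_Integration.integral_combine) (use d in auto)
      have e2: "integral {-d..0} (?f x) = integral {0..d} (\<lambda>t. ?f x (- t))"
        using Henstock_Kurzweil_Integration.integral_reflect_real[where f = "\<lambda>t. ?f x (- t)" and a = 0 and b = d] by simp
      have e3: "?f x (- t) = u (- of_real t) * exp (- (of_real x * (?a' * of_real t ^ v + r (- of_real t))))" for t
        by (simp add: power_minus[of "of_real t"] mult_ac)
      show ?thesis unfolding e1[symmetric] e2 e3 by (rule add.commute)
    qed
    then have "(\<lambda>x. integral {-d..d} (?f x) - (\<Sum>k<M. cpowr (- (real (k + 1) / real v)) x * (?C k + ?C' k))) =
       (\<lambda>x. (integral {0..d} (?f x) - ?S ?C x) +
        (?J' x -
         ?S ?C' x))"
      by (simp add: fun_eq_iff distrib_left sum.distrib)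
    also have "\<dots> \<in> ?O"
      by (rule sum_in_bigo(1)[OF 1[rule_format] 2[rule_format]])
    finally show "(\<lambda>x. integral {-d..d} (?f x) - (\<Sum>k<M. cpowr (- (real (k + 1) / real v)) x * (?C k + ?C' k)))
      \<in> ?O" .
  qed
qed

lemma laplace_coeff_reflect:
  assumes holu: "u holomorphic_on ball 0 \<rho>" and holr: "r holomorphic_on ball 0 \<rho>" and "\<rho> > 0"
  shows "laplace_coeff v s (\<lambda>z. u (- z)) (\<lambda>z. r (- z)) k =
     (\<Sum>l\<le>k. (- 1) ^ l * of_real (Gamma (real (k + v * l + 1) / real v)) / (fact l * of_nat v) *
        ((- 1) ^ (k + v * l) * s ^ (k + v * l + 1)) *
        ((deriv ^^ (k + v * l)) (\<lambda>z. u z * r z ^ l) 0 / fact (k + v * l)))"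
proof -
  have "(deriv ^^ m) (\<lambda>z. u (- z) * r (- z) ^ l) 0 = (- 1) ^ m * (deriv ^^ m) (\<lambda>z. u z * r z ^ l) 0" for m l
    by (rule higher_deriv_reflect_0[where f = "\<lambda>z. u z * r z ^ l" and \<rho> = \<rho>]) (intro holomorphic_intros holu holr, rule \<open>\<rho> > 0\<close>)
  then show ?thesis unfolding laplace_coeff_def by (simp add: mult_ac)
qed

text \<open>For even v the sign (-1)^(k + v l) does not depend on l. So in the two-sided sum the odd
  k cancel and the even k double, which accounts for the indices 2k and for the prefactor 1/(pi v)
  in place of 1/(2 pi v).\<close>

lemma laplace_coeff_reflect_even:
  assumes holu: "u holomorphic_on ball 0 \<rho>" and holr: "r holomorphic_on ball 0 \<rho>" and "\<rho> > 0"
    and "even v"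
  shows "laplace_coeff v s (\<lambda>z. u (- z)) (\<lambda>z. r (- z)) k = (- 1) ^ k * laplace_coeff v s u r k"
proof -
  have "(- 1) ^ (k + v * l) = ((- 1) ^ k :: complex)" for l
    using \<open>even v\<close> by (simp add: power_add)
  then show ?thesis
    unfolding laplace_coeff_reflect[OF assms(1-3)] laplace_coeff_def sum_distrib_left
    by (intro sum.cong refl) (simp add: mult_ac)
qed

text \<open>For imaginary a the principal roots of a and - a are a common modulus times zeta and its
  inverse, in an order depending on the sign of Im a. The factor \<open>\<i> * sgn a\<close> in
  \<open>scale_odd\<close> is the real sign that compensates for this order.\<close>

lemma laplace_coeff_odd_sum:
  assumes holu: "u holomorphic_on ball 0 \<rho>" and holr: "r holomorphic_on ball 0 \<rho>" and "\<rho> > 0"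
    and "odd v" "Re a = 0" "a \<noteq> 0"
    and D: "\<And>m l. (scaled_ddt (scale_odd v g) ^^ m) (\<lambda>t. ut t * phase_rest v g t ^ l) 0 =
              scale_odd v g ^ m * (deriv ^^ m) (\<lambda>z. u z * r z ^ l) 0"
    and a: "a = phase_coeff v g"
  shows "laplace_coeff v (a powr (- 1 / of_nat v)) u r k +
      laplace_coeff v (((- 1) ^ v * a) powr (- 1 / of_nat v)) (\<lambda>z. u (- z)) (\<lambda>z. r (- z)) k =
      of_real (cmod a powr (- 1 / real v)) / of_nat v * L_odd v k ut g"
proof -
  let ?s = "a powr (- 1 / of_nat v)" and ?s' = "((- 1) ^ v * a) powr (- 1 / of_nat v)"
  define \<beta> where "\<beta> = complex_of_real (cmod a powr (- 1 / real v))"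
  define \<zeta> where "\<zeta> = zeta_root v"
  have v0: "v > 0" using \<open>odd v\<close> by (rule odd_pos)
  have \<zeta>0: "\<zeta> \<noteq> 0" by (simp add: \<zeta>_def zeta_root_def)
  \<comment> \<open>The principal logarithm has imaginary part pi/2 or - pi/2 here; multiplied by -
    1/v it gives the inverse of zeta or zeta.\<close>
  have powr_imag: "(\<i> * of_real y) powr (- 1 / of_nat v) =
      of_real (\<bar>y\<bar> powr (- 1 / real v)) * (if y > 0 then inverse \<zeta> else \<zeta>)" if "y \<noteq> 0" for y :: real
  proof -
    have "Ln (\<i> * of_real y) = of_real (ln \<bar>y\<bar>) + (if y > 0 then \<i> * of_real pi / 2 else - (\<i> * of_real pi / 2))"
    proof (cases "y > 0")
      case True
      then have "Ln (of_real y * \<i>) = of_real (ln y) + Ln \<i>" by (subst Ln_times_of_real) (auto simp: Ln_of_real)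
      then show ?thesis using True by (simp add: mult.commute)
    next
      case False
      then have "Ln (of_real (- y) * (- \<i>)) = of_real (ln (- y)) + Ln (- \<i>)"
        using that Ln_of_real[of "- y"] by (subst Ln_times_of_real) auto
      then show ?thesis using False that by (simp add: mult.commute)
    qed
    then have "(\<i> * of_real y) powr (- 1 / of_nat v) = exp (- 1 / of_nat v *
       (of_real (ln \<bar>y\<bar>) + (if y > 0 then \<i> * of_real pi / 2 else - (\<i> * of_real pi / 2))))"
      using that by (simp add: powr_def)
    also have "\<dots> = exp (of_real (- 1 / real v * ln \<bar>y\<bar>)) * (if y > 0 then inverse \<zeta> else \<zeta>)"
      unfolding \<zeta>_def zeta_root_def exp_minus[symmetric]
      by (auto simp: exp_add[symmetric] distrib_left mult_ac)
    also have "exp (of_real (- 1 / real v * ln \<bar>y\<bar>)) = complex_of_real (\<bar>y\<bar> powr (- 1 / real v))"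
      unfolding exp_of_real using that by (simp add: powr_def)
    finally show ?thesis .
  qed
  have aeq: "a = \<i> * of_real (Im a)" using \<open>Re a = 0\<close> by (simp add: complex_eq_iff)
  then have y0: "Im a \<noteq> 0" and cm: "cmod a = \<bar>Im a\<bar>" using \<open>a \<noteq> 0\<close> \<open>Re a = 0\<close> by (auto simp: cmod_def)
  define \<sigma> where "\<sigma> = (if Im a > 0 then 1 else - 1 :: complex)"
  have "sgn a = \<i> * \<sigma>"
    using y0 unfolding sgn_eq cm by (subst aeq) (auto simp: \<sigma>_def field_simps)
  then have "scale_odd v g = \<beta> * (\<i> * \<i>) * \<sigma>"
    by (simp only: scale_odd_def a[symmetric] \<beta>_def mult.assoc)
  then have so: "scale_odd v g = - \<sigma> * \<beta>" by simp
  have s1: "?s = \<beta> * (if Im a > 0 then inverse \<zeta> else \<zeta>)"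
    using powr_imag[OF y0] aeq by (simp add: \<beta>_def cm)
  have s2: "?s' = \<beta> * (if Im a > 0 then \<zeta> else inverse \<zeta>)"
  proof -
    have "(- 1) ^ v * a = \<i> * of_real (- Im a)" using \<open>odd v\<close> by (subst aeq) simp
    then show ?thesis using powr_imag[of "- Im a"] y0 by (auto simp: \<beta>_def cm)
  qed
  \<comment> \<open>If Im a > 0, the power m of \<open>scale_odd\<close> carries (-1)^m, which moves
    the sign from one power of zeta to the other; if Im a < 0, both sides already agree.\<close>
  have key: "?s ^ (m + 1) + (- 1) ^ m * ?s' ^ (m + 1) =
     \<beta> * ((\<zeta> powi int (m + 1) + (- 1) ^ m * \<zeta> powi (- int (m + 1))) * scale_odd v g ^ m)" for m
  proof -
    have p: "\<zeta> powi int (m + 1) = \<zeta> ^ (m + 1)" "\<zeta> powi (- int (m + 1)) = inverse \<zeta> ^ (m + 1)"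
      by (simp_all only: power_int_of_nat power_int_minus power_inverse)
    have sq: "(- 1) ^ m * (- 1) ^ m = (1::complex)" by (simp flip: power_mult_distrib)
    show ?thesis
    proof (cases "Im a > 0")
      case True
      then have "scale_odd v g ^ m = (- 1) ^ m * \<beta> ^ m"
        unfolding so \<sigma>_def by (simp add: power_minus[of \<beta>])
      then show ?thesis unfolding s1 s2 p using True sq
        by (simp only: power_mult_distrib if_True power_add power_one_right) (simp add: algebra_simps)
    next
      case False
      then have "scale_odd v g ^ m = \<beta> ^ m" unfolding so \<sigma>_def by simp
      then show ?thesis unfolding s1 s2 p using False
        by (simp only: power_mult_distrib if_False power_add power_one_right) (simp add: algebra_simps)
    qed
  qed
  have "laplace_coeff v ?s u r k +
      laplace_coeff v ?s' (\<lambda>z. u (- z)) (\<lambda>z. r (- z)) k =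
     (\<Sum>l\<le>k. (- 1) ^ l * of_real (Gamma (real (k + v * l + 1) / real v)) / (fact l * of_nat v) *
        (?s ^ (k + v * l + 1) + (- 1) ^ (k + v * l) * ?s' ^ (k + v * l + 1)) *
        ((deriv ^^ (k + v * l)) (\<lambda>z. u z * r z ^ l) 0 / fact (k + v * l)))"
    unfolding laplace_coeff_reflect[OF assms(1-3)] unfolding laplace_coeff_def sum.distrib[symmetric]
    by (intro sum.cong refl) (simp only: distrib_left distrib_right)
  also have "\<dots> = \<beta> / of_nat v * L_odd v k ut g"
    unfolding key L_odd_def L_odd_term_def D sum_distrib_left \<zeta>_def[symmetric]
    by (intro sum.cong refl) (simp add: field_simps del: power_Suc of_nat_add of_nat_Suc of_nat_mult)
  finally show ?thesis by (simp add: \<beta>_def)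
qed

text \<open>Of the 2k + v l + 1 factors a^(-1/v) one stays in front and the others become the scale
  of the differential operator.\<close>

lemma laplace_coeff_even:
  assumes D: "\<And>m l. (scaled_ddt (scale_even v g) ^^ m) (\<lambda>t. ut t * phase_rest v g t ^ l) 0 =
              scale_even v g ^ m * (deriv ^^ m) (\<lambda>z. u z * r z ^ l) 0"
    and a: "a = phase_coeff v g"
  shows "laplace_coeff v (a powr (- 1 / of_nat v)) u r (2 * k) =
      a powr (- 1 / of_nat v) / of_nat v * L_even v k ut g"
  unfolding laplace_coeff_def L_even_def L_even_term_def D sum_distrib_left
  by (intro sum.cong refl) (simp add: scale_even_def a[symmetric] field_simps del: of_nat_add of_nat_Suc of_nat_mult)

section \<open>Holomorphic functions of two variables\<close>

lemma continuous_on_contour_integral_param: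
  assumes "continuous_on (S \<times> path_image \<gamma>) (\<lambda>(w, y). f w y)" "path \<gamma>"
    and "continuous_on {0..1} (\<lambda>t. vector_derivative \<gamma> (at t))"
  shows "continuous_on S (\<lambda>w. contour_integral \<gamma> (f w))"
proof -
  have "continuous_on (S \<times> cbox 0 1) (\<lambda>(w, t). f w (\<gamma> t) * vector_derivative \<gamma> (at t))"
  proof -
    have 1: "continuous_on (S \<times> cbox 0 1) (\<lambda>x. (\<lambda>(w, y). f w y) (fst x, \<gamma> (snd x)))"
      by (rule continuous_on_compose2[OF assms(1)])
         (use assms(2) in \<open>auto simp: path_def path_image_def intro!: continuous_intros continuous_on_compose2[of "{0..1}" \<gamma>]\<close>)
    have 2: "continuous_on (S \<times> cbox 0 1) (\<lambda>x. vector_derivative \<gamma> (at (snd x)))"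
      by (rule continuous_on_compose2[OF assms(3)]) (auto intro!: continuous_intros)
    show ?thesis using continuous_on_mult[OF 1 2] by (simp add: split_def)
  qed
  then have "continuous_on S (\<lambda>w. integral (cbox 0 1) (\<lambda>t. f w (\<gamma> t) * vector_derivative \<gamma> (at t)))"
    by (rule integral_continuous_on_param)
  then show ?thesis by (simp add: contour_integral_integral)
qed

text \<open>Morera's theorem: joint continuity permits exchanging the integral over a triangle with
  the one over the circle, and the inner triangle integral vanishes by Cauchy's theorem.\<close>

lemma holomorphic_on_contour_integral_param:
  assumes "open U" "r \<ge> 0"
    and cont: "continuous_on (U \<times> sphere z0 r) (\<lambda>(w, y). f w y)"
    and hol: "\<And>y. y \<in> sphere z0 r \<Longrightarrow> (\<lambda>w. f w y) holomorphic_on U"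
  shows "(\<lambda>w. contour_integral (circlepath z0 r) (f w)) holomorphic_on U"
proof -
  let ?\<gamma> = "circlepath z0 r"
  let ?I = "\<lambda>w. contour_integral ?\<gamma> (f w)"
  have vd: "continuous_on {0..1} (\<lambda>t. vector_derivative ?\<gamma> (at t))"
    by (simp add: vector_derivative_circlepath) (intro continuous_intros)
  have vdl: "continuous_on {0..1} (\<lambda>t. vector_derivative (linepath a b) (at t))" for a b :: complex
    by simp
  have im: "path_image ?\<gamma> = sphere z0 r" using \<open>r \<ge> 0\<close> by simp
  have contI: "continuous_on U ?I"
    by (rule continuous_on_contour_integral_param) (use cont vd im in auto)
  have "?I analytic_on U"
  proof (rule Morera_triangle[OF contI \<open>open U\<close>], rule impI)
    fix a b c assume sub: "convex hull {a, b, c} \<subseteq> U"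
    have seg: "closed_segment x y \<subseteq> U" if "x \<in> {a, b, c}" "y \<in> {a, b, c}" for x y
    proof -
      have "closed_segment x y \<subseteq> convex hull {a, b, c}"
        unfolding segment_convex_hull by (rule hull_mono) (use that in auto)
      then show ?thesis using sub by auto
    qed
    let ?L = "\<lambda>x y \<eta>. contour_integral (linepath x y) (\<lambda>w. f w \<eta>)" and ?L' = "\<lambda>x y. contour_integral (linepath x y) ?I"
    have swap: "?L' x y = contour_integral ?\<gamma> (\<lambda>\<eta>. ?L x y \<eta>)"
      and int: "(\<lambda>\<eta>. ?L x y \<eta>) contour_integrable_on ?\<gamma>"
      if "x \<in> {a, b, c}" "y \<in> {a, b, c}" for x y
    proof -
      have c': "continuous_on (path_image (linepath x y) \<times> path_image ?\<gamma>) (\<lambda>(w, y). f w y)"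
        by (rule continuous_on_subset[OF cont]) (use seg[OF that] im in auto)
      show "?L' x y = contour_integral ?\<gamma> (\<lambda>\<eta>. ?L x y \<eta>)"
        by (rule contour_integral_swap[OF c' _ _ vdl vd]) auto
      have "continuous_on (path_image ?\<gamma> \<times> path_image (linepath x y)) (\<lambda>(\<eta>, w). f w \<eta>)"
      proof -
        have "continuous_on (path_image ?\<gamma> \<times> path_image (linepath x y)) (\<lambda>x. (\<lambda>(w, y). f w y) (snd x, fst x))"
          by (rule continuous_on_compose2[OF c']) (auto intro!: continuous_intros)
        then show ?thesis by (simp add: split_def)
      qed
      then have "continuous_on (path_image ?\<gamma>) (\<lambda>\<eta>. ?L x y \<eta>)"
        by (rule continuous_on_contour_integral_param) (simp, rule vdl)
      then show "(\<lambda>\<eta>. ?L x y \<eta>) contour_integrable_on ?\<gamma>"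
        by (rule contour_integrable_continuous_circlepath)
    qed
    have "?L' a b + ?L' b c + ?L' c a =
       contour_integral ?\<gamma> (\<lambda>\<eta>. ?L a b \<eta> +
         ?L b c \<eta> + ?L c a \<eta>)"
      using int[of a b] int[of b c] int[of c a] swap[of a b] swap[of b c] swap[of c a]
      by (simp add: contour_integral_add contour_integrable_add)
    also have "\<dots> = contour_integral ?\<gamma> (\<lambda>\<eta>. 0)"
    proof (rule contour_integral_eq)
      fix \<eta> assume "\<eta> \<in> path_image ?\<gamma>"
      then have "(\<lambda>w. f w \<eta>) holomorphic_on U" unfolding im by (rule hol)
      then have h: "(\<lambda>w. f w \<eta>) holomorphic_on convex hull {a, b, c}" using sub by (rule holomorphic_on_subset)
      have ci: "(\<lambda>w. f w \<eta>) contour_integrable_on linepath x y" if "x \<in> {a, b, c}" "y \<in> {a, b, c}" for x y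
        by (intro contour_integrable_continuous_linepath holomorphic_on_imp_continuous_on
            holomorphic_on_subset[OF \<open>(\<lambda>w. f w \<eta>) holomorphic_on U\<close>] seg that)
      have "contour_integral (linepath a b +++ linepath b c +++ linepath c a) (\<lambda>w. f w \<eta>) = 0"
        by (rule contour_integral_unique[OF Cauchy_theorem_triangle[OF h]])
      then show "?L a b \<eta> +
         ?L b c \<eta> + ?L c a \<eta> = 0"
        using ci[of a b] ci[of b c] ci[of c a] by (simp add: contour_integral_join add.assoc)
    qed
    finally show "?L' a b + ?L' b c + ?L' c a = 0"
      by simp
  qed
  then show ?thesis by (rule analytic_imp_holomorphic)
qed

section \<open>Slices, polydiscs and Fourier coefficients\<close>

lemma holomorphic2_on_imp_continuous_on: "holomorphic2_on f D \<Longrightarrow> continuous_on D f"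
  unfolding holomorphic2_on_def
  by (meson continuous_at_imp_continuous_on has_derivative_continuous)

lemma has_derivative_pair_slices:
  assumes "(f has_derivative (\<lambda>z. A * fst z + B * snd z)) (at (w, y))"
  shows "((\<lambda>w. f (w, y)) has_field_derivative A) (at w)"
    and "((\<lambda>y. f (w, y)) has_field_derivative B) (at y)"
proof -
  have "((\<lambda>w. (w, y)) has_derivative (\<lambda>z. (z, 0))) (at w)" by (auto intro!: derivative_eq_intros)
  from has_derivative_compose[OF this assms] show "((\<lambda>w. f (w, y)) has_field_derivative A) (at w)"
    by (simp add: has_field_derivative_def)
  have "((\<lambda>y. (w, y)) has_derivative (\<lambda>z. (0, z))) (at y)" by (auto intro!: derivative_eq_intros)
  from has_derivative_compose[OF this assms] show "((\<lambda>y. f (w, y)) has_field_derivative B) (at y)"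
    by (simp add: has_field_derivative_def)
qed

lemma holomorphic2_on_has_derivative:
  assumes "holomorphic2_on f D" "x \<in> D"
  shows "(f has_derivative (\<lambda>z. pd1 f x * fst z + pd2 f x * snd z)) (at x)"
proof -
  obtain A B where AB: "(f has_derivative (\<lambda>z. A * fst z + B * snd z)) (at x)"
    using assms unfolding holomorphic2_on_def by blast
  have "pd1 f x = A" "pd2 f x = B"
    using has_derivative_pair_slices[of f A B "fst x" "snd x"] AB
    by (auto simp: pd1_def pd2_def intro!: DERIV_imp_deriv)
  then show ?thesis using AB by simp
qed

lemma holomorphic2_on_slices:
  assumes "holomorphic2_on f D"
  shows "(\<And>w. w \<in> A \<Longrightarrow> (w, y) \<in> D) \<Longrightarrow> (\<lambda>w. f (w, y)) holomorphic_on A"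
    and "(\<And>y. y \<in> B \<Longrightarrow> (w, y) \<in> D) \<Longrightarrow> (\<lambda>y. f (w, y)) holomorphic_on B"
  using has_derivative_pair_slices[OF holomorphic2_on_has_derivative[OF assms]]
  unfolding holomorphic_on_def by (meson field_differentiable_def field_differentiable_at_within)+

lemma pd1_funpow: "(pd1 ^^ m) f (w, y) = (deriv ^^ m) (\<lambda>w. f (w, y)) w"
  by (induction m arbitrary: w) (auto simp: pd1_def)

lemma pd2_funpow: "(pd2 ^^ n) f (w, y) = (deriv ^^ n) (\<lambda>y. f (w, y)) y"
  by (induction n arbitrary: y) (auto simp: pd2_def)

lemma maclaurin_coeff_eq:
  "maclaurin_coeff f m n = (deriv ^^ m) (\<lambda>w. (deriv ^^ n) (\<lambda>y. f (w, y)) 0) 0 / (fact m * fact n)"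
  unfolding maclaurin_coeff_def pd1_funpow pd2_funpow ..

text \<open>A compact set in an open one has a closed neighbourhood of some radius e inside it.
  Radial projection moves each coordinate of the enlarged polydisc by at most e/2, hence the point
  by at most e.\<close>

lemma closed_polydisc_enlarge:
  assumes "open (S :: (complex \<times> complex) set)" "cball 0 r1 \<times> cball 0 r2 \<subseteq> S" "r1 \<ge> 0" "r2 \<ge> 0"
  obtains e where "e > 0" "cball 0 (r1 + e) \<times> cball 0 (r2 + e) \<subseteq> S"
proof -
  have "compact (cball (0::complex) r1 \<times> cball (0::complex) r2)" by (intro compact_Times compact_cball)
  then obtain e where e: "e > 0" "{x. infdist x (cball 0 r1 \<times> cball 0 r2) \<le> e} \<subseteq> S"
    using compact_in_open_separated[of "cball 0 r1 \<times> cball 0 r2" S] assms by auto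
  have near: "\<exists>z'\<in>cball 0 r. dist z z' \<le> e / 2" if "z \<in> cball 0 (r + e / 2)" "r \<ge> 0" for z :: complex and r
  proof (cases "norm z \<le> r")
    case True then show ?thesis using e(1) by (intro bexI[of _ z]) auto
  next
    case False
    let ?z' = "of_real (r / norm z) * z"
    have "norm ?z' = \<bar>r / norm z\<bar> * norm z" by (simp only: norm_mult norm_of_real)
    then have nz': "norm ?z' = r" using False that by (cases "z = 0") auto
    have "z - ?z' = of_real (1 - r / norm z) * z" by (simp add: algebra_simps)
    then have "dist z ?z' = \<bar>1 - r / norm z\<bar> * norm z" by (simp only: dist_norm norm_mult norm_of_real)
    moreover have "\<bar>1 - r / norm z\<bar> = 1 - r / norm z"
      by (rule abs_of_nonneg) (use False that in \<open>auto simp: divide_le_eq\<close>)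
    moreover have "(1 - r / norm z) * norm z = norm z - r"
      using False that by (cases "z = 0") (auto simp: left_diff_distrib)
    ultimately have "dist z ?z' = norm z - r" by simp
    then show ?thesis using nz' that by (intro bexI[of _ ?z']) auto
  qed
  have "cball 0 (r1 + e / 2) \<times> cball 0 (r2 + e / 2) \<subseteq> S"
  proof
    fix x assume "x \<in> cball (0::complex) (r1 + e / 2) \<times> cball (0::complex) (r2 + e / 2)"
    then obtain w y where x: "x = (w, y)" "w \<in> cball 0 (r1 + e / 2)" "y \<in> cball 0 (r2 + e / 2)" by auto
    obtain w' y' where w': "w' \<in> cball 0 r1" "dist w w' \<le> e / 2" and y': "y' \<in> cball 0 r2" "dist y y' \<le> e / 2"
      using near[OF x(2) assms(3)] near[OF x(3) assms(4)] by auto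
    have "infdist x (cball 0 r1 \<times> cball 0 r2) \<le> dist x (w', y')"
      by (rule infdist_le) (use w' y' in auto)
    also have "\<dots> \<le> dist w w' + dist y y'"
      unfolding x dist_Pair_Pair by (rule sqrt_sum_squares_le_sum) auto
    also have "\<dots> \<le> e" using w' y' by simp
    finally show "x \<in> S" using e(2) by auto
  qed
  then show thesis using that[of "e / 2"] e(1) by simp
qed

text \<open>Cauchy's formula on the unit circle integrates from 0 to 2 pi. Applied to f(- c z) and
  shifted by pi, it gives the interval from - pi to pi, with the critical point at its
  centre.\<close>

lemma fourier_coefficient:
  assumes f: "f holomorphic_on ball 0 \<rho>" and "c \<noteq> 0" "cmod c < \<rho>"
  shows "((\<lambda>t. f (c * cis t) * cis (- (real m * t))) has_integral
           2 * of_real pi * ((deriv ^^ m) f 0 / fact m * c ^ m)) {-pi..pi}"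
proof -
  define k where "k = (\<lambda>z. f (- c * z))"
  have one: "1 < \<rho> / cmod c" using assms by simp
  then have sub: "cball 0 1 \<subseteq> ball (0::complex) (\<rho> / cmod c)" by auto
  have inb: "- c * z \<in> ball 0 \<rho>" if "z \<in> ball 0 (\<rho> / cmod c)" for z
    using that assms by (simp add: norm_mult field_simps)
  have k: "k holomorphic_on ball 0 (\<rho> / cmod c)"
    unfolding k_def using inb
    by (intro holomorphic_on_compose_gen[OF _ f, unfolded o_def]) (auto intro!: holomorphic_intros)
  have dk: "(deriv ^^ m) k 0 = (- c) ^ m * (deriv ^^ m) f 0"
    unfolding k_def using higher_deriv_compose_linear[where f = f and T = "ball 0 \<rho>" and S = "ball 0 (\<rho> / cmod c)" and z = 0 and u = "- c" and n = m] f inb one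
    by simp
  have "((\<lambda>u. k u / (u - 0) ^ Suc m) has_contour_integral (2 * pi * \<i>) / fact m * (deriv ^^ m) k 0) (circlepath 0 1)"
  proof (rule Cauchy_has_contour_integral_higher_derivative_circlepath)
    show "continuous_on (cball 0 1) k" by (rule continuous_on_subset[OF holomorphic_on_imp_continuous_on[OF k] sub])
    show "k holomorphic_on ball 0 1" by (rule holomorphic_on_subset[OF k]) (use sub ball_subset_cball in blast)
  qed simp
  then have "((\<lambda>s. k (cis s) / cis s ^ Suc m * \<i> * cis s) has_integral (2 * pi * \<i>) / fact m * (deriv ^^ m) k 0) {0..2 * pi}"
    unfolding circlepath_def by (subst (asm) has_contour_integral_part_circlepath_iff) auto
  then have "((\<lambda>s. - \<i> * (k (cis s) / cis s ^ Suc m * \<i> * cis s)) has_integral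
      - \<i> * ((2 * pi * \<i>) / fact m * (deriv ^^ m) k 0)) {0..2 * pi}"
    by (rule has_integral_mult_right)
  moreover have "- \<i> * (k (cis s) / cis s ^ Suc m * \<i> * cis s) = k (cis s) * cis (- (real m * s))" for s
  proof -
    have "cis (- (real m * s)) = inverse (cis s ^ m)" by (simp add: Complex.DeMoivre cis_inverse)
    then show ?thesis by (simp add: field_simps)
  qed
  moreover have "- \<i> * ((2 * pi * \<i>) / fact m * (deriv ^^ m) k 0) = 2 * pi * ((deriv ^^ m) k 0 / fact m)"
    by (simp add: field_simps)
  ultimately have "((\<lambda>s. k (cis s) * cis (- (real m * s))) has_integral 2 * pi * ((deriv ^^ m) k 0 / fact m)) {0..2 * pi}"
    by (simp only:)
  then have "((\<lambda>s. k (cis s) * cis (- (real m * s))) has_integral 2 * pi * ((deriv ^^ m) k 0 / fact m)) (cbox 0 (2 * pi))"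
    by simp
  from has_integral_affinity[OF this, of 1 pi]
  have "((\<lambda>t. k (cis (t + pi)) * cis (- (real m * (t + pi)))) has_integral 2 * pi * ((deriv ^^ m) k 0 / fact m)) {-pi..pi}"
    by (simp add: image_affinity_cbox)
  then have "((\<lambda>t. (- 1) ^ m * (k (cis (t + pi)) * cis (- (real m * (t + pi))))) has_integral
     (- 1) ^ m * (2 * pi * ((deriv ^^ m) k 0 / fact m))) {-pi..pi}"
    by (rule has_integral_mult_right)
  moreover have "(- 1) ^ m * (k (cis (t + pi)) * cis (- (real m * (t + pi)))) = f (c * cis t) * cis (- (real m * t))" for t
  proof -
    have "cis (- (real m * (t + pi))) = cis (- (real m * t)) * cis (- pi) ^ m"
      by (simp add: Complex.DeMoivre cis_mult algebra_simps)
    moreover have "cis (- pi) = - 1" by (simp add: cis.ctr complex_eq_iff)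
    moreover have "cis (t + pi) = - cis t" by (simp add: cis.ctr complex_eq_iff)
    ultimately show ?thesis by (simp add: k_def mult.commute[of _ c] flip: power_mult_distrib)
  qed
  moreover have "(- 1) ^ m * (2 * pi * ((deriv ^^ m) k 0 / fact m)) = 2 * of_real pi * ((deriv ^^ m) f 0 / fact m * c ^ m)"
    unfolding dk by (simp add: power_minus[of c])
  ultimately show ?thesis by (simp only:)
qed

text \<open>Near a point where the partial derivative with respect to the second variable does not
  vanish, this derivative stays within half of its modulus, so the second variable is
  an injective function of the value on each slice.\<close>

lemma zero_unique_on_slices:
  assumes "open D" and H: "holomorphic2_on H D" and "(c1, c2) \<in> D" and B0: "pd2 H (c1, c2) \<noteq> 0"
  obtains \<delta> \<epsilon> where "\<delta> > 0" "\<epsilon> > 0" "cball c1 \<delta> \<times> cball c2 \<epsilon> \<subseteq> D"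
    "\<And>w y y'. w \<in> cball c1 \<delta> \<Longrightarrow> y \<in> cball c2 \<epsilon> \<Longrightarrow> y' \<in> cball c2 \<epsilon> \<Longrightarrow> H (w, y) = 0 \<Longrightarrow> H (w, y') = 0 \<Longrightarrow> y = y'"
proof -
  define B where "B = pd2 H (c1, c2)"
  have nB: "norm B > 0" using B0 by (simp add: B_def)
  obtain A A' where AA: "open A" "open A'" "(c1, c2) \<in> A \<times> A'" "A \<times> A' \<subseteq> D"
    using open_prod_elim[OF \<open>open D\<close> \<open>(c1, c2) \<in> D\<close>] by metis
  obtain d0 where d0: "d0 > 0" "cball c1 d0 \<subseteq> A" using AA open_contains_cball[of A] by auto
  have h1: "(\<lambda>y. H (c1, y)) holomorphic_on A'"
    by (rule holomorphic2_on_slices(2)[OF H]) (use AA in auto)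
  have "continuous_on A' (deriv (\<lambda>y. H (c1, y)))"
    by (intro holomorphic_on_imp_continuous_on holomorphic_deriv h1 AA)
  then have "isCont (deriv (\<lambda>y. H (c1, y))) c2" using AA by (auto simp: continuous_on_eq_continuous_at)
  then obtain e1 where e1: "e1 > 0"
    "\<And>y. dist y c2 < e1 \<Longrightarrow> dist (deriv (\<lambda>y. H (c1, y)) y) (deriv (\<lambda>y. H (c1, y)) c2) < norm B / 4"
    using nB unfolding continuous_at_eps_delta by (metis zero_less_divide_iff zero_less_numeral)
  obtain e2 where e2: "e2 > 0" "cball c2 e2 \<subseteq> A'" using AA open_contains_cball[of A'] by auto
  define \<epsilon> where "\<epsilon> = min (e1 / 2) (e2 / 2)"
  have \<epsilon>: "\<epsilon> > 0" "\<epsilon> < e1" "2 * \<epsilon> \<le> e2" using e1 e2 by (auto simp: \<epsilon>_def)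
  have K: "cball c1 d0 \<times> cball c2 (2 * \<epsilon>) \<subseteq> D" using d0 e2 \<epsilon> AA by (fastforce)
  have "uniformly_continuous_on (cball c1 d0 \<times> cball c2 (2 * \<epsilon>)) H"
    by (intro compact_uniformly_continuous compact_Times compact_cball
        continuous_on_subset[OF holomorphic2_on_imp_continuous_on[OF H] K])
  \<comment> \<open>On circles of radius \<open>\<epsilon>\<close> Cauchy's inequality turns this
    tolerance into norm B / 4 for the derivative in y. The doubled radius leaves room for circles
    about all points of the smaller disc.\<close>
  then obtain d1 where d1: "d1 > 0" "\<And>x x'. x \<in> cball c1 d0 \<times> cball c2 (2 * \<epsilon>) \<Longrightarrow>
      x' \<in> cball c1 d0 \<times> cball c2 (2 * \<epsilon>) \<Longrightarrow> dist x' x < d1 \<Longrightarrow> dist (H x') (H x) < norm B * \<epsilon> / 4"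
    using nB \<epsilon>(1) unfolding uniformly_continuous_on_def by (metis divide_pos_pos mult_pos_pos zero_less_numeral)
  define \<delta> where "\<delta> = min d0 (d1 / 2)"
  have \<delta>: "\<delta> > 0" "\<delta> \<le> d0" "\<delta> < d1" using d0 d1 by (auto simp: \<delta>_def)
  have der: "norm (deriv (\<lambda>y. H (w, y)) y - B) \<le> norm B / 2" if w: "w \<in> cball c1 \<delta>" and y: "y \<in> cball c2 \<epsilon>" for w y
  proof -
    have inA: "z \<in> A'" "z \<in> cball c2 (2 * \<epsilon>)" if "z \<in> cball y \<epsilon>" for z
    proof -
      have "dist c2 z \<le> dist c2 y + dist y z" by (rule dist_triangle)
      then show "z \<in> cball c2 (2 * \<epsilon>)" using that y by simp
      then show "z \<in> A'" using e2 \<epsilon> by auto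
    qed
    have wA: "w \<in> A" "w \<in> cball c1 d0" using w d0 \<delta> by auto
    have hw: "(\<lambda>y. H (w, y)) holomorphic_on A'"
      by (rule holomorphic2_on_slices(2)[OF H]) (use AA wA in auto)
    have hd: "(\<lambda>y. H (w, y) - H (c1, y)) holomorphic_on A'" by (intro holomorphic_intros hw h1)
    have cs: "cball y \<epsilon> \<subseteq> A'" using inA by blast
    have "norm ((deriv ^^ 1) (\<lambda>y. H (w, y) - H (c1, y)) y) \<le> fact 1 * (norm B * \<epsilon> / 4) / \<epsilon> ^ 1"
    proof (rule Cauchy_inequality)
      show "(\<lambda>y. H (w, y) - H (c1, y)) holomorphic_on ball y \<epsilon>"
        by (rule holomorphic_on_subset[OF hd]) (use cs ball_subset_cball in blast)
      show "continuous_on (cball y \<epsilon>) (\<lambda>y. H (w, y) - H (c1, y))"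
        by (rule continuous_on_subset[OF holomorphic_on_imp_continuous_on[OF hd] cs])
      fix z assume "cmod (y - z) = \<epsilon>"
      then have z: "z \<in> cball c2 (2 * \<epsilon>)" using inA(2)[of z] by (simp add: dist_norm)
      have "dist (H (w, z)) (H (c1, z)) < norm B * \<epsilon> / 4"
        by (rule d1(2)) (use z wA w \<delta> d0 in \<open>auto simp: dist_Pair_Pair dist_commute\<close>)
      then show "cmod (H (w, z) - H (c1, z)) \<le> norm B * \<epsilon> / 4" by (simp add: dist_norm)
    qed (use \<epsilon> in auto)
    moreover have yA: "y \<in> A'" using cs \<epsilon> by auto
    then have "deriv (\<lambda>y. H (w, y) - H (c1, y)) y = deriv (\<lambda>y. H (w, y)) y - deriv (\<lambda>y. H (c1, y)) y"
      by (intro deriv_diff holomorphic_on_imp_differentiable_at[OF _ AA(2)] hw h1)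
    ultimately have 1: "norm (deriv (\<lambda>y. H (w, y)) y - deriv (\<lambda>y. H (c1, y)) y) \<le> norm B / 4"
      using \<epsilon> by simp
    have 2: "norm (deriv (\<lambda>y. H (c1, y)) y - B) \<le> norm B / 4"
      using e1(2)[of y] y \<epsilon> by (simp add: dist_norm B_def pd2_def dist_commute norm_minus_commute)
    show ?thesis using norm_triangle_ineq[of "deriv (\<lambda>y. H (w, y)) y - deriv (\<lambda>y. H (c1, y)) y" "deriv (\<lambda>y. H (c1, y)) y - B"] 1 2
      by simp
  qed
  show thesis
  proof (rule that[OF \<delta>(1) \<epsilon>(1)])
    show sub: "cball c1 \<delta> \<times> cball c2 \<epsilon> \<subseteq> D"
      using K \<delta> \<epsilon> subset_cball[of \<delta> d0 c1] subset_cball[of \<epsilon> "2 * \<epsilon>" c2] by fastforce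
    fix w y y' assume w: "w \<in> cball c1 \<delta>" and y: "y \<in> cball c2 \<epsilon>" "y' \<in> cball c2 \<epsilon>" and z: "H (w, y) = 0" "H (w, y') = 0"
    \<comment> \<open>Once the linear part B y is removed, what is left has Lipschitz constant norm
      B / 2. Two zeros of H on the slice would make the removed part alone vary by norm B times
      their distance.\<close>
    have "norm ((H (w, y) - B * y) - (H (w, y') - B * y')) \<le> norm B / 2 * norm (y - y')"
    proof (rule field_differentiable_bound[where S = "cball c2 \<epsilon>" and f' = "\<lambda>y. deriv (\<lambda>y. H (w, y)) y - B"])
      fix z assume z: "z \<in> cball c2 \<epsilon>"
      then have "(w, z) \<in> D" using sub w by auto
      from has_derivative_pair_slices(2)[OF holomorphic2_on_has_derivative[OF H this]]
      have "((\<lambda>y. H (w, y)) has_field_derivative deriv (\<lambda>y. H (w, y)) z) (at z within cball c2 \<epsilon>)"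
        by (simp add: pd2_def has_field_derivative_at_within)
      then show "((\<lambda>y. H (w, y) - B * y) has_field_derivative deriv (\<lambda>y. H (w, y)) z - B) (at z within cball c2 \<epsilon>)"
        by (auto intro!: derivative_eq_intros)
      show "norm (deriv (\<lambda>y. H (w, y)) z - B) \<le> norm B / 2" by (rule der[OF w z])
    qed (use y in auto)
    moreover have "(H (w, y) - B * y) - (H (w, y') - B * y') = - (B * (y - y'))"
      using z by (simp add: algebra_simps)
    ultimately have "norm B * norm (y - y') \<le> norm B * norm (y - y') / 2"
      by (simp add: norm_mult)
    then show "y = y'" using nB by (simp add: mult_le_0_iff)
  qed
qed

text \<open>Origin of the rising factorials in the theorem.\<close>

lemma deriv_funpow_inverse_power:
  fixes y :: complex
  assumes "y \<noteq> 0"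
  shows "(deriv ^^ q) (\<lambda>y. 1 / y ^ Suc n) y = (- 1) ^ q * pochhammer (of_nat n + 1) q / y ^ (Suc n + q)"
  using assms
proof (induction q arbitrary: y)
  case (Suc q)
  have "((\<lambda>y. 1 / y ^ Suc (n + q)) has_field_derivative - (of_nat (Suc (n + q)) / y ^ Suc (Suc (n + q)))) (at y)"
    using DERIV_power_Suc[OF DERIV_inverse[OF Suc.prems], of "n + q"] Suc.prems
    by (simp add: field_simps)
  then have "((\<lambda>y. ((- 1) ^ q * pochhammer (of_nat n + 1) q) * (1 / y ^ Suc (n + q))) has_field_derivative
      ((- 1) ^ q * pochhammer (of_nat n + 1) q) * (- (of_nat (Suc (n + q)) / y ^ Suc (Suc (n + q))))) (at y)"
    by (rule DERIV_cmult)
  then have "((\<lambda>y. (- 1) ^ q * pochhammer (of_nat n + 1) q / y ^ (Suc n + q)) has_field_derivative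
      (- 1) ^ Suc q * pochhammer (of_nat n + 1) (Suc q) / y ^ (Suc n + Suc q)) (at y)"
    by (simp add: pochhammer_Suc mult_ac add_ac)
  then have "((deriv ^^ q) (\<lambda>y. 1 / y ^ Suc n) has_field_derivative
      (- 1) ^ Suc q * pochhammer (of_nat n + 1) (Suc q) / y ^ (Suc n + Suc q)) (at y)"
    by (rule has_field_derivative_transform_within_open[where S = "- {0}"]) (use Suc in auto)
  then show ?case by (simp add: DERIV_imp_deriv)
qed simp

section \<open>The residue at the branch of the singular variety\<close>

text \<open>The hypotheses with V unfolded, as far as the residue argument uses them.
  \<open>c1_nz\<close> is not assumed in the theorem but follows there from criticality.\<close>

locale strictly_minimal_branch =
  fixes D :: "(complex \<times> complex) set" and F G H :: "complex \<times> complex \<Rightarrow> complex"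
    and p :: nat and c1 c2 :: complex and W :: "complex set" and h :: "complex \<Rightarrow> complex"
  assumes open_D: "open D" and holG: "holomorphic2_on G D" and holH: "holomorphic2_on H D"
    and p_pos: "p \<ge> 1"
    and F_eq: "\<And>x. x \<in> D \<Longrightarrow> H x \<noteq> 0 \<Longrightarrow> F x = G x / H x ^ p"
    and polydisc: "cball 0 (cmod c1) \<times> cball 0 (cmod c2) \<subseteq> D"
    and c_zero: "H (c1, c2) = 0"
    and minimal: "\<And>w y. (w, y) \<in> D \<Longrightarrow> H (w, y) = 0 \<Longrightarrow> cmod w \<le> cmod c1 \<Longrightarrow> cmod y \<le> cmod c2 \<Longrightarrow>
       w = c1 \<and> y = c2"
    and c1_nz: "c1 \<noteq> 0" and c2_nz: "c2 \<noteq> 0" and pd2_nz: "pd2 H (c1, c2) \<noteq> 0"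
    and open_W: "open W" and c1_W: "c1 \<in> W" and holh: "h holomorphic_on W" and h_c1: "h c1 = c2"
    and branch: "\<And>w. w \<in> W \<Longrightarrow> (w, h w) \<in> D \<and> H (w, h w) = 0 \<and> pd2 H (w, h w) \<noteq> 0"
begin

text \<open>F is prescribed only where H does not vanish; Q is the quotient itself, to which the
  rules for holomorphy on slices apply.\<close>

definition Q :: "complex \<times> complex \<Rightarrow> complex" where
  "Q x = G x / H x ^ p"

definition S :: "(complex \<times> complex) set" where
  "S = {x \<in> D. H x \<noteq> 0}"

definition slice_coeff :: "nat \<Rightarrow> complex \<Rightarrow> complex" where
  "slice_coeff n w = (deriv ^^ n) (\<lambda>y. Q (w, y)) 0 / fact n"

lemma c_in_D: "(c1, c2) \<in> D"
  using polydisc by auto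

lemma F_eq_Q: "x \<in> S \<Longrightarrow> F x = Q x"
  by (simp add: S_def Q_def F_eq)

lemma cont_H: "continuous_on D H"
  by (rule holomorphic2_on_imp_continuous_on[OF holH])

lemma open_S: "open S"
proof -
  have "open (D \<inter> H -` (- {0}))"
    by (intro continuous_open_preimage cont_H open_D) auto
  moreover have "S = D \<inter> H -` (- {0})" by (auto simp: S_def)
  ultimately show ?thesis by simp
qed

lemma cont_Q: "continuous_on S Q"
  unfolding Q_def S_def
  by (intro continuous_intros continuous_on_subset[OF cont_H]
      continuous_on_subset[OF holomorphic2_on_imp_continuous_on[OF holG]]) auto

lemma Q_slices:
  "(\<And>w. w \<in> A \<Longrightarrow> (w, y) \<in> S) \<Longrightarrow> (\<lambda>w. Q (w, y)) holomorphic_on A"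
  "(\<And>y. y \<in> B \<Longrightarrow> (w, y) \<in> S) \<Longrightarrow> (\<lambda>y. Q (w, y)) holomorphic_on B"
  unfolding Q_def S_def
  by (intro holomorphic_intros holomorphic2_on_slices[OF holG] holomorphic2_on_slices[OF holH]; simp)+

lemma Q_bounded:
  assumes "compact K" "K \<subseteq> S"
  obtains B where "B > 0" "\<And>x. x \<in> K \<Longrightarrow> cmod (Q x) \<le> B"
proof -
  have "compact (Q ` K)"
    by (intro compact_continuous_image continuous_on_subset[OF cont_Q] assms)
  then show thesis
    using bounded_pos[of "Q ` K"] compact_imp_bounded that by blast
qed

text \<open>The only zero of H in the closed polydisc has second coordinate c2, on the
  boundary.\<close>

lemma open_polydisc_subset_S: "cmod w \<le> cmod c1 \<Longrightarrow> cmod y < cmod c2 \<Longrightarrow> (w, y) \<in> S"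
  using subsetD[OF polydisc, of "(w, y)"] minimal[of w y] by (auto simp: S_def)

text \<open>For second coordinates up to half of cmod c2 no zero is met while w stays in the closed
  disc, hence, by compactness, in a slightly larger one. Cauchy's integral over that circle in y
  then gives holomorphy in w beyond the circle through c1.\<close>

lemma holomorphic_slice_coeff:
  obtains \<rho> where "\<rho> > cmod c1" "\<forall>n. slice_coeff n holomorphic_on ball 0 \<rho>"
    "\<forall>m n. maclaurin_coeff F m n = (deriv ^^ m) (slice_coeff n) 0 / fact m"
proof -
  define r where "r = cmod c2 / 2"
  have r: "r > 0" "r < cmod c2" using c2_nz by (auto simp: r_def)
  have "cball 0 (cmod c1) \<times> cball 0 r \<subseteq> S"
    using r open_polydisc_subset_S by auto
  then obtain e where e: "e > 0" "cball 0 (cmod c1 + e) \<times> cball 0 (r + e) \<subseteq> S"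
    using closed_polydisc_enlarge[OF open_S _ norm_ge_zero, of c1 r] r by auto
  define \<rho> where "\<rho> = cmod c1 + e"
  have sub: "ball 0 \<rho> \<times> cball 0 r \<subseteq> S"
  proof
    fix x assume "x \<in> ball (0::complex) \<rho> \<times> cball (0::complex) r"
    then have "x \<in> cball 0 (cmod c1 + e) \<times> cball 0 (r + e)" using e(1) by (auto simp: \<rho>_def)
    then show "x \<in> S" using e(2) by blast
  qed
  have holo: "(\<lambda>y. Q (w, y)) holomorphic_on cball 0 r" if "w \<in> ball 0 \<rho>" for w
    by (rule Q_slices(2)) (use sub that in auto)
  have eq: "slice_coeff n w = contour_integral (circlepath 0 r) (\<lambda>y. Q (w, y) / y ^ Suc n) / (2 * of_real pi * \<i>)"
    if w: "w \<in> ball 0 \<rho>" for n w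
  proof -
    have "((\<lambda>y. Q (w, y) / (y - 0) ^ Suc n) has_contour_integral
        (2 * pi * \<i>) / fact n * (deriv ^^ n) (\<lambda>y. Q (w, y)) 0) (circlepath 0 r)"
      by (rule Cauchy_has_contour_integral_higher_derivative_circlepath)
         (use holo[OF w] r in \<open>auto intro: holomorphic_on_imp_continuous_on holomorphic_on_subset\<close>)
    then have "contour_integral (circlepath 0 r) (\<lambda>y. Q (w, y) / y ^ Suc n) =
        (2 * pi * \<i>) / fact n * (deriv ^^ n) (\<lambda>y. Q (w, y)) 0"
      by (simp add: contour_integral_unique)
    then show ?thesis by (simp add: slice_coeff_def)
  qed
  have hol: "slice_coeff n holomorphic_on ball 0 \<rho>" for n
  proof -
    have "(\<lambda>w. contour_integral (circlepath 0 r) (\<lambda>y. Q (w, y) / y ^ Suc n)) holomorphic_on ball 0 \<rho>"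
    proof (rule holomorphic_on_contour_integral_param)
      show "continuous_on (ball 0 \<rho> \<times> sphere 0 r) (\<lambda>(w, y). Q (w, y) / y ^ Suc n)"
        unfolding split_def
        by (intro continuous_intros continuous_on_compose2[OF cont_Q]) (use sub r in auto)
      show "(\<lambda>w. Q (w, y) / y ^ Suc n) holomorphic_on ball 0 \<rho>" if "y \<in> sphere 0 r" for y
        by (intro holomorphic_intros Q_slices(1)) (use sub that r in auto)
    qed (use r in auto)
    then have "(\<lambda>w. contour_integral (circlepath 0 r) (\<lambda>y. Q (w, y) / y ^ Suc n) / (2 * of_real pi * \<i>)) holomorphic_on ball 0 \<rho>"
      by (intro holomorphic_intros) auto
    then show ?thesis by (rule holomorphic_transform) (simp add: eq)
  qed
  have mac: "maclaurin_coeff F m n = (deriv ^^ m) (slice_coeff n) 0 / fact m" for m n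
  proof -
    have \<rho>0: "\<rho> > 0" using e by (simp add: \<rho>_def add_nonneg_pos)
    have dF: "(deriv ^^ n) (\<lambda>y. F (w, y)) 0 = fact n * slice_coeff n w" if w: "w \<in> ball 0 \<rho>" for w
    proof -
      have "\<forall>\<^sub>F y in nhds 0. F (w, y) = Q (w, y)"
        using eventually_nhds_ball[OF r(1)]
      proof eventually_elim
        fix y :: complex assume "y \<in> ball 0 r"
        then have "(w, y) \<in> S" using w sub by (force simp: less_imp_le)
        then show "F (w, y) = Q (w, y)" by (rule F_eq_Q)
      qed
      then have "(deriv ^^ n) (\<lambda>y. F (w, y)) 0 = (deriv ^^ n) (\<lambda>y. Q (w, y)) 0"
        by (rule higher_deriv_cong_ev) simp
      then show ?thesis by (simp add: slice_coeff_def)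
    qed
    have "\<forall>\<^sub>F w in nhds 0. (deriv ^^ n) (\<lambda>y. F (w, y)) 0 = fact n * slice_coeff n w"
      by (rule eventually_mono[OF eventually_nhds_ball[OF \<rho>0] dF])
    then have "(deriv ^^ m) (\<lambda>w. (deriv ^^ n) (\<lambda>y. F (w, y)) 0) 0 = (deriv ^^ m) (\<lambda>w. fact n * slice_coeff n w) 0"
      by (rule higher_deriv_cong_ev) simp
    also have "\<dots> = fact n * (deriv ^^ m) (slice_coeff n) 0"
      by (rule higher_deriv_cmult[OF hol]) (use \<rho>0 in auto)
    finally show ?thesis by (simp add: maclaurin_coeff_eq)
  qed
  show thesis by (rule that[of \<rho>]) (use e hol mac in \<open>auto simp: \<rho>_def\<close>)
qed

text \<open>The zeros over T outside N form a compact set on which cmod y exceeds cmod c2, so its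
  minimum leaves a gap. N is empty away from c1 and a bidisc about c when all of the circle is
  considered.\<close>

lemma zeros_near_torus:
  assumes T: "compact T" "T \<subseteq> sphere 0 (cmod c1)" and "open N"
    and N: "\<And>w y. w \<in> T \<Longrightarrow> cmod y \<le> cmod c2 \<Longrightarrow> H (w, y) = 0 \<Longrightarrow> (w, y) \<in> N"
  obtains R where "R > cmod c2" "cball 0 (cmod c1) \<times> cball 0 R \<subseteq> D"
    "\<And>w y. w \<in> T \<Longrightarrow> cmod y \<le> R \<Longrightarrow> H (w, y) = 0 \<Longrightarrow> (w, y) \<in> N"
proof -
  obtain e where e: "e > 0" "cball 0 (cmod c1 + e) \<times> cball 0 (cmod c2 + e) \<subseteq> D"
    using closed_polydisc_enlarge[OF open_D polydisc] by auto
  define R0 where "R0 = cmod c2 + e"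
  have sub: "cball 0 (cmod c1) \<times> cball 0 R0 \<subseteq> D"
  proof
    fix x assume "x \<in> cball (0::complex) (cmod c1) \<times> cball (0::complex) R0"
    then have "x \<in> cball 0 (cmod c1 + e) \<times> cball 0 (cmod c2 + e)" using e(1) by (auto simp: R0_def)
    then show "x \<in> D" using e(2) by blast
  qed
  have TS: "T \<times> cball 0 R0 \<subseteq> D" using T(2) sub by force
  define Z where "Z = (T \<times> cball 0 R0 \<inter> H -` {0}) - N"
  have cK: "compact (T \<times> cball (0::complex) R0)" using T by (intro compact_Times) auto
  have "closed (T \<times> cball 0 R0 \<inter> H -` {0})"
    by (rule continuous_closed_preimage[OF continuous_on_subset[OF cont_H TS] compact_imp_closed[OF cK]]) simp
  then have "compact (T \<times> cball 0 R0 \<inter> (T \<times> cball 0 R0 \<inter> H -` {0}))"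
    by (rule compact_Int_closed[OF cK])
  moreover have "T \<times> cball 0 R0 \<inter> (T \<times> cball 0 R0 \<inter> H -` {0}) = T \<times> cball 0 R0 \<inter> H -` {0}" by blast
  ultimately have cZ: "compact Z" unfolding Z_def by (intro compact_diff \<open>open N\<close>) (simp only:)
  show thesis
  proof (cases "Z = {}")
    case True
    show thesis
    proof (rule that[of R0])
      fix w y assume "w \<in> T" "cmod y \<le> R0" "H (w, y) = 0"
      then show "(w, y) \<in> N" using True by (auto simp: Z_def)
    qed (use e sub in \<open>auto simp: R0_def\<close>)
  next
    case False
    have "continuous_on Z (\<lambda>x. cmod (snd x))" by (intro continuous_intros)
    then obtain x where x: "x \<in> Z" "\<And>x'. x' \<in> Z \<Longrightarrow> cmod (snd x) \<le> cmod (snd x')"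
      using continuous_attains_inf[OF cZ False] by blast
    have gt: "cmod (snd x) > cmod c2"
    proof (rule ccontr)
      assume "\<not> cmod (snd x) > cmod c2"
      then have "x \<in> N" using N[of "fst x" "snd x"] x(1) by (auto simp: Z_def)
      then show False using x(1) by (simp add: Z_def)
    qed
    \<comment> \<open>The midpoint lies strictly between cmod c2 and the smallest modulus of a zero
      outside N.\<close>
    define R where "R = min R0 ((cmod c2 + cmod (snd x)) / 2)"
    show thesis
    proof (rule that[of R])
      show "R > cmod c2" using e gt by (simp add: R_def R0_def)
      show "cball 0 (cmod c1) \<times> cball 0 R \<subseteq> D" using sub by (auto simp: R_def)
      fix w y assume wy: "w \<in> T" "cmod y \<le> R" "H (w, y) = 0"
      show "(w, y) \<in> N"
      proof (rule ccontr)
        assume "(w, y) \<notin> N"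
        then have "(w, y) \<in> Z" using wy by (auto simp: Z_def R_def)
        then have "cmod (snd x) \<le> cmod y" using x(2) by fastforce
        then show False using wy(2) gt by (simp add: R_def)
      qed
    qed
  qed
qed

end

text \<open>Half the radius in \<open>h_near\<close> keeps h(w) inside the fixed circle of radius
  \<open>\<epsilon> / 2\<close> about c2, a contour valid for all w. \<open>\<epsilon>_less\<close>
  keeps y away from 0 and h(w)/c2 away from the cut of the logarithm.\<close>

locale strictly_minimal_nbhd = strictly_minimal_branch +
  fixes \<delta> \<epsilon> :: real
  assumes \<delta>_pos: "\<delta> > 0" and \<epsilon>_pos: "\<epsilon> > 0" and \<epsilon>_less: "\<epsilon> < cmod c2"
    and nbhd_D: "ball c1 \<delta> \<times> ball c2 \<epsilon> \<subseteq> D" and nbhd_W: "ball c1 \<delta> \<subseteq> W"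
    and h_near: "\<And>w. w \<in> ball c1 \<delta> \<Longrightarrow> h w \<in> ball c2 (\<epsilon> / 2)"
    and unique: "\<And>w y. w \<in> ball c1 \<delta> \<Longrightarrow> y \<in> ball c2 \<epsilon> \<Longrightarrow> H (w, y) = 0 \<Longrightarrow> y = h w"

context strictly_minimal_branch
begin

lemma nbhd_exists: "\<exists>\<delta> \<epsilon>. strictly_minimal_nbhd D F G H p c1 c2 W h \<delta> \<epsilon>"
proof -
  obtain d e where de: "d > 0" "e > 0" "cball c1 d \<times> cball c2 e \<subseteq> D"
    "\<And>w y y'. w \<in> cball c1 d \<Longrightarrow> y \<in> cball c2 e \<Longrightarrow> y' \<in> cball c2 e \<Longrightarrow> H (w, y) = 0 \<Longrightarrow> H (w, y') = 0 \<Longrightarrow> y = y'"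
    using zero_unique_on_slices[OF open_D holH c_in_D pd2_nz] by metis
  define \<epsilon> where "\<epsilon> = min e (cmod c2 / 2)"
  have \<epsilon>: "\<epsilon> > 0" "\<epsilon> \<le> e" "\<epsilon> < cmod c2" using de c2_nz by (auto simp: \<epsilon>_def min_def)
  have "isCont h c1"
    using holomorphic_on_imp_continuous_on[OF holh] open_W c1_W by (simp add: continuous_on_eq_continuous_at)
  then obtain d1 where d1: "d1 > 0" "\<And>w. dist w c1 < d1 \<Longrightarrow> dist (h w) c2 < \<epsilon> / 2"
    using \<epsilon>(1) h_c1 unfolding continuous_at_eps_delta by (metis half_gt_zero)
  obtain d2 where d2: "d2 > 0" "ball c1 d2 \<subseteq> W" using open_W c1_W open_contains_ball by blast
  define \<delta> where "\<delta> = min d (min d1 d2)"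
  have \<delta>: "\<delta> > 0" "\<delta> \<le> d" "\<delta> \<le> d1" "\<delta> \<le> d2" using de d1 d2 by (auto simp: \<delta>_def)
  have hn: "h w \<in> ball c2 (\<epsilon> / 2)" if "w \<in> ball c1 \<delta>" for w
    using d1(2)[of w] that \<delta> by (simp add: dist_commute)
  have "strictly_minimal_nbhd D F G H p c1 c2 W h \<delta> \<epsilon>"
  proof unfold_locales
    show "ball c1 \<delta> \<times> ball c2 \<epsilon> \<subseteq> D" using de(3) \<delta> \<epsilon> by (force simp: subset_iff)
    show W: "ball c1 \<delta> \<subseteq> W" using d2 \<delta> by (force simp: subset_iff)
    fix w y assume w: "w \<in> ball c1 \<delta>" and y: "y \<in> ball c2 \<epsilon>" "H (w, y) = 0"
    show "y = h w"
      using de(4)[of w y "h w"] w y hn[OF w] branch[of w] W \<delta> \<epsilon> by auto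
  qed (use \<delta> \<epsilon> hn in auto)
  then show ?thesis by blast
qed

end

section \<open>The pole h(w) and its residue\<close>

context strictly_minimal_nbhd
begin

lemma nbhd_nz: "y \<in> ball c2 \<epsilon> \<Longrightarrow> y \<noteq> 0"
  using \<epsilon>_less by auto

lemma h_in_ball:
  assumes "w \<in> ball c1 \<delta>"
  shows "h w \<in> ball c2 \<epsilon>"
  using h_near[OF assms] \<epsilon>_pos unfolding mem_ball by linarith

lemma nbhd_S: "w \<in> ball c1 \<delta> \<Longrightarrow> y \<in> ball c2 \<epsilon> \<Longrightarrow> y \<noteq> h w \<Longrightarrow> (w, y) \<in> S"
  using subsetD[OF nbhd_D, of "(w, y)"] unique[of w y] by (simp add: S_def) blast

text \<open>As the derivative of H in y is nonzero at h(w), the quotient k of H(w, y) by y - h(w)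
  extends without zeros, and G / k^p is the function sought.\<close>

lemma regularised_slice:
  assumes w: "w \<in> ball c1 \<delta>"
  obtains \<Phi> where "\<Phi> holomorphic_on ball c2 \<epsilon>"
    "\<And>y. y \<in> ball c2 \<epsilon> \<Longrightarrow> y \<noteq> h w \<Longrightarrow> \<Phi> y = (y - h w) ^ p * Q (w, y)"
proof -
  have wW: "w \<in> W" using w nbhd_W by auto
  have inD: "(w, y) \<in> D" if "y \<in> ball c2 \<epsilon>" for y
    using subsetD[OF nbhd_D, of "(w, y)"] w that by simp
  define k where "k = (\<lambda>y. if y = h w then deriv (\<lambda>y. H (w, y)) (h w) else (H (w, y) - H (w, h w)) / (y - h w))"
  have hH: "(\<lambda>y. H (w, y)) holomorphic_on ball c2 \<epsilon>" by (rule holomorphic2_on_slices(2)[OF holH inD])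
  have hG: "(\<lambda>y. G (w, y)) holomorphic_on ball c2 \<epsilon>" by (rule holomorphic2_on_slices(2)[OF holG inD])
  have k: "k holomorphic_on ball c2 \<epsilon>"
    unfolding k_def by (rule pole_lemma_open[OF hH open_ball])
  have knz: "k y \<noteq> 0" if "y \<in> ball c2 \<epsilon>" for y
  proof (cases "y = h w")
    case False
    then have "H (w, y) \<noteq> 0" using unique[OF w that] by blast
    then show ?thesis using branch[OF wW] False by (simp add: k_def)
  qed (use branch[OF wW] in \<open>simp add: k_def pd2_def\<close>)
  show thesis
  proof (rule that[of "\<lambda>y. G (w, y) / k y ^ p"])
    show "(\<lambda>y. G (w, y) / k y ^ p) holomorphic_on ball c2 \<epsilon>"
      by (intro holomorphic_intros k hG) (simp add: knz)
    fix y assume "y \<in> ball c2 \<epsilon>" "y \<noteq> h w"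
    then show "G (w, y) / k y ^ p = (y - h w) ^ p * Q (w, y)"
      using branch[OF wW] by (simp add: k_def Q_def power_divide)
  qed
qed

text \<open>Evaluates the limit in the definition: off h(w) the differentiated function has the germ
  of the regular one, whose derivatives are continuous at h(w), and h(w) is nonzero.\<close>

lemma assoc_u_eq:
  assumes w: "w \<in> ball c1 \<delta>" and \<Phi>: "\<Phi> holomorphic_on ball c2 \<epsilon>"
    and eq: "\<And>y. y \<in> ball c2 \<epsilon> \<Longrightarrow> y \<noteq> h w \<Longrightarrow> \<Phi> y = (y - h w) ^ p * Q (w, y)"
  shows "assoc_u p F h j w = (- h w) powi (int j - int p) * (deriv ^^ j) \<Phi> (h w)"
proof -
  have ev: "\<forall>\<^sub>F y in at (h w). (- y) powi (int j - int p) * (deriv ^^ j) \<Phi> y =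
      (- y) powi (int j - int p) * (deriv ^^ j) (\<lambda>z. (z - h w) ^ p * F (w, z)) y"
  proof -
    have "\<forall>\<^sub>F y in at (h w). y \<in> ball c2 \<epsilon> - {h w}"
      using eventually_at_in_open[OF open_ball h_in_ball[OF w]] .
    then show ?thesis
    proof eventually_elim
      fix y assume y: "y \<in> ball c2 \<epsilon> - {h w}"
      have "\<forall>\<^sub>F z in nhds y. z \<in> ball c2 \<epsilon> - {h w}"
        by (rule eventually_nhds_in_open) (use y in auto)
      then have "\<forall>\<^sub>F z in nhds y. \<Phi> z = (z - h w) ^ p * F (w, z)"
        by eventually_elim (use eq nbhd_S[OF w] F_eq_Q in auto)
      then have "(deriv ^^ j) \<Phi> y = (deriv ^^ j) (\<lambda>z. (z - h w) ^ p * F (w, z)) y"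
        by (rule higher_deriv_cong_ev) simp
      then show "(- y) powi (int j - int p) * (deriv ^^ j) \<Phi> y =
        (- y) powi (int j - int p) * (deriv ^^ j) (\<lambda>z. (z - h w) ^ p * F (w, z)) y" by simp
    qed
  qed
  have "isCont ((deriv ^^ j) \<Phi>) (h w)"
    using holomorphic_on_imp_continuous_on[OF holomorphic_higher_deriv[OF \<Phi> open_ball]] h_in_ball[OF w]
    by (simp add: continuous_on_eq_continuous_at)
  then have "((\<lambda>y. (- y) powi (int j - int p) * (deriv ^^ j) \<Phi> y) \<longlongrightarrow>
      (- h w) powi (int j - int p) * (deriv ^^ j) \<Phi> (h w)) (at (h w))"
    using nbhd_nz[OF h_in_ball[OF w]] by (intro tendsto_intros) (auto simp: isCont_def)
  then have "((\<lambda>y. (- y) powi (int j - int p) * (deriv ^^ j) (\<lambda>z. (z - h w) ^ p * F (w, z)) y) \<longlongrightarrow>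
      (- h w) powi (int j - int p) * (deriv ^^ j) \<Phi> (h w)) (at (h w))"
    using tendsto_cong[OF ev] by simp
  then show ?thesis unfolding assoc_u_def by (intro tendsto_Lim) auto
qed

lemma holomorphic_h: "h holomorphic_on ball c1 \<delta>"
  using holomorphic_on_subset[OF holh nbhd_W] .

text \<open>The derivative is taken at the moving point h(w). Cauchy's formula over the fixed circle
  about c2 puts the dependence on w into the integrand, where it is holomorphic.\<close>

lemma holomorphic_assoc_u: "assoc_u p F h j holomorphic_on ball c1 \<delta>"
proof -
  let ?f = "\<lambda>w y. (y - h w) ^ p * Q (w, y) / (y - h w) ^ Suc j"
  let ?I = "\<lambda>w. contour_integral (circlepath c2 (\<epsilon> / 2)) (?f w)"
  have sph: "y \<in> ball c2 \<epsilon>" "y \<noteq> h w" if "y \<in> sphere c2 (\<epsilon> / 2)" "w \<in> ball c1 \<delta>" for y w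
    using that h_near[OF that(2)] \<epsilon>_pos by auto
  have inS: "(w, y) \<in> S" if "dist c2 y = \<epsilon> / 2" "dist c1 w < \<delta>" for w y
    using nbhd_S[of w y] sph[of y w] that by simp
  have ne: "y \<noteq> h w" if "dist c2 y = \<epsilon> / 2" "dist c1 w < \<delta>" for w y
    using sph[of y w] that by simp
  have "?I holomorphic_on ball c1 \<delta>"
  proof (rule holomorphic_on_contour_integral_param)
    show "continuous_on (ball c1 \<delta> \<times> sphere c2 (\<epsilon> / 2)) (\<lambda>(w, y). ?f w y)"
      unfolding split_def
      by (intro continuous_intros continuous_on_compose2[OF cont_Q]
           continuous_on_compose2[OF holomorphic_on_imp_continuous_on[OF holomorphic_h]])
         (auto simp: inS ne)
    show "(\<lambda>w. ?f w y) holomorphic_on ball c1 \<delta>" if "y \<in> sphere c2 (\<epsilon> / 2)" for y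
      by (intro holomorphic_intros holomorphic_h Q_slices(1)) (use that in \<open>auto simp: inS ne\<close>)
  qed (use \<epsilon>_pos in auto)
  then have hol: "(\<lambda>w. (- h w) powi (int j - int p) * (?I w * fact j / (2 * of_real pi * \<i>))) holomorphic_on ball c1 \<delta>"
    by (intro holomorphic_intros holomorphic_h) (simp_all add: nbhd_nz[OF h_in_ball])
  show ?thesis
  proof (rule holomorphic_transform[OF hol])
    fix w assume w: "w \<in> ball c1 \<delta>"
    obtain \<Phi> where \<Phi>: "\<Phi> holomorphic_on ball c2 \<epsilon>"
      "\<And>y. y \<in> ball c2 \<epsilon> \<Longrightarrow> y \<noteq> h w \<Longrightarrow> \<Phi> y = (y - h w) ^ p * Q (w, y)"
      by (rule regularised_slice[OF w]) blast
    have sub: "cball c2 (\<epsilon> / 2) \<subseteq> ball c2 \<epsilon>" using \<epsilon>_pos by auto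
    have "((\<lambda>y. \<Phi> y / (y - h w) ^ Suc j) has_contour_integral
        (2 * pi * \<i>) / fact j * (deriv ^^ j) \<Phi> (h w)) (circlepath c2 (\<epsilon> / 2))"
    proof (rule Cauchy_has_contour_integral_higher_derivative_circlepath)
      show "continuous_on (cball c2 (\<epsilon> / 2)) \<Phi>"
        by (rule continuous_on_subset[OF holomorphic_on_imp_continuous_on[OF \<Phi>(1)] sub])
      show "\<Phi> holomorphic_on ball c2 (\<epsilon> / 2)"
        by (rule holomorphic_on_subset[OF \<Phi>(1)]) (use sub ball_subset_cball in blast)
    qed (rule h_near[OF w])
    then have "contour_integral (circlepath c2 (\<epsilon> / 2)) (\<lambda>y. \<Phi> y / (y - h w) ^ Suc j) =
        (2 * pi * \<i>) / fact j * (deriv ^^ j) \<Phi> (h w)" by (rule contour_integral_unique)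
    moreover have "contour_integral (circlepath c2 (\<epsilon> / 2)) (\<lambda>y. \<Phi> y / (y - h w) ^ Suc j) = ?I w"
      by (rule contour_integral_eq) (use sph[OF _ w] \<Phi>(2) \<epsilon>_pos in auto)
    ultimately have "(deriv ^^ j) \<Phi> (h w) = ?I w * fact j / (2 * of_real pi * \<i>)"
      by (simp add: field_simps)
    moreover have "assoc_u p F h j w = (- h w) powi (int j - int p) * (deriv ^^ j) \<Phi> (h w)"
      by (rule assoc_u_eq[OF w \<Phi>])
    ultimately show "(- h w) powi (int j - int p) * (?I w * fact j / (2 * of_real pi * \<i>)) = assoc_u p F h j w"
      by (simp only:)
  qed
qed

text \<open>Minus the residue of Q(w, y) / y^(n+1) at h(w), which is the contribution of this pole
  to the n-th Taylor coefficient of the slice.\<close>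

definition singular_part :: "nat \<Rightarrow> complex \<Rightarrow> complex" where
  "singular_part n w = (\<Sum>j<p. pochhammer (of_nat n + 1) (p - 1 - j) / (fact (p - 1 - j) * fact j) *
     assoc_u p F h j w) / h w ^ n"

text \<open>The residue at a pole of order at most p is a derivative of order p - 1, expanded by the
  Leibniz rule. The weight (- y)^(j-p) in the definition of u_j absorbs the alternating signs and
  all powers of h(w) except the n-th.\<close>

lemma residue_eq:
  assumes w: "w \<in> ball c1 \<delta>"
  shows "residue (\<lambda>y. Q (w, y) / y ^ Suc n) (h w) = - singular_part n w"
proof -
  obtain \<Phi> where \<Phi>: "\<Phi> holomorphic_on ball c2 \<epsilon>"
    "\<And>y. y \<in> ball c2 \<epsilon> \<Longrightarrow> y \<noteq> h w \<Longrightarrow> \<Phi> y = (y - h w) ^ p * Q (w, y)"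
    by (rule regularised_slice[OF w]) blast
  have hb: "h w \<in> ball c2 \<epsilon>" by (rule h_in_ball[OF w])
  have hnz: "h w \<noteq> 0" by (rule nbhd_nz[OF hb])
  obtain q where q: "p = Suc q" using p_pos by (cases p) auto
  have inv: "(\<lambda>y. 1 / y ^ Suc n) holomorphic_on ball c2 \<epsilon>"
    by (intro holomorphic_intros) (use nbhd_nz in auto)
  have "residue (\<lambda>y. Q (w, y) / y ^ Suc n) (h w) = residue (\<lambda>y. (\<Phi> y * (1 / y ^ Suc n)) / (y - h w) ^ Suc q) (h w)"
  proof (rule residue_cong)
    have "\<forall>\<^sub>F y in at (h w). y \<in> ball c2 \<epsilon> - {h w}"
      using eventually_at_in_open[OF open_ball hb] .
    then show "\<forall>\<^sub>F y in at (h w). Q (w, y) / y ^ Suc n = (\<Phi> y * (1 / y ^ Suc n)) / (y - h w) ^ Suc q"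
    proof eventually_elim
      fix y assume "y \<in> ball c2 \<epsilon> - {h w}"
      then have y: "y \<in> ball c2 \<epsilon>" "y \<noteq> h w" by auto
      have "\<Phi> y = (y - h w) ^ Suc q * Q (w, y)" using \<Phi>(2)[OF y] by (simp only: q[symmetric])
      then show "Q (w, y) / y ^ Suc n = (\<Phi> y * (1 / y ^ Suc n)) / (y - h w) ^ Suc q"
        using y(2) by simp
    qed
  qed simp
  also have "\<dots> = (deriv ^^ q) (\<lambda>y. \<Phi> y * (1 / y ^ Suc n)) (h w) / fact q"
    by (rule residue_holomorphic_over_power[OF open_ball hb]) (intro holomorphic_on_mult \<Phi>(1) inv)
  also have "(deriv ^^ q) (\<lambda>y. \<Phi> y * (1 / y ^ Suc n)) (h w) =
      (\<Sum>i = 0..q. of_nat (q choose i) * (deriv ^^ i) \<Phi> (h w) * (deriv ^^ (q - i)) (\<lambda>y. 1 / y ^ Suc n) (h w))"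
    by (rule higher_deriv_mult[OF \<Phi>(1) inv open_ball hb])
  also have "\<dots> = (\<Sum>i<p. of_nat (q choose i) * (deriv ^^ i) \<Phi> (h w) *
      ((- 1) ^ (q - i) * pochhammer (of_nat n + 1) (q - i) / h w ^ (Suc n + (q - i))))"
    using deriv_funpow_inverse_power[OF hnz] by (intro sum.cong) (auto simp: q)
  also have "\<dots> / fact q = (\<Sum>i<p. - (pochhammer (of_nat n + 1) (p - 1 - i) / (fact (p - 1 - i) * fact i) *
     assoc_u p F h i w / h w ^ n))"
    unfolding sum_divide_distrib
  proof (rule sum.cong[OF refl])
    fix i assume "i \<in> {..<p}"
    then have i: "i \<le> q" by (simp add: q)
    have "int i - int p = - int (Suc (q - i))" using i by (simp add: q of_nat_diff)
    then have "(- h w) powi (int i - int p) = inverse ((- h w) ^ Suc (q - i))"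
      by (simp only: power_int_minus power_int_of_nat)
    moreover have "assoc_u p F h i w = (- h w) powi (int i - int p) * (deriv ^^ i) \<Phi> (h w)"
      by (rule assoc_u_eq[OF w \<Phi>])
    ultimately have "assoc_u p F h i w = inverse ((- h w) ^ Suc (q - i)) * (deriv ^^ i) \<Phi> (h w)"
      by (simp only:)
    also have "(- h w) ^ Suc (q - i) = - ((- 1) ^ (q - i) * h w ^ Suc (q - i))"
      by (simp add: power_minus[of "h w" "q - i"])
    also have "inverse (- ((- 1) ^ (q - i) * h w ^ Suc (q - i))) = - ((- 1) ^ (q - i) / h w ^ Suc (q - i))"
    proof -
      have "inverse ((- 1) ^ (q - i)) = ((- 1) ^ (q - i) :: complex)"
        by (simp flip: power_inverse)
      then show ?thesis by (simp only: inverse_minus_eq inverse_mult_distrib divide_inverse)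
    qed
    finally have u: "assoc_u p F h i w = - ((- 1) ^ (q - i) / h w ^ Suc (q - i)) * (deriv ^^ i) \<Phi> (h w)" .
    have bin: "of_nat (q choose i) / fact q = (1 / (fact (q - i) * fact i) :: complex)"
      using binomial_fact[OF i, where 'a = complex] by simp
    have b: "of_nat (q choose i) * x / fact q = x / (fact (q - i) * fact i)" for x :: complex
    proof -
      have "of_nat (q choose i) * x / fact q = of_nat (q choose i) / fact q * x" by simp
      also have "\<dots> = 1 / (fact (q - i) * fact i) * x"
        by (simp only: bin)
      finally show ?thesis by simp
    qed
    have "of_nat (q choose i) * (deriv ^^ i) \<Phi> (h w) *
      ((- 1) ^ (q - i) * pochhammer (of_nat n + 1) (q - i) / h w ^ (Suc n + (q - i))) / fact q =
      (deriv ^^ i) \<Phi> (h w) * ((- 1) ^ (q - i) * pochhammer (of_nat n + 1) (q - i) / h w ^ (Suc n + (q - i)))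
        / (fact (q - i) * fact i)"
      unfolding mult.assoc b by (simp add: mult_ac)
    also have "\<dots> = - (pochhammer (of_nat n + 1) (q - i) / (fact (q - i) * fact i) * assoc_u p F h i w / h w ^ n)"
      unfolding u by (simp add: power_add mult_ac)
    finally show "of_nat (q choose i) * (deriv ^^ i) \<Phi> (h w) *
      ((- 1) ^ (q - i) * pochhammer (of_nat n + 1) (q - i) / h w ^ (Suc n + (q - i))) / fact q =
      - (pochhammer (of_nat n + 1) (p - 1 - i) / (fact (p - 1 - i) * fact i) * assoc_u p F h i w / h w ^ n)"
      by (simp add: q)
  qed
  finally show ?thesis by (simp add: singular_part_def sum_negf sum_divide_distrib)
qed

text \<open>Over T the slices are holomorphic up to a radius R > cmod c2 by minimality, so this is
  Cauchy's inequality with one bound for the compact set of all slices.\<close>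

lemma slice_coeff_bound_away:
  assumes T: "compact T" "T \<subseteq> sphere 0 (cmod c1)" "c1 \<notin> T"
  obtains R C where "R > cmod c2" "\<And>n w. w \<in> T \<Longrightarrow> cmod (slice_coeff n w) \<le> C / R ^ n"
proof -
  obtain R where R: "R > cmod c2" "cball 0 (cmod c1) \<times> cball 0 R \<subseteq> D"
    "\<And>w y. w \<in> T \<Longrightarrow> cmod y \<le> R \<Longrightarrow> H (w, y) = 0 \<Longrightarrow> (w, y) \<in> {}"
  proof (rule zeros_near_torus[OF T(1,2) open_empty])
    fix w y assume "w \<in> T" "cmod y \<le> cmod c2" "H (w, y) = 0"
    moreover from this have "(w, y) \<in> D" using subsetD[OF polydisc, of "(w, y)"] T(2) by auto
    ultimately have "w = c1" using minimal[of w y] T(2) by auto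
    then show "(w, y) \<in> {}" using \<open>w \<in> T\<close> T(3) by auto
  qed blast
  have sub: "T \<times> cball 0 R \<subseteq> S"
    using R(2,3) T(2) by (fastforce simp: S_def)
  have R0: "R > 0" using R(1) norm_ge_zero[of c2] by linarith
  obtain B where B: "B > 0" "\<And>x. x \<in> T \<times> cball 0 R \<Longrightarrow> cmod (Q x) \<le> B"
    by (rule Q_bounded[OF _ sub]) (use T in \<open>auto intro: compact_Times\<close>)
  have "cmod (slice_coeff n w) \<le> B / R ^ n" if w: "w \<in> T" for n w
  proof -
    have hol: "(\<lambda>y. Q (w, y)) holomorphic_on cball 0 R"
      by (rule Q_slices(2)) (use sub w in auto)
    have "norm ((deriv ^^ n) (\<lambda>y. Q (w, y)) 0) \<le> fact n * B / R ^ n"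
      by (rule Cauchy_inequality)
         (use hol R0 B w in \<open>auto intro: holomorphic_on_imp_continuous_on holomorphic_on_subset\<close>)
    then show ?thesis by (simp add: slice_coeff_def norm_divide field_simps)
  qed
  then show thesis using that R(1) by blast
qed

text \<open>Inside the circle of radius r the integrand has the poles 0 and h(w) only. The residues
  add up to the difference to be bounded, and the integral itself is of order r^(-n).\<close>

lemma slice_coeff_bound_near:
  obtains \<eta> where "\<eta> > 0" "\<eta> \<le> \<delta>"
    "\<forall>T. compact T \<and> T \<subseteq> sphere 0 (cmod c1) \<inter> ball c1 \<eta> \<longrightarrow>
       (\<exists>R C. R > cmod c2 \<and> (\<forall>n. \<forall>w\<in>T. cmod (slice_coeff n w - singular_part n w) \<le> C / R ^ n))"
proof -
  obtain R where R: "R > cmod c2" "cball 0 (cmod c1) \<times> cball 0 R \<subseteq> D"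
    "\<And>w y. w \<in> sphere 0 (cmod c1) \<Longrightarrow> cmod y \<le> R \<Longrightarrow> H (w, y) = 0 \<Longrightarrow> (w, y) \<in> ball c1 \<delta> \<times> ball c2 \<epsilon>"
  proof (rule zeros_near_torus[of "sphere 0 (cmod c1)" "ball c1 \<delta> \<times> ball c2 \<epsilon>"])
    fix w y assume "w \<in> sphere 0 (cmod c1)" "cmod y \<le> cmod c2" "H (w, y) = 0"
    moreover from this have "(w, y) \<in> D" using subsetD[OF polydisc, of "(w, y)"] by auto
    ultimately show "(w, y) \<in> ball c1 \<delta> \<times> ball c2 \<epsilon>" using minimal[of w y] \<delta>_pos \<epsilon>_pos by auto
  qed (auto intro: open_Times)
  define r where "r = (cmod c2 + R) / 2"
  have r: "cmod c2 < r" "r < R" "r > 0" using R(1) norm_ge_zero[of c2] by (auto simp: r_def simp del: norm_ge_zero)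
  have "isCont h c1"
    using holomorphic_on_imp_continuous_on[OF holomorphic_h] \<delta>_pos by (simp add: continuous_on_eq_continuous_at)
  \<comment> \<open>The modulus of h(w) may exceed cmod c2; w is kept so close to c1 that h(w) still
    lies inside the circle of radius r.\<close>
  then obtain d where d: "d > 0" "\<And>w. dist w c1 < d \<Longrightarrow> dist (h w) c2 < r - cmod c2"
    using r(1) h_c1 unfolding continuous_at_eps_delta by (metis diff_gt_0_iff_gt)
  define \<eta> where "\<eta> = min \<delta> d"
  show thesis
  proof (rule that[of \<eta>], goal_cases)
    case 3
    show ?case
    proof (intro allI impI, elim conjE)
      fix T assume T: "compact T" "T \<subseteq> sphere 0 (cmod c1) \<inter> ball c1 \<eta>"
      have hr: "cmod (h w) < r" if "w \<in> T" for w
      proof -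
        have "dist (h w) c2 < r - cmod c2" using d(2)[of w] that T by (auto simp: \<eta>_def dist_commute)
        then show ?thesis using norm_triangle_ineq2[of "h w" c2] by (simp add: dist_norm)
      qed
      have inS: "(w, y) \<in> S" if "w \<in> T" "cmod y \<le> R" "y \<noteq> h w" for w y
      proof -
        have w: "w \<in> sphere 0 (cmod c1)" "w \<in> ball c1 \<delta>" using that T by (auto simp: \<eta>_def)
        have "(w, y) \<in> D" using R(2) w that by auto
        moreover have "H (w, y) \<noteq> 0" using R(3)[OF w(1) that(2)] unique[OF w(2), of y] that(3) by auto
        ultimately show ?thesis by (simp add: S_def)
      qed
      have sub: "T \<times> sphere 0 r \<subseteq> S"
      proof (intro subsetI, elim SigmaE)
        fix x :: "complex \<times> complex" and w y assume x: "w \<in> T" "y \<in> sphere 0 r" "x = (w, y)"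
        then have "y \<noteq> h w" using hr[of w] by auto
        then show "x \<in> S" using inS[of w y] x r by simp
      qed
      obtain B where B: "B > 0" "\<And>x. x \<in> T \<times> sphere 0 r \<Longrightarrow> cmod (Q x) \<le> B"
        by (rule Q_bounded[OF _ sub]) (use T in \<open>auto intro: compact_Times\<close>)
      have "cmod (slice_coeff n w - singular_part n w) \<le> B / r ^ n" if w: "w \<in> T" for n w
      proof -
        have wd: "w \<in> ball c1 \<delta>" using w T by (auto simp: \<eta>_def)
        have hnz: "h w \<noteq> 0" using nbhd_nz[OF h_in_ball[OF wd]] .
        let ?f = "\<lambda>y. Q (w, y) / y ^ Suc n"
        have wind: "winding_number (circlepath 0 r) z = 1" if "cmod z < r" for z
          by (rule winding_number_circlepath) (use that in simp)
        have I: "contour_integral (circlepath 0 r) ?f = 2 * pi * \<i> *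
            (\<Sum>z\<in>{0, h w}. winding_number (circlepath 0 r) z * residue ?f z)"
        proof (rule Residue_theorem[of "ball 0 R"])
          show "?f holomorphic_on ball 0 R - {0, h w}"
            by (intro holomorphic_intros Q_slices(2)) (use inS w in auto)
          show "path_image (circlepath 0 r) \<subseteq> ball 0 R - {0, h w}"
            using r hr[OF w] by auto
          show "\<forall>z. z \<notin> ball 0 R \<longrightarrow> winding_number (circlepath 0 r) z = 0"
          proof (intro allI impI)
            fix z :: complex assume "z \<notin> ball 0 R"
            then show "winding_number (circlepath 0 r) z = 0"
              by (intro winding_number_zero_outside[of _ "cball 0 r"]) (use r in auto)
          qed
        qed auto
        have "residue ?f 0 = slice_coeff n w"
        proof -
          \<comment> \<open>Up to the modulus of h(w) the slice has no pole, so the residue at 0 is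
            its Taylor coefficient.\<close>
          define s where "s = cmod (h w)"
          have s: "s > 0" "s < R" using hnz hr[OF w] r by (auto simp: s_def)
          have "(\<lambda>y. Q (w, y)) holomorphic_on ball 0 s"
          proof (rule Q_slices(2))
            fix y :: complex assume "y \<in> ball 0 s"
            then show "(w, y) \<in> S" using s by (intro inS[OF w]) (auto simp: s_def)
          qed
          from residue_holomorphic_over_power'[OF open_ball _ this] show ?thesis
            using s by (simp add: slice_coeff_def)
        qed
        then have I': "contour_integral (circlepath 0 r) ?f = 2 * pi * \<i> * (slice_coeff n w - singular_part n w)"
          unfolding I using hnz wind[of 0] wind[OF hr[OF w]] r residue_eq[OF wd] by simp
        have "?f holomorphic_on sphere 0 r"
          by (intro holomorphic_intros Q_slices(2)) (use sub w r in auto)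
        then have int: "?f contour_integrable_on circlepath 0 r"
          by (intro contour_integrable_continuous_circlepath holomorphic_on_imp_continuous_on) (use r in auto)
        have "cmod (contour_integral (circlepath 0 r) ?f) \<le> B / r ^ Suc n * (2 * pi * r)"
        proof (rule has_contour_integral_bound_circlepath[OF has_contour_integral_integral[OF int]])
          fix y assume "cmod (y - 0) = r"
          then show "cmod (?f y) \<le> B / r ^ Suc n"
            using B(2)[of "(w, y)"] w r by (simp add: norm_divide norm_mult norm_power divide_right_mono)
        qed (use B r in auto)
        moreover have "cmod (2 * pi * \<i> * (slice_coeff n w - singular_part n w)) = 2 * pi * cmod (slice_coeff n w - singular_part n w)"
          unfolding norm_mult by simp
        moreover have "B / r ^ Suc n * (2 * pi * r) = 2 * pi * (B / r ^ n)" using r by simp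
        ultimately have "2 * pi * cmod (slice_coeff n w - singular_part n w) \<le> 2 * pi * (B / r ^ n)"
          unfolding I' by (simp only:)
        then show ?thesis by (rule mult_left_le_imp_le) simp
      qed
      then show "\<exists>R C. R > cmod c2 \<and> (\<forall>n. \<forall>w\<in>T. cmod (slice_coeff n w - singular_part n w) \<le> C / R ^ n)"
        using r(1) by blast
    qed
  qed (use d \<delta>_pos in \<open>auto simp: \<eta>_def\<close>)
qed

end

section \<open>Reduction to a short interval about 0\<close>

context strictly_minimal_nbhd
begin

text \<open>The requirements on the interval length. The error is uniform in m, since the
  integration runs over the circle through c1 and c1^m has been normalised away; q is cmod c2 /
  R.\<close>

definition localizing :: "real \<Rightarrow> bool" where
  "localizing \<tau> \<longleftrightarrow> (\<forall>t\<in>{-\<tau>..\<tau>}. c1 * cis t \<in> ball c1 \<delta>) \<and> (\<exists>q C. 0 < q \<and> q < 1 \<and> (\<forall>m n.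
     cmod (2 * of_real pi * (c1 ^ m * c2 ^ n * maclaurin_coeff F m n) -
       c2 ^ n * integral {-\<tau>..\<tau>} (\<lambda>t. singular_part n (c1 * cis t) * cis (- (real m * t)))) \<le> C * q ^ n))"

text \<open>The circle is cut at the angles of modulus \<open>\<tau>\<close>: on the arc about c1
  the coefficient is replaced by the singular part, on the compact rest, which avoids c1, it is
  exponentially small itself.\<close>

lemma eventually_localizing: "\<forall>\<^sub>F \<tau> in at_right 0. localizing \<tau>"
proof -
  obtain \<eta> where \<eta>: "\<eta> > 0" "\<eta> \<le> \<delta>" and near: "\<forall>T. compact T \<and> T \<subseteq> sphere 0 (cmod c1) \<inter> ball c1 \<eta> \<longrightarrow>
       (\<exists>R C. R > cmod c2 \<and> (\<forall>n. \<forall>w\<in>T. cmod (slice_coeff n w - singular_part n w) \<le> C / R ^ n))"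
    by (rule slice_coeff_bound_near)
  obtain \<rho> where \<rho>: "\<rho> > cmod c1" "\<forall>n. slice_coeff n holomorphic_on ball 0 \<rho>"
    "\<forall>m n. maclaurin_coeff F m n = (deriv ^^ m) (slice_coeff n) 0 / fact m"
    by (rule holomorphic_slice_coeff)
  have "continuous_on UNIV (\<lambda>t. c1 * cis t)" by (intro continuous_intros)
  then have "isCont (\<lambda>t. c1 * cis t) 0" by (simp add: continuous_on_eq_continuous_at)
  then obtain d where d: "d > 0" "\<And>t. dist t 0 < d \<Longrightarrow> dist (c1 * cis t) (c1 * cis 0) < \<eta>"
    using \<eta>(1) unfolding continuous_at_eps_delta by blast
  define \<tau>0 where "\<tau>0 = min (d / 2) (pi / 2)"
  have "\<tau>0 > 0" using d by (simp add: \<tau>0_def)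
  then show ?thesis
  proof (rule eventually_mono[OF eventually_at_right_real])
    fix \<tau> assume "\<tau> \<in> {0<..<\<tau>0}"
    then have \<tau>: "0 < \<tau>" "\<tau> \<le> \<tau>0" by auto
    have \<tau>pi: "\<tau> < pi" using \<tau> pi_gt_zero by (simp add: \<tau>0_def)
    define T1 where "T1 = (\<lambda>t. c1 * cis t) ` {-\<tau>..\<tau>}"
    define T2 where "T2 = (\<lambda>t. c1 * cis t) ` ({-pi..-\<tau>} \<union> {\<tau>..pi})"
    have cpt: "compact T1" "compact T2"
      unfolding T1_def T2_def by (intro compact_continuous_image continuous_intros compact_Un compact_Icc)+
    have in\<eta>: "c1 * cis t \<in> ball c1 \<eta>" if "t \<in> {-\<tau>..\<tau>}" for t
      using d(2)[of t] that \<tau> by (auto simp: \<tau>0_def dist_commute)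
    then have in\<delta>: "\<forall>t\<in>{-\<tau>..\<tau>}. c1 * cis t \<in> ball c1 \<delta>" using \<eta>(2) by fastforce
    have "T1 \<subseteq> sphere 0 (cmod c1) \<inter> ball c1 \<eta>" using in\<eta> by (auto simp: T1_def norm_mult)
    with near cpt(1) obtain R1 C1 where R1: "R1 > cmod c2"
      "\<And>n w. w \<in> T1 \<Longrightarrow> cmod (slice_coeff n w - singular_part n w) \<le> C1 / R1 ^ n" by meson
    have "c1 \<notin> T2"
    proof
      assume "c1 \<in> T2"
      then obtain t where t: "t \<in> {-pi..-\<tau>} \<union> {\<tau>..pi}" "c1 = c1 * cis t" unfolding T2_def by blast
      from t(2) have "cis t = 1" using c1_nz by simp
      then have "cos \<bar>t\<bar> = 1" by (simp add: complex_eq_iff)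
      moreover have "cos \<bar>t\<bar> < cos 0" by (rule cos_monotone_0_pi) (use t(1) \<tau> in auto)
      ultimately show False by simp
    qed
    moreover have "T2 \<subseteq> sphere 0 (cmod c1)" by (auto simp: T2_def norm_mult)
    ultimately obtain R2 C2 where R2: "R2 > cmod c2" "\<And>n w. w \<in> T2 \<Longrightarrow> cmod (slice_coeff n w) \<le> C2 / R2 ^ n"
      using slice_coeff_bound_away[OF cpt(2)] by metis
    define R where "R = min R1 R2"
    define C where "C = \<bar>C1\<bar> + \<bar>C2\<bar>"
    define q where "q = cmod c2 / R"
    have c2p: "cmod c2 > 0" using c2_nz by simp
    have R: "R > cmod c2" using R1 R2 by (simp add: R_def)
    have R0: "R > 0" using R c2p by linarith
    have q: "0 < q" "q < 1" unfolding q_def using divide_pos_pos[OF c2p R0] R R0 by simp_all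
    have le: "X / R' ^ n \<le> C / R ^ n" if "R' \<ge> R" "\<bar>X\<bar> \<le> C" for X R' n
    proof -
      have "X / R' ^ n \<le> \<bar>X\<bar> / R' ^ n" using that R0 by (intro divide_right_mono) auto
      also have "\<dots> \<le> C / R ^ n" using that R0 by (intro frac_le power_mono) auto
      finally show ?thesis .
    qed
    have b1: "cmod (slice_coeff n w - singular_part n w) \<le> C / R ^ n" if "w \<in> T1" for n w
      using R1(2)[OF that, of n] le[of R1 C1 n] by (simp add: R_def C_def)
    have b2: "cmod (slice_coeff n w) \<le> C / R ^ n" if "w \<in> T2" for n w
      using R2(2)[OF that, of n] le[of R2 C2 n] by (simp add: R_def C_def)
    have "cmod (2 * of_real pi * (c1 ^ m * c2 ^ n * maclaurin_coeff F m n) -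
         c2 ^ n * integral {-\<tau>..\<tau>} (\<lambda>t. singular_part n (c1 * cis t) * cis (- (real m * t)))) \<le> (2 * pi * C) * q ^ n" for m n
    proof -
      let ?f = "\<lambda>t. slice_coeff n (c1 * cis t) * cis (- (real m * t))"
      let ?s = "\<lambda>t. singular_part n (c1 * cis t) * cis (- (real m * t))"
      have hI: "(?f has_integral 2 * of_real pi * ((deriv ^^ m) (slice_coeff n) 0 / fact m * c1 ^ m)) {-pi..pi}"
        by (rule fourier_coefficient[OF \<rho>(2)[rule_format] c1_nz \<rho>(1)])
      then have full: "integral {-pi..pi} ?f = 2 * of_real pi * (c1 ^ m * maclaurin_coeff F m n)"
        by (simp add: \<rho>(3) integral_unique mult_ac)
      have int: "?f integrable_on {-pi..pi}" using hI by (rule has_integral_integrable)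
      have "singular_part n holomorphic_on ball c1 \<delta>"
        unfolding singular_part_def
        by (intro holomorphic_intros holomorphic_assoc_u holomorphic_h) (simp add: nbhd_nz[OF h_in_ball])
      then have "continuous_on {-\<tau>..\<tau>} (\<lambda>t. singular_part n (c1 * cis t))"
        by (rule continuous_on_compose2[OF holomorphic_on_imp_continuous_on])
           (intro continuous_intros, use in\<delta> in blast)
      then have conts: "continuous_on {-\<tau>..\<tau>} ?s" by (intro continuous_intros)
      have sub: "?f integrable_on {x..y}" if "-pi \<le> x" "y \<le> pi" for x y
        by (rule integrable_on_subinterval[OF int]) (use that in auto)
      have split: "integral {-pi..pi} ?f = integral {-pi..-\<tau>} ?f + integral {-\<tau>..\<tau>} ?f + integral {\<tau>..pi} ?f"
      proof -
        have e1: "integral {-pi..-\<tau>} ?f + integral {-\<tau>..pi} ?f = integral {-pi..pi} ?f"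
          by (rule Henstock_Kurzweil_Integration.integral_combine) (use \<tau> \<tau>pi int in auto)
        have e2: "integral {-\<tau>..\<tau>} ?f + integral {\<tau>..pi} ?f = integral {-\<tau>..pi} ?f"
          by (rule Henstock_Kurzweil_Integration.integral_combine) (use \<tau> \<tau>pi sub in auto)
        show ?thesis unfolding e1[symmetric] e2[symmetric] by (rule add.assoc[symmetric])
      qed
      have CR: "C / R ^ n \<ge> 0" using R0 by (simp add: C_def)
      have bnd: "cmod (integral {x..y} f) \<le> C / R ^ n * (y - x)"
        if "f integrable_on {x..y}" "x \<le> y" "\<And>t. t \<in> {x..y} \<Longrightarrow> cmod (f t) \<le> C / R ^ n" for x y and f :: "real \<Rightarrow> complex"
        using has_integral_bound[OF CR, of f "integral {x..y} f" x y] that integrable_integral[OF that(1)] by simp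
      have i1: "cmod (integral {-pi..-\<tau>} ?f) \<le> C / R ^ n * (pi - \<tau>)"
      proof -
        have "cmod (?f t) \<le> C / R ^ n" if "t \<in> {-pi..-\<tau>}" for t
          using b2[of "c1 * cis t" n] that unfolding T2_def norm_mult norm_cis mult_1_right by blast
        from bnd[of ?f "-pi" "-\<tau>", OF _ _ this] show ?thesis using sub[of "-pi" "-\<tau>"] \<tau> \<tau>pi by simp
      qed
      have i3: "cmod (integral {\<tau>..pi} ?f) \<le> C / R ^ n * (pi - \<tau>)"
      proof -
        have "cmod (?f t) \<le> C / R ^ n" if "t \<in> {\<tau>..pi}" for t
          using b2[of "c1 * cis t" n] that unfolding T2_def norm_mult norm_cis mult_1_right by blast
        from bnd[of ?f \<tau> pi, OF _ _ this] show ?thesis using sub[of \<tau> pi] \<tau> \<tau>pi by simp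
      qed
      have ints: "?s integrable_on {-\<tau>..\<tau>}" by (rule integrable_continuous_interval[OF conts])
      have i2: "cmod (integral {-\<tau>..\<tau>} (\<lambda>t. ?f t - ?s t)) \<le> C / R ^ n * (\<tau> - - \<tau>)"
      proof (rule bnd)
        show "(\<lambda>t. ?f t - ?s t) integrable_on {-\<tau>..\<tau>}"
          by (intro integrable_diff sub ints) (use \<tau>pi in auto)
        fix t assume t: "t \<in> {-\<tau>..\<tau>}"
        have "?f t - ?s t = (slice_coeff n (c1 * cis t) - singular_part n (c1 * cis t)) * cis (- (real m * t))"
          by (simp add: algebra_simps)
        then have "cmod (?f t - ?s t) = cmod (slice_coeff n (c1 * cis t) - singular_part n (c1 * cis t))"
          by (simp only: norm_mult norm_cis mult_1_right)
        moreover have "c1 * cis t \<in> T1" unfolding T1_def using t by (rule imageI)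
        ultimately show "cmod (?f t - ?s t) \<le> C / R ^ n" using b1 by (simp only:)
      qed (use \<tau> in auto)
      have "integral {-\<tau>..\<tau>} (\<lambda>t. ?f t - ?s t) = integral {-\<tau>..\<tau>} ?f - integral {-\<tau>..\<tau>} ?s"
        by (rule integral_diff) (use ints sub \<tau>pi in auto)
      then have "integral {-pi..pi} ?f - integral {-\<tau>..\<tau>} ?s = integral {-pi..-\<tau>} ?f + integral {-\<tau>..\<tau>} (\<lambda>t. ?f t - ?s t) + integral {\<tau>..pi} ?f"
        using split by simp
      also have "cmod \<dots> \<le> C / R ^ n * (pi - \<tau>) + C / R ^ n * (\<tau> - - \<tau>) + C / R ^ n * (pi - \<tau>)"
        by (intro order_trans[OF norm_triangle_ineq] add_mono i1 i2 i3)
      also have "\<dots> = 2 * pi * C / R ^ n"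
      proof -
        have "X * (pi - \<tau>) + X * (\<tau> - - \<tau>) + X * (pi - \<tau>) = 2 * pi * X" for X :: real
          by (simp add: algebra_simps)
        then show ?thesis by (simp only: times_divide_eq_right)
      qed
      finally have "cmod (c2 ^ n) * cmod (integral {-pi..pi} ?f - integral {-\<tau>..\<tau>} ?s) \<le> cmod (c2 ^ n) * (2 * pi * C / R ^ n)"
        by (intro mult_left_mono) auto
      also have "\<dots> = (2 * pi * C) * q ^ n" by (simp add: q_def power_divide norm_power)
      finally have "cmod (c2 ^ n * (integral {-pi..pi} ?f - integral {-\<tau>..\<tau>} ?s)) \<le> (2 * pi * C) * q ^ n"
        by (simp only: norm_mult)
      moreover have "c2 ^ n * (integral {-pi..pi} ?f - integral {-\<tau>..\<tau>} ?s) =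
          2 * of_real pi * (c1 ^ m * c2 ^ n * maclaurin_coeff F m n) - c2 ^ n * integral {-\<tau>..\<tau>} ?s"
        unfolding full by (simp add: algebra_simps)
      ultimately show ?thesis by (simp only:)
    qed
    then show "localizing \<tau>"
      unfolding localizing_def using q in\<delta> by blast
  qed
qed

end

text \<open>For n >= 1 each of the r factors is at most (k + r) n; hence the rising factorials cost
  at most a power n^(p-1).\<close>

lemma norm_pochhammer_le:
  fixes r k n :: nat
  assumes "n \<ge> 1"
  shows "norm (pochhammer (of_nat (k * n) + 1) r :: complex) \<le> (real (k + r) * real n) ^ r"
proof -
  have "pochhammer (of_nat (k * n) + 1) r = (\<Prod>i<r. of_nat (k * n + 1 + i) :: complex)"
    by (simp add: pochhammer_prod lessThan_atLeast0 add_ac)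
  then have "norm (pochhammer (of_nat (k * n) + 1) r :: complex) = (\<Prod>i<r. real (k * n + 1 + i))"
    by (simp only: prod_norm[symmetric] norm_of_nat)
  also have "\<dots> \<le> (\<Prod>i<r. real (k + r) * real n)"
  proof (rule prod_mono)
    fix i assume "i \<in> {..<r}"
    then have "1 + i \<le> r" by simp
    also have "r \<le> r * n" using assms by simp
    finally have "k * n + 1 + i \<le> (k + r) * n" by (simp add: algebra_simps)
    then show "0 \<le> real (k * n + 1 + i) \<and> real (k * n + 1 + i) \<le> real (k + r) * real n"
      by (metis of_nat_0_le_iff of_nat_le_iff of_nat_mult)
  qed
  finally show ?thesis by simp
qed

section \<open>Asymptotics of the Maclaurin coefficients\<close>

context strictly_minimal_nbhd
begin

text \<open>The chain rule for H(w, h w) = 0. Combined with criticality it removes the linear term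
  of the phase.\<close>

lemma deriv_h_c1: "pd1 H (c1, c2) + pd2 H (c1, c2) * deriv h c1 = 0"
proof -
  have "(h has_field_derivative deriv h c1) (at c1)"
    by (rule holomorphic_derivI[OF holh open_W c1_W])
  then have "((\<lambda>w. (w, h w)) has_derivative (\<lambda>z. (z, deriv h c1 * z))) (at c1)"
    by (intro has_derivative_Pair) (auto simp: has_field_derivative_def)
  then have "((\<lambda>w. H (w, h w)) has_derivative
      (\<lambda>z. pd1 H (c1, h c1) * fst (z, deriv h c1 * z) + pd2 H (c1, h c1) * snd (z, deriv h c1 * z))) (at c1)"
    by (rule has_derivative_compose[OF _ holomorphic2_on_has_derivative[OF holH]])
       (use c_in_D h_c1 in simp)
  then have "((\<lambda>w. H (w, h w)) has_field_derivative (pd1 H (c1, c2) + pd2 H (c1, c2) * deriv h c1)) (at c1)"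
  proof -
    have "(*) (pd1 H (c1, c2) + pd2 H (c1, c2) * deriv h c1) =
        (\<lambda>z. pd1 H (c1, h c1) * fst (z, deriv h c1 * z) + pd2 H (c1, h c1) * snd (z, deriv h c1 * z))"
      by (simp add: fun_eq_iff h_c1 algebra_simps)
    then show ?thesis
      using \<open>((\<lambda>w. H (w, h w)) has_derivative _) (at c1)\<close> unfolding has_field_derivative_def by (simp only:)
  qed
  moreover have "((\<lambda>w. H (w, h w)) has_field_derivative 0) (at c1)"
    by (rule has_field_derivative_transform_within_open[of "\<lambda>w. 0" _ _ W])
       (use open_W c1_W branch in auto)
  ultimately show ?thesis by (rule DERIV_unique)
qed

text \<open>Replacing t by a complex variable in c1 exp(i t) extends all functions to a disc. For
  real t the real part of g is ln (cmod (h w / c2)), and strict minimality makes it positive,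
  because w has modulus cmod c1 without being c1.\<close>

lemma tilde_extension:
  assumes "\<alpha>1 \<ge> (1::nat)" "\<alpha>2 \<ge> (1::nat)"
    and crit: "c1 * pd1 H (c1, c2) / of_nat \<alpha>1 = c2 * pd2 H (c1, c2) / of_nat \<alpha>2"
  obtains \<rho> U g where "\<rho> > 0" "\<forall>j. U j holomorphic_on ball 0 \<rho>" "g holomorphic_on ball 0 \<rho>"
    "\<forall>j t. \<bar>t\<bar> < \<rho> \<longrightarrow> assoc_u_tilde p F h c1 j t = U j (of_real t)"
    "\<forall>t. \<bar>t\<bar> < \<rho> \<longrightarrow> assoc_g_tilde h c1 \<alpha>1 \<alpha>2 t = g (of_real t)"
    "g 0 = 0" "deriv g 0 = 0" "\<forall>t. \<bar>t\<bar> < \<rho> \<and> t \<noteq> 0 \<longrightarrow> Re (g (of_real t)) > 0"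
proof -
  define E where "E = (\<lambda>z::complex. c1 * exp (\<i> * z))"
  have "isCont E 0" unfolding E_def by (intro continuous_intros)
  then obtain d where d: "d > 0" "\<And>z. dist z 0 < d \<Longrightarrow> dist (E z) (E 0) < \<delta>"
    using \<delta>_pos unfolding continuous_at_eps_delta by blast
  \<comment> \<open>The bound pi ensures that the circle does not return to c1 for 0 < |t| <
    \<open>\<rho>\<close>.\<close>
  define \<rho> where "\<rho> = min d pi"
  have \<rho>: "\<rho> > 0" using d by (simp add: \<rho>_def)
  have E0: "E 0 = c1" by (simp add: E_def)
  have Eb: "E z \<in> ball c1 \<delta>" if "z \<in> ball 0 \<rho>" for z
    using d(2)[of z] that by (simp add: \<rho>_def E0 dist_commute)
  have holE: "E holomorphic_on A" for A unfolding E_def by (intro holomorphic_intros)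
  have comp: "(\<lambda>z. k (E z)) holomorphic_on ball 0 \<rho>" if "k holomorphic_on ball c1 \<delta>" for k
    by (rule holomorphic_on_compose_gen[OF holE that, unfolded o_def]) (use Eb in auto)
  define U where "U = (\<lambda>j z. assoc_u p F h j (E z))"
  define g where "g = (\<lambda>z. Ln (h (E z) / c2) + \<i> * (of_nat \<alpha>1 / of_nat \<alpha>2) * z)"
  \<comment> \<open>h stays within less than cmod c2 of c2, so the quotient lies in the right
    half-plane and the principal logarithm is holomorphic.\<close>
  have right: "Re (h (E z) / c2) > 0" if "z \<in> ball 0 \<rho>" for z
  proof -
    have "cmod (h (E z) - c2) < cmod c2"
      using h_near[OF Eb[OF that]] \<epsilon>_less \<epsilon>_pos by (simp add: dist_norm norm_minus_commute)
    moreover have "h (E z) / c2 - 1 = (h (E z) - c2) / c2" using c2_nz by (simp add: field_simps)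
    ultimately have "cmod (h (E z) / c2 - 1) < 1" using c2_nz by (simp add: norm_divide)
    then show ?thesis using abs_Re_le_cmod[of "h (E z) / c2 - 1"] by simp
  qed
  have slit: "h (E z) / c2 \<notin> \<real>\<^sub>\<le>\<^sub>0" if "z \<in> ball 0 \<rho>" for z
    using right[OF that] unfolding complex_nonpos_Reals_iff by linarith
  have holg: "g holomorphic_on ball 0 \<rho>"
    unfolding g_def
    by (intro holomorphic_intros comp holomorphic_h) (use slit c2_nz in auto)
  have Et: "E (of_real t) = circle c1 t" for t by (simp add: E_def circle_def)
  have geq: "assoc_g_tilde h c1 \<alpha>1 \<alpha>2 t = g (of_real t)" for t
    unfolding assoc_g_tilde_def g_def Et by (simp add: circle_def h_c1)
  have g0: "g 0 = 0" using c2_nz by (simp add: g_def E0 h_c1)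
  have dg: "deriv g 0 = 0"
  proof (rule DERIV_imp_deriv)
    have "(E has_field_derivative c1 * \<i>) (at 0)"
      unfolding E_def by (auto intro!: derivative_eq_intros)
    moreover have "(h has_field_derivative deriv h c1) (at (E 0))"
      unfolding E0 by (rule holomorphic_derivI[OF holh open_W c1_W])
    ultimately have "((\<lambda>z. h (E z)) has_field_derivative deriv h c1 * (c1 * \<i>)) (at 0)"
      by (rule DERIV_chain2[rotated])
    then have "((\<lambda>z. h (E z) / c2) has_field_derivative deriv h c1 * (c1 * \<i>) / c2) (at 0)"
      by (rule DERIV_cdivide)
    moreover have "(Ln has_field_derivative inverse (h (E 0) / c2)) (at (h (E 0) / c2))"
      by (rule has_field_derivative_Ln) (use c2_nz in \<open>simp add: E0 h_c1\<close>)
    ultimately have "((\<lambda>z. Ln (h (E z) / c2)) has_field_derivative inverse (h (E 0) / c2) * (deriv h c1 * (c1 * \<i>) / c2)) (at 0)"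
      by (rule DERIV_chain2[rotated])
    then have "(g has_field_derivative inverse (h (E 0) / c2) * (deriv h c1 * (c1 * \<i>) / c2) +
       \<i> * (of_nat \<alpha>1 / of_nat \<alpha>2)) (at 0)"
      unfolding g_def by (rule DERIV_add[OF _ DERIV_cmult_Id])
    moreover have "inverse (h (E 0) / c2) * (deriv h c1 * (c1 * \<i>) / c2) + \<i> * (of_nat \<alpha>1 / of_nat \<alpha>2) = 0"
    proof -
      let ?B = "pd2 H (c1, c2)" and ?A = "pd1 H (c1, c2)"
      have nz: "of_nat \<alpha>1 \<noteq> (0::complex)" "of_nat \<alpha>2 \<noteq> (0::complex)" using assms by auto
      have "?A = - (?B * deriv h c1)" using deriv_h_c1 by (simp add: eq_neg_iff_add_eq_0)
      then have "- (c1 * (?B * deriv h c1)) * of_nat \<alpha>2 = c2 * ?B * of_nat \<alpha>1"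
        using crit nz by (simp add: field_simps)
      moreover have "?B * (c1 * deriv h c1 * of_nat \<alpha>2 + c2 * of_nat \<alpha>1) =
          c2 * ?B * of_nat \<alpha>1 - (- (c1 * (?B * deriv h c1)) * of_nat \<alpha>2)"
        by (simp add: algebra_simps)
      ultimately have "?B * (c1 * deriv h c1 * of_nat \<alpha>2 + c2 * of_nat \<alpha>1) = 0" by simp
      \<comment> \<open>The criticality equation after inserting h'(c1): it says that the
        logarithmic derivative of h along the circle cancels the linear term i
        \<open>\<alpha>1\<close> / \<open>\<alpha>2\<close>.\<close>
      then have e: "c1 * deriv h c1 * of_nat \<alpha>2 + c2 * of_nat \<alpha>1 = 0" using pd2_nz by simp
      have "inverse (h (E 0) / c2) * (deriv h c1 * (c1 * \<i>) / c2) + \<i> * (of_nat \<alpha>1 / of_nat \<alpha>2) =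
          \<i> * (c1 * deriv h c1 * of_nat \<alpha>2 + c2 * of_nat \<alpha>1) / (c2 * of_nat \<alpha>2)"
        using nz c2_nz by (simp add: E0 h_c1 field_simps)
      then show ?thesis using e by simp
    qed
    ultimately show "(g has_field_derivative 0) (at 0)" by simp
  qed
  have pos: "Re (g (of_real t)) > 0" if t: "\<bar>t\<bar> < \<rho>" "t \<noteq> 0" for t
  proof -
    let ?w = "circle c1 t"
    have wb: "?w \<in> ball c1 \<delta>" using Eb[of "of_real t"] t by (simp add: Et)
    have "?w \<noteq> c1"
    proof
      assume "?w = c1"
      then have "cis t = 1" using c1_nz by (simp add: circle_def cis_conv_exp)
      then have "cos \<bar>t\<bar> = 1" by (simp add: complex_eq_iff)
      moreover have "cos \<bar>t\<bar> < cos 0" by (rule cos_monotone_0_pi) (use t in \<open>auto simp: \<rho>_def\<close>)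
      ultimately show False by simp
    qed
    moreover have "cmod ?w \<le> cmod c1" by (simp add: circle_def norm_mult)
    moreover have "?w \<in> W" using wb nbhd_W by blast
    ultimately have gt: "cmod (h ?w) > cmod c2"
      using minimal[of ?w "h ?w"] branch[of ?w] by linarith
    have "Re (g (of_real t)) = Re (Ln (h ?w / c2))"
    proof -
      have "Re (\<i> * (of_nat \<alpha>1 / of_nat \<alpha>2) * of_real t) = 0"
      proof -
        have "(of_nat \<alpha>1 / of_nat \<alpha>2 :: complex) = of_real (real \<alpha>1 / real \<alpha>2)" by simp
        then show ?thesis by (simp only:) simp
      qed
      then show ?thesis by (simp only: g_def Et plus_complex.sel)
    qed
    also have "\<dots> = ln (cmod (h ?w / c2))" using gt c2_nz by (intro Re_Ln) auto
    also have "\<dots> > 0"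
    proof (rule ln_gt_zero)
      show "1 < cmod (h ?w / c2)" using gt c2_nz by (simp add: norm_divide less_divide_eq)
    qed
    finally show ?thesis .
  qed
  show thesis
  proof (rule that[of \<rho> U g])
    show "\<forall>j. U j holomorphic_on ball 0 \<rho>"
      unfolding U_def by (intro allI comp holomorphic_assoc_u)
    show "\<forall>j t. \<bar>t\<bar> < \<rho> \<longrightarrow> assoc_u_tilde p F h c1 j t = U j (of_real t)"
      by (simp add: assoc_u_tilde_def U_def Et)
    show "\<forall>t. \<bar>t\<bar> < \<rho> \<longrightarrow> assoc_g_tilde h c1 \<alpha>1 \<alpha>2 t = g (of_real t)" using geq by blast
    show "\<forall>t. \<bar>t\<bar> < \<rho> \<and> t \<noteq> 0 \<longrightarrow> Re (g (of_real t)) > 0" using pos by blast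
  qed (rule \<rho> holg g0 dg)+
qed

end

lemma power_bigo_powr:
  assumes "0 < q" "q < (1::real)" "k \<ge> (1::nat)"
  shows "(\<lambda>n. of_real (q ^ (k * n)) :: complex) \<in> O(\<lambda>n. of_real (real n powr e))"
proof -
  have "(\<lambda>n. (q ^ k) ^ n) \<in> O(\<lambda>n. real n powr e)"
  proof -
    have "0 < q ^ k" "q ^ k < 1" using assms by (auto simp: power_less_one_iff)
    then show ?thesis by real_asymp
  qed
  then show ?thesis
    by (subst landau_o.big.norm_iff[symmetric]) (simp add: landau_o.big.norm_iff norm_power power_mult abs_of_pos[OF assms(1)])
qed

context strictly_minimal_nbhd
begin

text \<open>Transfers approximations E j of the Laplace integrals, of whatever form, to the
  coefficients: the polynomial factors raise the error by n^(p-1), and the exponentially small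
  localisation error is absorbed.\<close>

lemma maclaurin_coeff_asymptotics:
  assumes \<alpha>: "\<alpha>1 \<ge> (1::nat)" "\<alpha>2 \<ge> (1::nat)" and \<tau>: "localizing \<tau>"
    and cu: "\<And>j. continuous_on {-\<tau>..\<tau>} (assoc_u_tilde p F h c1 j)"
    and cg: "continuous_on {-\<tau>..\<tau>} (assoc_g_tilde h c1 \<alpha>1 \<alpha>2)"
    and E: "\<And>j. j < p \<Longrightarrow> (\<lambda>x. integral {-\<tau>..\<tau>} (\<lambda>t. assoc_u_tilde p F h c1 j t *
       exp (- (of_real x * assoc_g_tilde h c1 \<alpha>1 \<alpha>2 t))) - E j x) \<in> O[at_top](cpowr e)"
  shows "(\<lambda>n. c1 ^ (n * \<alpha>1) * c2 ^ (n * \<alpha>2) * maclaurin_coeff F (n * \<alpha>1) (n * \<alpha>2) -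
      (\<Sum>j<p. pochhammer (of_nat (\<alpha>2 * n) + 1) (p - 1 - j) / (fact (p - 1 - j) * fact j) * E j (real (\<alpha>2 * n))) / (2 * of_real pi))
    \<in> O(\<lambda>n. of_real (real n powr (real p - 1 + e)))"
proof -
  let ?u = "assoc_u_tilde p F h c1" and ?g = "assoc_g_tilde h c1 \<alpha>1 \<alpha>2"
  let ?P = "\<lambda>n j. pochhammer (of_nat (\<alpha>2 * n) + 1) (p - 1 - j) / (fact (p - 1 - j) * fact j) :: complex"
  let ?c = "\<lambda>n. c1 ^ (n * \<alpha>1) * c2 ^ (n * \<alpha>2) * maclaurin_coeff F (n * \<alpha>1) (n * \<alpha>2)" and ?x = "\<lambda>n. real (\<alpha>2 * n)"
  let ?O = "O(\<lambda>n. complex_of_real (real n powr (real p - 1 + e)))"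
  define I where "I = (\<lambda>j x. integral {-\<tau>..\<tau>} (\<lambda>t. ?u j t * exp (- (of_real x * ?g t))))"
  obtain q C where q: "0 < q" "q < 1" and in\<delta>: "\<forall>t\<in>{-\<tau>..\<tau>}. c1 * cis t \<in> ball c1 \<delta>" and qC:
    "\<And>m n. cmod (2 * of_real pi * (c1 ^ m * c2 ^ n * maclaurin_coeff F m n) -
       c2 ^ n * integral {-\<tau>..\<tau>} (\<lambda>t. singular_part n (c1 * cis t) * cis (- (real m * t)))) \<le> C * q ^ n"
    using \<tau> unfolding localizing_def by meson
  have eqI: "c2 ^ (n * \<alpha>2) * integral {-\<tau>..\<tau>} (\<lambda>t. singular_part (n * \<alpha>2) (c1 * cis t) * cis (- (real (n * \<alpha>1) * t))) =
      (\<Sum>j<p. ?P n j * I j (?x n))" for n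
  proof -
    have pt: "c2 ^ (n * \<alpha>2) * (singular_part (n * \<alpha>2) (c1 * cis t) * cis (- (real (n * \<alpha>1) * t))) =
        (\<Sum>j<p. ?P n j * (?u j t * exp (- (of_real (?x n) * ?g t))))" if t: "t \<in> {-\<tau>..\<tau>}" for t
    proof -
      let ?w = "c1 * cis t"
      have w: "circle c1 t = ?w" by (simp add: circle_def cis_conv_exp)
      have hnz: "h ?w \<noteq> 0" using in\<delta> t nbhd_nz[OF h_in_ball] by blast
      \<comment> \<open>An integer multiple of the logarithm is exponentiated, which gives the power
        of h(w)/c2 whatever the branch; the linear term of g turns into the Fourier factor, since
        \<open>\<alpha>2\<close> cancels.\<close>
      have "exp (- (of_real (?x n) * ?g t)) =
          inverse (exp (of_nat (\<alpha>2 * n) * Ln (h ?w / c2))) * exp (- (of_nat (\<alpha>2 * n) * (\<i> * (of_nat \<alpha>1 / of_nat \<alpha>2) * of_real t)))"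
        unfolding assoc_g_tilde_def w exp_minus[symmetric] exp_add[symmetric]
        by (simp add: circle_def h_c1 algebra_simps)
      also have "exp (of_nat (\<alpha>2 * n) * Ln (h ?w / c2)) = (h ?w / c2) ^ (\<alpha>2 * n)"
        unfolding exp_of_nat_mult using hnz c2_nz by simp
      also have "of_nat (\<alpha>2 * n) * (\<i> * (of_nat \<alpha>1 / of_nat \<alpha>2) * of_real t) = \<i> * of_real (real (n * \<alpha>1) * t)"
        using \<alpha> by (simp add: field_simps)
      also have "exp (- (\<i> * of_real (real (n * \<alpha>1) * t))) = cis (- (real (n * \<alpha>1) * t))"
        by (simp add: cis_conv_exp)
      finally have ex: "exp (- (of_real (?x n) * ?g t)) =
          c2 ^ (n * \<alpha>2) / h ?w ^ (n * \<alpha>2) * cis (- (real (n * \<alpha>1) * t))"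
        by (simp add: power_divide mult.commute)
      let ?X = "c2 ^ (n * \<alpha>2) / h ?w ^ (n * \<alpha>2) * cis (- (real (n * \<alpha>1) * t))"
      have "singular_part (n * \<alpha>2) ?w = (\<Sum>j<p. ?P n j * ?u j t) / h ?w ^ (n * \<alpha>2)"
        unfolding singular_part_def assoc_u_tilde_def w mult.commute[of \<alpha>2 n] ..
      then have "c2 ^ (n * \<alpha>2) * (singular_part (n * \<alpha>2) ?w * cis (- (real (n * \<alpha>1) * t))) =
          (\<Sum>j<p. ?P n j * ?u j t) * ?X" by simp
      also have "\<dots> = (\<Sum>j<p. ?P n j * (?u j t * ?X))"
        by (simp only: sum_distrib_right mult.assoc)
      finally show ?thesis by (simp only: ex)
    qed
    have "c2 ^ (n * \<alpha>2) * integral {-\<tau>..\<tau>} (\<lambda>t. singular_part (n * \<alpha>2) (c1 * cis t) * cis (- (real (n * \<alpha>1) * t))) =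
      integral {-\<tau>..\<tau>} (\<lambda>t. \<Sum>j<p. ?P n j * (?u j t * exp (- (of_real (?x n) * ?g t))))"
      unfolding integral_mult_right[symmetric] by (rule integral_cong) (rule pt)
    also have "\<dots> = (\<Sum>j<p. integral {-\<tau>..\<tau>} (\<lambda>t. ?P n j * (?u j t * exp (- (of_real (?x n) * ?g t)))))"
    proof (rule integral_sum)
      fix j assume "j \<in> {..<p}"
      then have "continuous_on {-\<tau>..\<tau>} (?u j)" using cu by simp
      then show "(\<lambda>t. ?P n j * (?u j t * exp (- (of_real (?x n) * ?g t)))) integrable_on {-\<tau>..\<tau>}"
        by (intro integrable_continuous_interval continuous_intros cg)
    qed simp
    finally show ?thesis by (simp add: I_def)
  qed
  have lim: "filterlim (\<lambda>n. ?x n) at_top sequentially"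
    using \<alpha> by real_asymp
  have Pb: "(\<lambda>n. ?P n j * (I j (?x n) - E j (?x n))) \<in> ?O"
    if j: "j < p" for j
  proof -
    have "(\<lambda>n. I j (?x n) - E j (?x n)) \<in> O(\<lambda>n. cpowr e (?x n))"
      using E j by (intro landau_o.big.compose[OF _ lim]) (simp add: I_def)
    also have "(\<lambda>n. cpowr e (?x n)) \<in> O(\<lambda>n. of_real (real n powr e))"
    proof (rule bigoI[where c = "real \<alpha>2 powr e"])
      show "\<forall>\<^sub>F n in sequentially. cmod (cpowr e (?x n)) \<le> real \<alpha>2 powr e * cmod (of_real (real n powr e))"
        by (rule always_eventually) (simp add: powr_mult norm_mult)
    qed
    finally have 1: "(\<lambda>n. I j (?x n) - E j (?x n)) \<in> O(\<lambda>n. of_real (real n powr e))" .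
    have 2: "(\<lambda>n. ?P n j) \<in> O(\<lambda>n. of_real (real n powr (real p - 1)))"
    proof (rule bigoI[where c = "real (\<alpha>2 + (p - 1 - j)) ^ (p - 1 - j)"])
      show "\<forall>\<^sub>F n in sequentially. cmod (?P n j) \<le> real (\<alpha>2 + (p - 1 - j)) ^ (p - 1 - j) * cmod (of_real (real n powr (real p - 1)))"
        using eventually_ge_at_top[of 1]
      proof eventually_elim
        fix n :: nat assume n: "n \<ge> 1"
        let ?r = "p - 1 - j"
        have "cmod (?P n j) = cmod (pochhammer (of_nat (\<alpha>2 * n) + 1) ?r :: complex) / (fact ?r * fact j)"
          by (simp add: norm_divide norm_mult)
        also have "\<dots> \<le> cmod (pochhammer (of_nat (\<alpha>2 * n) + 1) ?r :: complex) / 1"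
        proof (rule divide_left_mono)
          have "(1::real) * 1 \<le> fact ?r * fact j" by (intro mult_mono) (auto simp: fact_ge_1)
          then show "(1::real) \<le> fact ?r * fact j" by simp
        qed auto
        also have "\<dots> \<le> (real (\<alpha>2 + ?r) * real n) ^ ?r" using norm_pochhammer_le[OF n] by simp
        also have "\<dots> = real (\<alpha>2 + ?r) ^ ?r * real n powr real ?r"
          using n by (simp add: power_mult_distrib powr_realpow)
        also have "\<dots> \<le> real (\<alpha>2 + ?r) ^ ?r * real n powr (real p - 1)"
          by (intro mult_left_mono powr_mono) (use n p_pos in auto)
        finally show "cmod (?P n j) \<le> real (\<alpha>2 + ?r) ^ ?r * cmod (of_real (real n powr (real p - 1)))" by simp
      qed
    qed
    from landau_o.big.mult[OF 2 1] show ?thesis by (simp add: powr_add)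
  qed
  have "(\<lambda>n. (2 * of_real pi * ?c n - (\<Sum>j<p. ?P n j * I j (?x n)))) \<in> ?O"
  proof -
    have "(\<lambda>n. (2 * of_real pi * ?c n - (\<Sum>j<p. ?P n j * I j (?x n)))) \<in> O(\<lambda>n. of_real (q ^ (\<alpha>2 * n)))"
    proof (rule bigoI[where c = C])
      show "\<forall>\<^sub>F n in sequentially. cmod (2 * of_real pi * ?c n - (\<Sum>j<p. ?P n j * I j (?x n))) \<le> C * cmod (of_real (q ^ (\<alpha>2 * n)) :: complex)"
      proof (intro always_eventually allI)
        fix n
        have "cmod (of_real (q ^ (\<alpha>2 * n)) :: complex) = q ^ (n * \<alpha>2)"
          unfolding norm_of_real using q by (simp add: mult.commute)
        then show "cmod (2 * of_real pi * ?c n - (\<Sum>j<p. ?P n j * I j (?x n))) \<le> C * cmod (of_real (q ^ (\<alpha>2 * n)) :: complex)"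
          using qC[of "n * \<alpha>1" "n * \<alpha>2"] unfolding eqI by (simp only:)
      qed
    qed
    also have "(\<lambda>n. of_real (q ^ (\<alpha>2 * n)) :: complex) \<in> ?O"
      by (rule power_bigo_powr[OF q \<alpha>(2)])
    finally show ?thesis .
  qed
  moreover have "(\<lambda>n. \<Sum>j<p. ?P n j * (I j (?x n) - E j (?x n))) \<in> ?O"
    by (rule big_sum_in_bigo) (use Pb in auto)
  ultimately have "(\<lambda>n. (2 * of_real pi * ?c n - (\<Sum>j<p. ?P n j * I j (?x n))) + (\<Sum>j<p. ?P n j * (I j (?x n) - E j (?x n)))) \<in> ?O"
    by (rule sum_in_bigo)
  then have "(\<lambda>n. inverse (2 * of_real pi) * ((2 * of_real pi * ?c n - (\<Sum>j<p. ?P n j * I j (?x n))) + (\<Sum>j<p. ?P n j * (I j (?x n) - E j (?x n))))) \<in> ?O"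
    by (subst landau_o.big.cmult_in_iff) auto
  moreover have "inverse (2 * of_real pi) * ((2 * of_real pi * ?c n - (\<Sum>j<p. ?P n j * I j (?x n))) + (\<Sum>j<p. ?P n j * (I j (?x n) - E j (?x n)))) =
     ?c n - (\<Sum>j<p. ?P n j * E j (?x n)) / (2 * of_real pi)" for n
  proof -
    have alg: "inverse P * ((P * x - y) + (y - z)) = x - z / P" if "P \<noteq> 0" for P x y z :: complex
      using that by (simp add: field_simps)
    have "(\<Sum>j<p. ?P n j * (I j (?x n) - E j (?x n))) =
        (\<Sum>j<p. ?P n j * I j (?x n)) - (\<Sum>j<p. ?P n j * E j (?x n))"
      by (simp only: right_diff_distrib sum_subtractf)
    then show ?thesis by (simp only:) (rule alg, simp)
  qed
  ultimately show "(\<lambda>n. ?c n - (\<Sum>j<p. ?P n j * E j (?x n)) / (2 * of_real pi)) \<in> ?O"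
    by (simp only:)
qed

end

text \<open>For odd v reflection replaces a by - a, and both must have nonnegative real part. This
  is why only imaginary a occur in the odd formula.\<close>

lemma Re_leading_coeff_eq_0:
  fixes r :: "complex \<Rightarrow> complex"
  assumes "\<rho> > 0" "odd v" and holr: "r holomorphic_on ball 0 \<rho>"
    and r0: "\<And>i. i \<le> v \<Longrightarrow> (deriv ^^ i) r 0 = 0"
    and pos: "\<And>t::real. t \<noteq> 0 \<Longrightarrow> \<bar>t\<bar> < \<rho> \<Longrightarrow> Re (a * of_real t ^ v + r (of_real t)) > 0"
  shows "Re a = 0"
proof -
  have "Re a \<ge> 0" by (rule Re_leading_coeff_nonneg[OF \<open>\<rho> > 0\<close> holr r0]) (use pos in auto)
  moreover have "Re (- a) \<ge> 0"
  proof (rule Re_leading_coeff_nonneg[OF \<open>\<rho> > 0\<close> holomorphic_reflect[OF holr]])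
    show "(deriv ^^ i) (\<lambda>z. r (- z)) 0 = 0" if "i \<le> v" for i
      using higher_deriv_reflect_0[OF holr \<open>\<rho> > 0\<close>] r0[OF that] by simp
    show "Re (- a * of_real t ^ v + r (- of_real t)) > 0" if "0 < t" "t < \<rho>" for t
    proof -
      have "a * of_real (- t) ^ v = - a * of_real t ^ v" using \<open>odd v\<close> by simp
      moreover have "0 < Re (a * of_real (- t) ^ v + r (of_real (- t)))"
        using pos[of "- t"] that by simp
      ultimately show ?thesis by (simp only: of_real_minus)
    qed
  qed
  ultimately show ?thesis by simp
qed

section \<open>Assembly of the theorem\<close>

lemma powr_of_real_mult:
  fixes a :: complex
  assumes "x > 0" "a \<noteq> 0"
  shows "(of_real x * a) powr (- 1 / of_nat v) = of_real (x powr (- 1 / real v)) * a powr (- 1 / of_nat v)"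
proof -
  have "Ln (of_real x * a) = of_real (ln x) + Ln a" using assms by (simp add: Ln_times_of_real Ln_of_real)
  then have "(of_real x * a) powr (- 1 / of_nat v) = exp (- 1 / of_nat v * of_real (ln x)) * exp (- 1 / of_nat v * Ln a)"
    using assms by (simp add: powr_def exp_add[symmetric] distrib_left)
  also have "- 1 / of_nat v * of_real (ln x) = complex_of_real (- 1 / real v * ln x)" by simp
  finally show ?thesis unfolding exp_of_real using assms by (simp add: powr_def)
qed

lemma sum_even_terms:
  fixes f :: "nat \<Rightarrow> complex"
  shows "(\<Sum>k<2 * N. f k * (X k + (- 1) ^ k * X k)) = (\<Sum>k<N. f (2 * k) * (2 * X (2 * k)))"
  by (induction N) auto

theorem theorem3p3:
  fixes D V :: "(complex \<times> complex) set"
    and F G H :: "complex \<times> complex \<Rightarrow> complex"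
    and p v \<alpha>1 \<alpha>2 :: nat
    and c1 c2 a :: complex
    and W :: "complex set"
    and h :: "complex \<Rightarrow> complex"
    and u :: "nat \<Rightarrow> real \<Rightarrow> complex"
    and g :: "real \<Rightarrow> complex"
  assumes "open D" and "connected D" and "D \<noteq> {}"
    and "holomorphic2_on G D" and "holomorphic2_on H D"
    and "relatively_prime_on D G H"
    and V: "V = {x \<in> D. H x = 0}"
    and "V \<noteq> {}" and "(0, 0) \<in> D - V"
    and "p \<ge> 1"
    and F: "\<forall>x \<in> D - V. F x = G x / H x ^ p"
    and "\<alpha>1 \<ge> 1" and "\<alpha>2 \<ge> 1"
    and polydisc: "closed_polydisc c1 c2 \<subseteq> D"
    and "strictly_minimal V (c1, c2)"
    and "smooth_point H V (c1, c2)"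
    and "c2 * pd2 H (c1, c2) \<noteq> 0"
    and "critical_point H V \<alpha>1 \<alpha>2 (c1, c2)"
    and "isolated_critical_point H V \<alpha>1 \<alpha>2 (c1, c2)"
    and "implicit_branch H V c1 c2 W h"
    and u: "u = assoc_u_tilde p F h c1"
    and g: "g = assoc_g_tilde h c1 \<alpha>1 \<alpha>2"
    and "v \<ge> 2" and "(ddt ^^ v) g 0 \<noteq> 0"
    and "\<forall>i. 2 \<le> i \<and> i < v \<longrightarrow> (ddt ^^ i) g 0 = 0"
    and a: "a = phase_coeff v g"
  shows "(even v \<longrightarrow> (\<forall>N::nat. \<exists>R \<in> O(\<lambda>n. of_real (real n powr (real p - 1 - real (2 * N + 1) / real v))).
            \<forall>n. maclaurin_coeff F (n * \<alpha>1) (n * \<alpha>2) =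
              inverse (c1 ^ (n * \<alpha>1) * c2 ^ (n * \<alpha>2)) *
              ((a * of_nat \<alpha>2 * of_nat n) powr (- 1 / of_nat v) / (of_real pi * of_nat v) *
                 (\<Sum>j<p. \<Sum>k<N. pochhammer (of_nat (\<alpha>2 * n) + 1) (p - 1 - j) / (fact (p - 1 - j) * fact j) *
                    of_real (real (\<alpha>2 * n) powr (- (2 * real k) / real v)) * L_even v k (u j) g)
               + R n)))
       \<and> (odd v \<longrightarrow> (\<forall>N::nat. \<exists>R \<in> O(\<lambda>n. of_real (real n powr (real p - 1 - real (N + 1) / real v))).
            \<forall>n. maclaurin_coeff F (n * \<alpha>1) (n * \<alpha>2) =
              inverse (c1 ^ (n * \<alpha>1) * c2 ^ (n * \<alpha>2)) *
              (of_real ((cmod a * real \<alpha>2 * real n) powr (- 1 / real v)) / (2 * of_real pi * of_nat v) *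
                 (\<Sum>j<p. \<Sum>k<N. pochhammer (of_nat (\<alpha>2 * n) + 1) (p - 1 - j) / (fact (p - 1 - j) * fact j) *
                    of_real (real (\<alpha>2 * n) powr (- real k / real v)) * L_odd v k (u j) g)
               + R n)))
       \<and> (\<forall>k. \<forall>l\<le>2 * k. derivatives_at_most v (2 * k) (2 * k + v * l) l (scale_even v)
            (L_even_term v k l) {(u j, g) | j. j < p})
       \<and> (\<forall>k. \<forall>l\<le>k. derivatives_at_most v k (k + v * l) l (scale_odd v)
            (L_odd_term v k l) {(u j, g) | j. j < p})"
proof -
  have c2_nz: "c2 \<noteq> 0" and B_nz: "pd2 H (c1, c2) \<noteq> 0" using \<open>c2 * pd2 H (c1, c2) \<noteq> 0\<close> by auto
  have crit: "c1 * pd1 H (c1, c2) / of_nat \<alpha>1 = c2 * pd2 H (c1, c2) / of_nat \<alpha>2"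
    using \<open>critical_point H V \<alpha>1 \<alpha>2 (c1, c2)\<close> by (simp add: critical_point_def)
  have c1_nz: "c1 \<noteq> 0"
  proof
    assume "c1 = 0"
    then have "c2 * pd2 H (c1, c2) / of_nat \<alpha>2 = 0" using crit by simp
    then show False using c2_nz B_nz \<open>\<alpha>2 \<ge> 1\<close> by simp
  qed
  have cV: "(c1, c2) \<in> V" and smin: "\<And>x. x \<in> V \<Longrightarrow> cmod (fst x) \<le> cmod c1 \<Longrightarrow> cmod (snd x) \<le> cmod c2 \<Longrightarrow> x = (c1, c2)"
    using \<open>strictly_minimal V (c1, c2)\<close> by (auto simp: strictly_minimal_def)
  interpret strictly_minimal_branch D F G H p c1 c2 W h
  proof unfold_locales
    show "cball 0 (cmod c1) \<times> cball 0 (cmod c2) \<subseteq> D"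
      using polydisc by (auto simp: closed_polydisc_def)
    fix w y assume "(w, y) \<in> D" "H (w, y) = 0" "cmod w \<le> cmod c1" "cmod y \<le> cmod c2"
    then show "w = c1 \<and> y = c2" using smin[of "(w, y)"] by (simp add: V)
  next
    fix w assume "w \<in> W"
    then have "(w, h w) \<in> V \<and> pd2 H (w, h w) \<noteq> 0"
      using \<open>implicit_branch H V c1 c2 W h\<close> by (simp add: implicit_branch_def)
    then show "(w, h w) \<in> D \<and> H (w, h w) = 0 \<and> pd2 H (w, h w) \<noteq> 0" by (simp add: V)
  qed (use assms(1,4,5,10) cV c1_nz c2_nz B_nz \<open>implicit_branch H V c1 c2 W h\<close> F in \<open>simp_all add: V implicit_branch_def\<close>)
  obtain \<delta> \<epsilon> where "strictly_minimal_nbhd D F G H p c1 c2 W h \<delta> \<epsilon>" using nbhd_exists by blast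
  then interpret strictly_minimal_nbhd D F G H p c1 c2 W h \<delta> \<epsilon> .
  obtain \<rho> U \<gamma> where \<rho>: "\<rho> > 0" and holU: "\<forall>j. U j holomorphic_on ball 0 \<rho>" and hol\<gamma>: "\<gamma> holomorphic_on ball 0 \<rho>"
    and Ueq': "\<forall>j t. \<bar>t\<bar> < \<rho> \<longrightarrow> assoc_u_tilde p F h c1 j t = U j (of_real t)"
    and \<gamma>eq': "\<forall>t. \<bar>t\<bar> < \<rho> \<longrightarrow> assoc_g_tilde h c1 \<alpha>1 \<alpha>2 t = \<gamma> (of_real t)"
    and \<gamma>0: "\<gamma> 0 = 0" "deriv \<gamma> 0 = 0" and pos: "\<forall>t. \<bar>t\<bar> < \<rho> \<and> t \<noteq> 0 \<longrightarrow> Re (\<gamma> (of_real t)) > 0"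
    by (rule tilde_extension[OF \<open>\<alpha>1 \<ge> 1\<close> \<open>\<alpha>2 \<ge> 1\<close> crit])
  have Ueq: "u j t = U j (of_real t)" if "\<bar>t\<bar> < \<rho>" for j t using Ueq' that by (simp add: u)
  have \<gamma>eq: "g t = \<gamma> (of_real t)" if "\<bar>t\<bar> < \<rho>" for t using \<gamma>eq' that by (simp add: g)
  have v1: "v \<ge> 1" using \<open>v \<ge> 2\<close> by simp
  have gd: "(ddt ^^ i) g 0 = (deriv ^^ i) \<gamma> 0" for i
    using ddt_funpow_eq_deriv[OF hol\<gamma> \<gamma>eq, of 0 i] \<rho> by simp
  have a_nz: "a \<noteq> 0" using \<open>(ddt ^^ v) g 0 \<noteq> 0\<close> by (simp add: a phase_coeff_def)
  have low: "(ddt ^^ i) g 0 = 0" if "1 \<le> i" "i < v" for i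
  proof (cases "i = 1")
    case True
    then show ?thesis using gd[of 1] \<gamma>0(2) by simp
  next
    case False
    then show ?thesis using assms(25) that by simp
  qed
  have smg: "smooth_near_0 g" by (rule smooth_near_0_holomorphic[OF hol\<gamma> \<gamma>eq \<rho>])
  have smu: "smooth_near_0 (u j)" for j
    by (rule smooth_near_0_holomorphic[OF holU[rule_format] Ueq \<rho>])
  have phase: "phase_of_order v g"
    using smg low \<open>(ddt ^^ v) g 0 \<noteq> 0\<close> by (simp add: phase_of_order_def)
  \<comment> \<open>The complex extension of the phase rest; its vanishing up to order v is read off
    from the real derivatives in \<open>r0\<close>.\<close>
  define r where "r = (\<lambda>z. \<gamma> z - a * z ^ v)"
  have holr: "r holomorphic_on ball 0 \<rho>" unfolding r_def by (intro holomorphic_intros hol\<gamma>)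
  have g0: "g 0 = 0" using \<gamma>eq[of 0] \<rho> \<gamma>0 by simp
  have rest: "phase_rest v g t = r (of_real t)" if "\<bar>t\<bar> < \<rho>" for t
    using \<gamma>eq[OF that] by (simp add: phase_rest_def r_def g0 a)
  have r0: "(deriv ^^ i) r 0 = 0" if "i \<le> v" for i
  proof -
    have "(deriv ^^ i) r 0 = (ddt ^^ i) (phase_rest v g) 0"
      using ddt_funpow_eq_deriv[OF holr rest, of 0 i] \<rho> by simp
    also have "\<dots> = 0" using ddt_funpow_phase_rest_0[OF phase v1] that by simp
    finally show ?thesis .
  qed
  have D: "(scaled_ddt b ^^ m) (\<lambda>t. u j t * phase_rest v g t ^ l) 0 =
      b ^ m * (deriv ^^ m) (\<lambda>z. U j z * r z ^ l) 0" for b m l j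
  proof -
    have hol: "(\<lambda>z. U j z * r z ^ l) holomorphic_on ball 0 \<rho>" by (intro holomorphic_intros holU[rule_format] holr)
    have eq: "u j t * phase_rest v g t ^ l = U j (of_real t) * r (of_real t) ^ l" if "\<bar>t\<bar> < \<rho>" for t
      using Ueq[OF that] rest[OF that] by simp
    obtain e where e: "e > 0" "smooth_on_interval e (\<lambda>t. u j t * phase_rest v g t ^ l)"
      using smooth_near_0_holomorphic[OF hol eq \<rho>] unfolding smooth_near_0_iff by blast
    show ?thesis
      using scaled_ddt_funpow[OF e(2), where t = 0 and b = b and n = m] ddt_funpow_eq_deriv[OF hol eq, of 0 m] e(1) \<rho> by simp
  qed
  have posr: "Re (a * of_real t ^ v + r (of_real t)) > 0" if "t \<noteq> 0" "\<bar>t\<bar> < \<rho>" for t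
    using pos that by (simp add: r_def)
  define C where "C = (\<lambda>j k. laplace_coeff v (a powr (- 1 / of_nat v)) (U j) r k +
             laplace_coeff v (((- 1) ^ v * a) powr (- 1 / of_nat v)) (\<lambda>z. U j (- z)) (\<lambda>z. r (- z)) k)"
  let ?I = "\<lambda>j d x. integral {-d..d} (\<lambda>t. U j (of_real t) * exp (- (of_real x * (a * of_real t ^ v + r (of_real t)))))"
  have "\<forall>\<^sub>F d in at_right 0. \<forall>j\<in>{..<p}. laplace_expansion (?I j d) v (C j)"
    unfolding C_def
    by (intro eventually_ball_finite ballI laplace_two_sided[OF v1 a_nz \<rho> holU[rule_format] holr r0 posr]) auto
  moreover have "\<forall>\<^sub>F d in at_right 0. 0 < d \<and> d < \<rho>"
    using eventually_at_right_real[OF \<rho>] by (auto elim: eventually_mono)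
  \<comment> \<open>The index set of j is finite, so one interval length serves all expansions and
    the localisation.\<close>
  ultimately have "\<forall>\<^sub>F d in at_right 0. (\<forall>j\<in>{..<p}. laplace_expansion (?I j d) v (C j))
      \<and> (0 < d \<and> d < \<rho>) \<and> localizing d"
    using eventually_localizing by eventually_elim blast
  from eventually_happens'[OF trivial_limit_at_right_real this]
  obtain d where exp0: "\<forall>j\<in>{..<p}. laplace_expansion (?I j d) v (C j)"
    and d: "0 < d" "d < \<rho>" "localizing d" by blast
  have d\<rho>: "\<bar>t\<bar> < \<rho>" if "t \<in> {-d..d}" for t using that d by auto
  have contd: "continuous_on {-d..d} (\<lambda>t. f (complex_of_real t))" if "f holomorphic_on ball 0 \<rho>" for f
    by (rule continuous_on_compose2[OF holomorphic_on_imp_continuous_on[OF that]])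
       (use d\<rho> in \<open>auto intro!: continuous_intros\<close>)
  have cu: "continuous_on {-d..d} (u j)" for j
    using contd[OF holU[rule_format]] Ueq[OF d\<rho>] by (metis (no_types, lifting) continuous_on_cong)
  have cg: "continuous_on {-d..d} g"
    using contd[OF hol\<gamma>] \<gamma>eq[OF d\<rho>] by (metis (no_types, lifting) continuous_on_cong)
  let ?S = "\<lambda>j M x. \<Sum>k<M. cpowr (- (real (k + 1) / real v)) x * C j k"
  have exp1: "(\<lambda>x. integral {-d..d} (\<lambda>t. u j t * exp (- (of_real x * g t))) - ?S j M x)
      \<in> O[at_top](cpowr (- (real (M + 1) / real v)))" if "j < p" for j M
  proof -
    have "integral {-d..d} (\<lambda>t. u j t * exp (- (of_real x * g t))) = ?I j d x" for x
      by (rule integral_cong) (simp add: Ueq[OF d\<rho>] \<gamma>eq[OF d\<rho>] r_def)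
    then show ?thesis using exp0 that by (simp add: laplace_expansion_def)
  qed
  let ?F = "\<lambda>n. maclaurin_coeff F (n * \<alpha>1) (n * \<alpha>2)" and ?c = "\<lambda>n. c1 ^ (n * \<alpha>1) * c2 ^ (n * \<alpha>2)"
  let ?P = "\<lambda>n j. pochhammer (of_nat (\<alpha>2 * n) + 1) (p - 1 - j) / (fact (p - 1 - j) * fact j) :: complex"
  have main: "(\<lambda>n. ?c n * ?F n - (\<Sum>j<p. ?P n j * ?S j M (real (\<alpha>2 * n))) / (2 * of_real pi))
       \<in> O(\<lambda>n. of_real (real n powr (real p - 1 - real (M + 1) / real v)))" for M
    using maclaurin_coeff_asymptotics[OF \<open>\<alpha>1 \<ge> 1\<close> \<open>\<alpha>2 \<ge> 1\<close> d(3) cu[unfolded u] cg[unfolded g] exp1[unfolded u g]] by simp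
  have nz: "?c n \<noteq> 0" for n using c1_nz c2_nz by simp
  \<comment> \<open>The formula is to hold for every n, so R is defined as the exact difference. The
    two main terms need to agree only for n >= 1, where \<open>\<alpha>2 * n\<close> is positive and
    \<open>powr\<close> splits; a single value does not affect the order of R.\<close>
  have conclude: "\<exists>R\<in>O(\<lambda>n. of_real (real n powr e)). \<forall>n. ?F n = inverse (?c n) * (X n + R n)"
    if "(\<lambda>n. ?c n * ?F n - Y n) \<in> O(\<lambda>n. of_real (real n powr e))"
      "\<And>n. n \<ge> 1 \<Longrightarrow> X n = Y n" for X Y e
  proof (rule bexI[where x = "\<lambda>n. ?c n * ?F n - X n"])
    show "\<forall>n. ?F n = inverse (?c n) * (X n + (?c n * ?F n - X n))"
    proof
      fix n
      have "x = inverse y * (z + (y * x - z))" if "y \<noteq> 0" for x y z :: complex using that by simp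
      from this[OF nz] show "?F n = inverse (?c n) * (X n + (?c n * ?F n - X n))" .
    qed
    have "\<forall>\<^sub>F n in sequentially. ?c n * ?F n - X n = ?c n * ?F n - Y n"
      using eventually_ge_at_top[of 1] by eventually_elim (simp add: that(2))
    from landau_o.big.in_cong[OF this] that(1)
    show "(\<lambda>n. ?c n * ?F n - X n) \<in> O(\<lambda>n. of_real (real n powr e))"
      by blast
  qed
  have x_pos: "real (\<alpha>2 * n) > 0" if "n \<ge> 1" for n using that \<open>\<alpha>2 \<ge> 1\<close> by simp
  have powr_split: "x powr (- (real (k + 1) / real v)) = x powr (- 1 / real v) * x powr (- (real k / real v))" for x k
    by (simp add: powr_add[symmetric] add_divide_distrib)
  have smooth_phase: "smooth_near_0 u' \<and> phase_of_order v g'" if "(u', g') \<in> {(u j, g) | j. j < p}" for u' g'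
    using that smu phase by auto
  show ?thesis
  proof (intro conjI impI allI, goal_cases)
    case (1 N)
    have Ceq: "C j k = laplace_coeff v (a powr (- 1 / of_nat v)) (U j) r k + (- 1) ^ k * laplace_coeff v (a powr (- 1 / of_nat v)) (U j) r k" for j k
      unfolding C_def laplace_coeff_reflect_even[OF holU[rule_format] holr \<rho> 1] using 1 by simp
    have Leq: "laplace_coeff v (a powr (- 1 / of_nat v)) (U j) r (2 * k) = a powr (- 1 / of_nat v) / of_nat v * L_even v k (u j) g" for j k
      by (rule laplace_coeff_even[OF D a])
    \<comment> \<open>Truncation at 2N keeps the N even indices below 2N and gives the error
      exponent (2N+1)/v.\<close>
    show ?case
    proof (rule conclude[OF main[of "2 * N"]])
      fix n :: nat assume n: "n \<ge> 1"
      define x where "x = real (\<alpha>2 * n)"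
      have x: "x > 0" using x_pos[OF n] by (simp add: x_def)
      have "a * of_nat \<alpha>2 * of_nat n = of_real x * a" by (simp add: x_def)
      then have pref: "(a * of_nat \<alpha>2 * of_nat n) powr (- 1 / of_nat v) = of_real (x powr (- 1 / real v)) * a powr (- 1 / of_nat v)"
        using powr_of_real_mult[OF x a_nz] by (simp only:)
      have "(\<Sum>k<2 * N. cpowr (- (real (k + 1) / real v)) x * C j k) =
          (\<Sum>k<N. cpowr (- (real (2 * k + 1) / real v)) x * (2 * (a powr (- 1 / of_nat v) / of_nat v * L_even v k (u j) g)))" for j
        unfolding Ceq by (subst sum_even_terms) (simp only: Leq)
      also have "\<dots> j = 2 * (of_real (x powr (- 1 / real v)) * a powr (- 1 / of_nat v)) / of_nat v *
          (\<Sum>k<N. of_real (x powr (- (2 * real k) / real v)) * L_even v k (u j) g)" for j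
        unfolding powr_split sum_distrib_left by (rule sum.cong) (simp_all add: mult_ac)
      finally have inner: "(\<Sum>k<2 * N. cpowr (- (real (k + 1) / real v)) x * C j k) =
          2 * (of_real (x powr (- 1 / real v)) * a powr (- 1 / of_nat v)) / of_nat v *
          (\<Sum>k<N. of_real (x powr (- (2 * real k) / real v)) * L_even v k (u j) g)" for j .
      show "(a * of_nat \<alpha>2 * of_nat n) powr (- 1 / of_nat v) / (of_real pi * of_nat v) *
                 (\<Sum>j<p. \<Sum>k<N. ?P n j * of_real (real (\<alpha>2 * n) powr (- (2 * real k) / real v)) * L_even v k (u j) g) =
        (\<Sum>j<p. ?P n j * (\<Sum>k<2 * N. cpowr (- (real (k + 1) / real v)) (real (\<alpha>2 * n)) * C j k)) / (2 * of_real pi)"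
        unfolding pref x_def[symmetric] inner sum_divide_distrib sum_distrib_left mult.assoc[of _ "of_real _" "L_even _ _ _ _"]
        by (intro sum.cong refl) (simp add: mult_ac)
    qed
  next
    case (2 N)
    \<comment> \<open>From here on the roots of a and - a are the powers of zeta in
      \<open>L_odd\<close>.\<close>
    have Re0: "Re a = 0" by (rule Re_leading_coeff_eq_0[OF \<rho> 2 holr r0 posr])
    have Ceq: "C j k = of_real (cmod a powr (- 1 / real v)) / of_nat v * L_odd v k (u j) g" for j k
      unfolding C_def by (rule laplace_coeff_odd_sum[OF holU[rule_format] holr \<rho> 2 Re0 a_nz D a])
    show ?case
    proof (rule conclude[OF main[of N]])
      fix n :: nat assume n: "n \<ge> 1"
      define x where "x = real (\<alpha>2 * n)"
      have x: "x > 0" using x_pos[OF n] by (simp add: x_def)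
      have "cmod a * real \<alpha>2 * real n = x * cmod a" by (simp add: x_def)
      then have pref: "(cmod a * real \<alpha>2 * real n) powr (- 1 / real v) = x powr (- 1 / real v) * cmod a powr (- 1 / real v)"
        using x by (simp only: powr_mult)
      have inner: "(\<Sum>k<N. cpowr (- (real (k + 1) / real v)) x * C j k) =
          of_real (x powr (- 1 / real v) * cmod a powr (- 1 / real v)) / of_nat v *
          (\<Sum>k<N. of_real (x powr (- real k / real v)) * L_odd v k (u j) g)" for j
        unfolding Ceq powr_split sum_distrib_left by (rule sum.cong) (simp_all add: mult_ac)
      show "of_real ((cmod a * real \<alpha>2 * real n) powr (- 1 / real v)) / (2 * of_real pi * of_nat v) *
                 (\<Sum>j<p. \<Sum>k<N. ?P n j * of_real (real (\<alpha>2 * n) powr (- real k / real v)) * L_odd v k (u j) g) =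
        (\<Sum>j<p. ?P n j * (\<Sum>k<N. cpowr (- (real (k + 1) / real v)) (real (\<alpha>2 * n)) * C j k)) / (2 * of_real pi)"
        unfolding pref x_def[symmetric] inner sum_divide_distrib sum_distrib_left mult.assoc[of _ "of_real _" "L_odd _ _ _ _"]
        by (intro sum.cong refl) (simp add: mult_ac)
    qed
  next
    case (3 k l)
    show ?case
      by (rule derivatives_at_most_leibniz[OF v1 smooth_phase], assumption, unfold L_even_term_def, rule refl)
  next
    case (4 k l)
    show ?case
      by (rule derivatives_at_most_leibniz[OF v1 smooth_phase], assumption, unfold L_odd_term_def, rule refl)
  qed
qed

end
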